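(* Let $X=\Gamma^4(1/4)$ and $Y=\pi^{-1}$. For all integers $m\geq 1$ and $p\geq \lfloor m/2\rfloor$, the integral \[ \int_0^\infty \frac{x^{4p+1}\, dx}{(\cos x+\cosh x)^{m}} \] belongs to $\mathbb{Q}[X,Y]$; more precisely, it equals a finite sum $\sum c_{\alpha,\beta} X^\alpha Y^\beta$ with $c_{\alpha,\beta}\in\mathbb{Q}$, in which every exponent $\alpha$ of $X$ has the same parity as $m$ and satisfies $2p-m+2\le \alpha\le 2p+m$, and every exponent $\beta$ of $Y$ satisfies $2p-m+2\le \beta\le 2p+3m-2$.
   Context: $\Gamma$ denotes Euler's gamma function. *)

theory Defs
  imports "HOL-Analysis.Analysis"
begin

text \<open>The subring \<open>\<rat>[x, y]\<close> of the reals generated over the rationals by two real numbers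
  (not a formal polynomial ring).\<close>

definition rat_adjoin2 :: "real \<Rightarrow> real \<Rightarrow> real set" where
  "rat_adjoin2 x y =
     {\<Sum>(\<alpha>, \<beta>)\<in>S. of_rat (c \<alpha> \<beta>) * x ^ \<alpha> * y ^ \<beta> | (S :: (nat \<times> nat) set) (c :: nat \<Rightarrow> nat \<Rightarrow> rat). finite S}"

end

theory Submission
  imports Defs "HOL-Complex_Analysis.Complex_Analysis"
begin

text \<open>
  Along the rays at angles \<open>\<mp>\<pi>/4\<close> the integral becomes, up to a rational multiple of \<open>\<pi>\<close>, the sum of the
  residues of \<open>z ^ (4 p + 1) (sec z sech z) ^ m\<close> at the positive zeros \<open>z = (2 n + 1) \<pi> / 2\<close> of the cosine.
  Integrations by parts lower the order of the poles to 1 (\<open>m\<close> odd) or 2 (\<open>m\<close> even), which leaves sums of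
  \<open>(-1) ^ n z ^ a sech\<^sup>(\<^sup>b\<^sup>) z\<close>, respectively \<open>z ^ a (sech\<^sup>2)\<^sup>(\<^sup>b\<^sup>) z\<close>, over these zeros.

  Let \<open>C(v)\<close> be the sum of \<open>sech ((2 n + 1) t) e ^ (\<i> (2 n + 1) v)\<close> and \<open>\<Psi>(w)\<close> that of
  \<open>\<i> (tanh ((2 n + 1) t) - sgn (2 n + 1)) e ^ (\<i> (2 n + 1) w)\<close> over all integers \<open>n\<close>. The sums above are derivatives
  in \<open>t\<close>, at \<open>t = \<pi>/2\<close>, of the Taylor coefficients of \<open>C\<close> at \<open>\<pi>/2\<close> and of \<open>\<Psi>\<close> at 0. Multiplying the
  series and telescoping gives \<open>C'' = K C - 2 C\<^sup>3\<close> and \<open>C(\<pi>/2 + w) (1 - sin w \<Psi>(w)) = L sin w\<close> with \<open>L = C'(\<pi>/2)\<close>.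
  With the sum \<open>e\<close> of \<open>sech ((2 n + 1) t) ^ 2\<close>, derivatives in \<open>t\<close> satisfy \<open>L' = (K - 2 e) L\<close>, \<open>K' = - 2 e K - 4 L\<^sup>2\<close>,
  \<open>e' = - e\<^sup>2 - L\<^sup>2\<close>. So all quantities are isobaric polynomials in \<open>L, K, e\<close> with rational coefficients.

  At \<open>t = \<pi>/2\<close> contour integration gives \<open>K = 0\<close> and \<open>e = 1/\<pi>\<close>. Then \<open>C\<close> solves the lemniscate equation
  with quarter period \<open>\<pi>/2\<close>, and the Beta integral for this period yields \<open>L = \<plusminus> \<Gamma>(1/4)\<^sup>4 / (8 \<pi>\<^sup>3)\<close>.
\<close>

subsection \<open>Sums over the integers and Fourier series\<close>

text \<open>The exponent ranges come from two gradings. Give each of \<open>L\<close>,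
  \<open>K\<close>, \<open>e\<close> weight 1 and call the degree in \<open>e\<close> the depth. A
  derivative in \<open>t\<close> raises the weight by one and the depth by at most one, and it
  changes the degree in \<open>L\<close> by an even number. At \<open>t = \<pi>/2\<close> a monomial
  \<open>L^i e^l\<close> is a rational multiple of \<open>X^i Y^(3 i + l)\<close>; with
  \<open>i + l\<close> known, bounding the depth \<open>l\<close> bounds both exponents. The parity
  of \<open>i\<close> is that of \<open>m\<close>, because the Taylor coefficients of
  \<open>C\<close> are odd in \<open>L\<close> and those of \<open>\<Psi>\<close> are, up to
  constants, even. The expansion points reflect the residues: a simple pole of the secant carries a
  sign \<open>(-1)^n\<close>, which is what evaluation at \<open>\<pi>/2\<close> produces, and a
  double pole carries none, which calls for evaluation at 0. \<open>C\<close> is a multiple of the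
  Jacobi function cn with nome \<open>exp (-2 t)\<close>, and \<open>t = \<pi>/2\<close> is the
  lemniscatic case; its symmetry under multiplication by \<open>\<i>\<close> makes \<open>K\<close>
  vanish there. As \<open>K\<close> arises as a quotient by \<open>L\<close>, the work takes place
  where \<open>L \<noteq> 0\<close>; at \<open>\<pi>/2\<close> this follows from the positivity of
  the integral for \<open>m = 1\<close>, \<open>p = 0\<close>.\<close>

lemma summable_on_int_iff_nat:
  fixes f :: "int \<Rightarrow> 'a::banach"
  assumes "(\<lambda>n. f (int n)) summable_on UNIV" "(\<lambda>n. f (- int n)) summable_on UNIV"
  shows "f summable_on UNIV"
proof -
  have "f summable_on {0..}"
    using assms(1) by (subst summable_on_reindex_bij_witness[of _ int nat UNIV "\<lambda>n. f (int n)"]) auto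
  moreover have "f summable_on {..<0}"
  proof -
    have "(\<lambda>n. f (- int n)) summable_on {0<..}"
      by (rule summable_on_subset_banach[OF assms(2)]) auto
    thus ?thesis
      by (subst summable_on_reindex_bij_witness[of _ "\<lambda>n. - int n" "\<lambda>k. nat (-k)" "{0<..}" "\<lambda>n. f (- int n)"]) auto
  qed
  ultimately have "f summable_on ({0..} \<union> {..<0})"
    by (rule summable_on_Un_disjoint) auto
  moreover have "{0::int..} \<union> {..<0} = UNIV" by auto
  ultimately show ?thesis by simp
qed

lemma summable_on_power_exp_int:
  fixes \<rho> :: real
  assumes "\<rho> > 0"
  shows "(\<lambda>n::int. \<bar>of_int n\<bar> ^ k * exp (- \<rho> * \<bar>of_int n\<bar>)) summable_on UNIV"
proof -
  \<comment> \<open>The bound \<open>x \<le> exp (\<epsilon> x) / \<epsilon>\<close>, raised to the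
    power \<open>k\<close>, costs \<open>exp (k \<epsilon> x)\<close>; this choice keeps the cost
    below half of the decay, also for \<open>k = 0\<close>.\<close>
  define \<epsilon> where "\<epsilon> = \<rho> / (2 * (real k + 1))"
  have \<epsilon>: "\<epsilon> > 0" "real k * \<epsilon> \<le> \<rho> / 2"
    using assms by (auto simp: \<epsilon>_def field_simps)
  have "summable (\<lambda>n. norm (real n ^ k * exp (- \<rho> * real n)))"
  proof (rule summable_comparison_test', rule summable_mult)
    show "summable (\<lambda>n. exp (- \<rho> / 2) ^ n)"
      using assms by (auto intro!: summable_geometric)
    fix n :: nat
    have "\<epsilon> * real n \<le> exp (\<epsilon> * real n)"
      using exp_ge_add_one_self[of "\<epsilon> * real n"] by linarith
    hence "(\<epsilon> * real n) ^ k \<le> exp (\<epsilon> * real n) ^ k"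
      using \<epsilon> by (intro power_mono) auto
    hence "real n ^ k \<le> (1 / \<epsilon>) ^ k * exp (real k * \<epsilon> * real n)"
      using \<epsilon> by (simp add: power_mult_distrib exp_of_nat_mult[symmetric] field_simps)
    also have "\<dots> \<le> (1 / \<epsilon>) ^ k * exp (\<rho> / 2 * real n)"
      using \<epsilon> mult_right_mono[OF \<epsilon>(2), of "real n"] by (intro mult_left_mono) auto
    finally have "real n ^ k * exp (- \<rho> * real n) \<le> (1 / \<epsilon>) ^ k * exp (\<rho> / 2 * real n) * exp (- \<rho> * real n)"
      by (rule mult_right_mono) auto
    also have "\<dots> = (1 / \<epsilon>) ^ k * exp (- \<rho> / 2) ^ n"
      unfolding mult.assoc exp_of_nat_mult[symmetric] exp_add[symmetric] by (simp add: field_simps)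
    finally show "norm (norm (real n ^ k * exp (- \<rho> * real n))) \<le> (1 / \<epsilon>) ^ k * exp (- \<rho> / 2) ^ n"
      by simp
  qed
  hence *: "(\<lambda>n. real n ^ k * exp (- \<rho> * real n)) summable_on UNIV"
    by (rule norm_summable_imp_summable_on)
  show ?thesis
    by (rule summable_on_int_iff_nat) (use * in simp_all)
qed

lemma summable_on_exp_int:
  fixes \<rho> :: real
  assumes "\<rho> > 0"
  shows "(\<lambda>n::int. exp (- \<rho> * \<bar>of_int n\<bar>)) summable_on UNIV"
  using summable_on_power_exp_int[OF assms, of 0] by simp

text \<open>Cauchy product over the integers: the family \<open>f n * g m\<close> is absolutely
  summable on pairs, so it may be regrouped along the antidiagonals
  \<open>n + m = N\<close>.\<close>

lemma infsum_int_convolution: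
  fixes f g :: "int \<Rightarrow> complex"
  assumes f: "f summable_on UNIV" and g: "g summable_on UNIV"
  shows "((\<lambda>N. \<Sum>\<^sub>\<infinity>n. f n * g (N - n)) has_sum infsum f UNIV * infsum g UNIV) UNIV"
    and "(\<lambda>n. f n * g (N - n)) summable_on UNIV"
proof -
  have af: "(\<lambda>x. norm (f x)) summable_on UNIV" and ag: "(\<lambda>x. norm (g x)) summable_on UNIV"
    using f g by (simp_all add: summable_on_iff_abs_summable_on_complex)
  have "(\<lambda>p. norm (case p of (n, m) \<Rightarrow> f n * g m)) summable_on (UNIV \<times> UNIV)"
  proof (subst Infinite_Sum.abs_summable_on_Sigma_iff, intro conjI ballI)
    show "(\<lambda>m. norm (case (n, m) of (n, m) \<Rightarrow> f n * g m)) summable_on UNIV" for n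
      using summable_on_cmult_right[OF ag] by (simp add: norm_mult)
    have "(\<lambda>n. norm (f n) * (\<Sum>\<^sub>\<infinity>m. norm (g m))) summable_on UNIV"
      by (rule summable_on_cmult_left[OF af])
    thus "(\<lambda>n. norm (\<Sum>\<^sub>\<infinity>m. norm (case (n, m) of (n, m) \<Rightarrow> f n * g m))) summable_on UNIV"
      using ag by (simp add: norm_mult infsum_cmult_right infsum_nonneg abs_mult)
  qed
  hence *: "(\<lambda>(n, m). f n * g m) summable_on (UNIV \<times> UNIV)"
    by (rule abs_summable_summable)
  have "((\<lambda>(n, m). f n * g m) has_sum infsum f UNIV * infsum g UNIV) (UNIV \<times> UNIV)"
    by (rule has_sum_SigmaI[OF _ _ *, of "\<lambda>n. f n * infsum g UNIV"])
       (use f g in \<open>auto intro!: has_sum_cmult_right has_sum_cmult_left\<close>)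
  hence 1: "((\<lambda>(N, n). f n * g (N - n)) has_sum infsum f UNIV * infsum g UNIV) (UNIV \<times> UNIV)"
    by (subst (asm) has_sum_reindex_bij_witness[of _ "\<lambda>(N, n). (n, N - n)" "\<lambda>(n, m). (n + m, n)"
         "UNIV \<times> UNIV" "\<lambda>(N, n). f n * g (N - n)"]) auto
  show 2: "(\<lambda>n. f n * g (N - n)) summable_on UNIV" for N
    using summable_on_SigmaD1[of "\<lambda>N n. f n * g (N - n)" UNIV "\<lambda>_. UNIV" N] has_sum_imp_summable[OF 1]
    by simp
  show "((\<lambda>N. \<Sum>\<^sub>\<infinity>n. f n * g (N - n)) has_sum infsum f UNIV * infsum g UNIV) UNIV"
    by (rule has_sum_SigmaD[OF 1]) (use 2 in auto)
qed

text \<open>The M-test gives uniform convergence along the net of finite index sets, and uniform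
  limits of holomorphic functions may be differentiated any number of times. With this net the sums
  stay unordered and can be reindexed freely.\<close>

lemma termwise_higher_deriv:
  fixes f :: "'i \<Rightarrow> complex \<Rightarrow> complex"
  assumes A: "open A" and hol: "\<And>k. f k holomorphic_on A"
    and bound: "\<And>k x. x \<in> A \<Longrightarrow> norm (f k x) \<le> M k" and M: "M summable_on UNIV"
  shows "(\<lambda>x. \<Sum>\<^sub>\<infinity>k. f k x) holomorphic_on A"
    and "z \<in> A \<Longrightarrow> ((\<lambda>k. (deriv ^^ n) (f k) z) has_sum (deriv ^^ n) (\<lambda>x. \<Sum>\<^sub>\<infinity>k. f k x) z) UNIV"
proof -
  have u: "uniform_limit A (\<lambda>X y. \<Sum>x\<in>X. f x y) (\<lambda>y. \<Sum>\<^sub>\<infinity>x. f x y) (finite_subsets_at_top UNIV)"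
    by (rule Weierstrass_m_test_general[OF bound M]) auto
  show "(\<lambda>x. \<Sum>\<^sub>\<infinity>k. f k x) holomorphic_on A"
    unfolding holomorphic_on_open[OF A]
  proof
    fix z assume "z \<in> A"
    then obtain r where r: "r > 0" "cball z r \<subseteq> A"
      using A by (meson open_contains_cball)
    have r': "ball z r \<subseteq> A" using r(2) by auto
    have "(\<lambda>x. \<Sum>\<^sub>\<infinity>k. f k x) holomorphic_on ball z r"
    proof (rule holomorphic_uniform_limit)
      show "uniform_limit (cball z r) (\<lambda>X y. \<Sum>x\<in>X. f x y) (\<lambda>y. \<Sum>\<^sub>\<infinity>x. f x y) (finite_subsets_at_top UNIV)"
        by (rule uniform_limit_on_subset[OF u r(2)])
      show "\<forall>\<^sub>F X in finite_subsets_at_top UNIV. continuous_on (cball z r) (\<lambda>y. \<Sum>x\<in>X. f x y) \<and>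
              (\<lambda>y. \<Sum>x\<in>X. f x y) holomorphic_on ball z r"
        by (intro always_eventually allI conjI holomorphic_on_imp_continuous_on holomorphic_on_sum)
           (use holomorphic_on_subset[OF hol r(2)] holomorphic_on_subset[OF hol r'] in auto)
    qed auto
    thus "\<exists>f'. ((\<lambda>x. \<Sum>\<^sub>\<infinity>k. f k x) has_field_derivative f') (at z)"
      using r(1) by (auto simp: holomorphic_on_open)
  qed
  show "((\<lambda>k. (deriv ^^ n) (f k) z) has_sum (deriv ^^ n) (\<lambda>x. \<Sum>\<^sub>\<infinity>k. f k x) z) UNIV" if z: "z \<in> A"
  proof -
    have "((\<lambda>X. (deriv ^^ n) (\<lambda>y. \<Sum>x\<in>X. f x y) z) \<longlongrightarrow> (deriv ^^ n) (\<lambda>y. \<Sum>\<^sub>\<infinity>x. f x y) z)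
            (finite_subsets_at_top UNIV)"
      by (rule higher_deriv_complex_uniform_limit[OF u _ _ A z])
         (auto intro!: always_eventually holomorphic_on_sum hol)
    moreover have "(deriv ^^ n) (\<lambda>y. \<Sum>x\<in>X. f x y) z = (\<Sum>x\<in>X. (deriv ^^ n) (f x) z)" if "finite X" for X
      using that
    proof (induction X rule: finite_induct)
      case (insert x X)
      thus ?case
        by (simp, subst higher_deriv_add[OF _ _ A z]) (auto intro!: holomorphic_on_sum hol)
    qed auto
    ultimately show ?thesis
      unfolding has_sum_def
      by (elim Lim_transform_eventually) (auto simp: eventually_finite_subsets_at_top_weakI)
  qed
qed

text \<open>On odd frequencies \<open>n \<mapsto> -1 - n\<close> is
  \<open>2 n + 1 \<mapsto> -(2 n + 1)\<close>. It exchanges negative and nonnegative indices, so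
  each half carries half of the sum. This is the passage from all odd frequencies to the positive
  zeros of the cosine.\<close>

lemma has_sum_int_symmetric_partial_sums:
  fixes f :: "int \<Rightarrow> complex"
  assumes "(f has_sum S) UNIV" and "\<And>n. f (- 1 - n) = f n"
  shows "(\<lambda>n. f (int n)) sums (S / 2)"
proof -
  have *: "f summable_on X" for X
    using assms(1) by (meson has_sum_imp_summable subset_UNIV summable_on_subset_banach)
  have U: "UNIV = {0::int..} \<union> {..<0}" by auto
  obtain a where a: "(f has_sum a) {0..}"
    using * by (meson summable_on_def)
  hence "(f has_sum a) {..<0}"
    by (subst has_sum_reindex_bij_witness[of _ "\<lambda>n. -1 - n" "\<lambda>n. -1 - n" "{0..}" f]) (use assms in auto)
  hence "(f has_sum (a + a)) ({0..} \<union> {..<0})"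
    by (intro has_sum_Un_disjoint a) auto
  hence S: "S = a + a" using assms(1) U by (metis has_sum_unique)
  have "((\<lambda>n. f (int n)) has_sum a) UNIV"
    using a by (subst has_sum_reindex_bij_witness[of _ nat int "{0..}" f]) auto
  thus ?thesis using S by (simp add: has_sum_imp_sums)
qed

lemma has_sum_int_reflect:
  assumes "(f has_sum S) (UNIV :: int set)"
  shows "((\<lambda>n. f (c - n)) has_sum S) UNIV"
  using assms by (subst has_sum_reindex_bij_witness[of _ "\<lambda>n. c - n" "\<lambda>n. c - n" UNIV f]) auto

lemma has_sum_int_shift:
  assumes "(f has_sum S) (UNIV :: int set)"
  shows "((\<lambda>n. f (n + c)) has_sum S) UNIV"
  using assms by (subst has_sum_reindex_bij_witness[of _ "\<lambda>n. n - c" "\<lambda>n. n + c" UNIV f]) auto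

lemma has_sum_int_odd:
  fixes f :: "int \<Rightarrow> complex"
  assumes "f summable_on UNIV" "\<And>n. f (- n) = - f n"
  shows "(f has_sum 0) UNIV"
proof -
  obtain S where S: "(f has_sum S) UNIV" using assms(1) by (auto simp: summable_on_def)
  have "((\<lambda>n. - f n) has_sum S) UNIV"
    using has_sum_int_reflect[OF S, of 0] assms(2) by simp
  hence "((\<lambda>n. - f n) has_sum S) UNIV \<and> ((\<lambda>n. - f n) has_sum - S) UNIV"
    using S by (auto intro: has_sum_uminusI)
  hence "S = - S" using has_sum_unique by blast
  thus ?thesis using S by simp
qed

lemma has_sum_int_finite:
  fixes f :: "int \<Rightarrow> complex"
  assumes "finite A" "\<And>n. n \<notin> A \<Longrightarrow> f n = 0" "S = sum f A"
  shows "(f has_sum S) UNIV"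
  by (rule has_sum_finite_neutralI[of A]) (use assms in auto)

lemma int_bidirectional_induct:
  assumes "P (0::int)" "\<And>n. P (n + 1) \<longleftrightarrow> P n"
  shows "P n"
proof (induction n rule: int_induct[of _ 0])
  case (step2 i)
  thus ?case using assms(2)[of "i - 1"] by simp
qed (use assms in simp_all)

text \<open>A function on the integers that decays like \<open>exp (-\<rho>\<bar>\<omega> n\<bar>)\<close>, up to a loss in the exponent
  that absorbs polynomial factors.\<close>

definition exp_decay :: "real \<Rightarrow> (int \<Rightarrow> int) \<Rightarrow> (int \<Rightarrow> complex) \<Rightarrow> bool" where
  "exp_decay \<rho> \<omega> a \<longleftrightarrow> (\<forall>\<delta>. 0 < \<delta> \<and> \<delta> < \<rho> \<longrightarrow> (\<exists>M. \<forall>n. norm (a n) \<le> M * exp (- \<delta> * \<bar>of_int (\<omega> n)\<bar>)))"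

lemma exp_decayI:
  assumes "\<And>n. norm (a n) \<le> M * exp (- \<rho> * \<bar>of_int (\<omega> n)\<bar>)"
  shows "exp_decay \<rho> \<omega> a"
  unfolding exp_decay_def
proof (intro allI impI exI)
  fix \<delta> n assume \<delta>: "0 < \<delta> \<and> \<delta> < \<rho>"
  have "0 \<le> M * exp (- \<rho> * \<bar>of_int (\<omega> n)\<bar>)" using assms[of n] norm_ge_zero order_trans by blast
  hence M: "M \<ge> 0" by (simp add: zero_le_mult_iff)
  have "exp (- \<rho> * \<bar>of_int (\<omega> n)\<bar>) \<le> exp (- \<delta> * \<bar>of_int (\<omega> n)\<bar>)"
    using \<delta> by (auto intro!: mult_right_mono)
  thus "norm (a n) \<le> M * exp (- \<delta> * \<bar>of_int (\<omega> n)\<bar>)"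
    using assms[of n] M by (meson mult_left_mono order_trans)
qed

lemma exp_decay_mult_bounded:
  assumes a: "exp_decay \<rho> \<omega> a" and b: "\<And>n. norm (b n) \<le> B"
  shows "exp_decay \<rho> \<omega> (\<lambda>n. b n * a n)"
  unfolding exp_decay_def
proof (intro allI impI)
  fix \<delta> :: real assume \<delta>: "0 < \<delta> \<and> \<delta> < \<rho>"
  obtain M where M: "\<forall>n. norm (a n) \<le> M * exp (- \<delta> * \<bar>of_int (\<omega> n)\<bar>)"
    using assms \<delta> unfolding exp_decay_def by blast
  have "norm (b n * a n) \<le> (B * M) * exp (- \<delta> * \<bar>of_int (\<omega> n)\<bar>)" for n
    unfolding norm_mult mult.assoc using M b
    by (meson mult_mono norm_ge_zero order_trans)
  thus "\<exists>M. \<forall>n. norm (b n * a n) \<le> M * exp (- \<delta> * \<bar>of_int (\<omega> n)\<bar>)" by blast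
qed

lemma exp_decay_mult_freq:
  assumes a: "exp_decay \<rho> \<omega> a"
  shows "exp_decay \<rho> \<omega> (\<lambda>n. of_int (\<omega> n) * a n)"
  unfolding exp_decay_def
proof (intro allI impI)
  fix \<delta> :: real assume \<delta>: "0 < \<delta> \<and> \<delta> < \<rho>"
  define \<epsilon> where "\<epsilon> = (\<rho> - \<delta>) / 2"
  have \<epsilon>: "\<epsilon> > 0" "0 < \<delta> + \<epsilon>" "\<delta> + \<epsilon> < \<rho>" using \<delta> by (auto simp: \<epsilon>_def field_simps)
  obtain M where M: "\<forall>n. norm (a n) \<le> M * exp (- (\<delta> + \<epsilon>) * \<bar>of_int (\<omega> n)\<bar>)"
    using assms \<epsilon> unfolding exp_decay_def by blast
  have "norm (of_int (\<omega> n) * a n) \<le> M / \<epsilon> * exp (- \<delta> * \<bar>of_int (\<omega> n)\<bar>)" for n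
  proof -
    define x where "x = \<bar>real_of_int (\<omega> n)\<bar>"
    have "\<epsilon> * x \<le> exp (\<epsilon> * x)" using exp_ge_add_one_self[of "\<epsilon> * x"] by linarith
    hence x: "x \<le> exp (\<epsilon> * x) / \<epsilon>" using \<epsilon> by (simp add: field_simps)
    have "norm (of_int (\<omega> n) * a n) = x * norm (a n)" by (simp add: norm_mult x_def)
    also have "\<dots> \<le> exp (\<epsilon> * x) / \<epsilon> * (M * exp (- (\<delta> + \<epsilon>) * x))"
      using x M[rule_format, of n] \<epsilon> by (intro mult_mono) (auto simp: x_def)
    also have "\<dots> = M / \<epsilon> * (exp (\<epsilon> * x) * exp (- (\<delta> + \<epsilon>) * x))" by simp
    also have "exp (\<epsilon> * x) * exp (- (\<delta> + \<epsilon>) * x) = exp (- \<delta> * x)"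
      unfolding exp_add[symmetric] by (simp add: algebra_simps)
    finally show ?thesis by (simp add: x_def)
  qed
  thus "\<exists>M. \<forall>n. norm (of_int (\<omega> n) * a n) \<le> M * exp (- \<delta> * \<bar>of_int (\<omega> n)\<bar>)" by blast
qed

lemma exp_decay_mult_index:
  assumes a: "exp_decay \<rho> \<omega> a" and \<omega>: "\<And>n. \<bar>n\<bar> \<le> \<bar>\<omega> n\<bar>"
  shows "exp_decay \<rho> \<omega> (\<lambda>n. of_int n * a n)"
proof -
  have "exp_decay \<rho> \<omega> (\<lambda>n. (of_int n / of_int (\<omega> n)) * (of_int (\<omega> n) * a n))"
  proof (rule exp_decay_mult_bounded[OF exp_decay_mult_freq[OF a]])
    show "norm (of_int n / of_int (\<omega> n) :: complex) \<le> 1" for n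
      using \<omega>[of n] by (cases "\<omega> n = 0") (auto simp: norm_divide simp flip: of_int_abs)
  qed
  also have "(\<lambda>n. (of_int n / of_int (\<omega> n)) * (of_int (\<omega> n) * a n)) = (\<lambda>n. of_int n * a n)"
  proof
    show "of_int n / of_int (\<omega> n) * (of_int (\<omega> n) * a n) = of_int n * a n" for n
      using \<omega>[of n] by (cases "\<omega> n = 0") auto
  qed
  finally show ?thesis .
qed

lemma exp_decay_mult_freq_power:
  "exp_decay \<rho> \<omega> a \<Longrightarrow> exp_decay \<rho> \<omega> (\<lambda>n. (\<i> * of_int (\<omega> n)) ^ p * a n)"
proof (induction p)
  case (Suc p)
  show ?case
    using exp_decay_mult_bounded[OF exp_decay_mult_freq[OF Suc.IH[OF Suc.prems]], of "\<lambda>_. \<i>" 1]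
    by (simp add: mult_ac)
qed simp

definition fourier :: "(int \<Rightarrow> int) \<Rightarrow> (int \<Rightarrow> complex) \<Rightarrow> complex \<Rightarrow> complex" where
  "fourier \<omega> a v = (\<Sum>\<^sub>\<infinity>n. a n * exp (\<i> * of_int (\<omega> n) * v))"

text \<open>On the strip of half-width \<open>\<delta>\<close> the exponentials grow at most at rate
  \<open>\<delta>\<close> in the frequency, while the coefficients decay at the larger rate
  \<open>\<delta> + \<epsilon>\<close>. What is left is a summable majorant independent of
  \<open>v\<close>.\<close>

lemma fourier_bound:
  assumes a: "exp_decay \<rho> \<omega> a" and \<delta>: "0 < \<delta>" "\<delta> < \<rho>" and \<omega>: "\<And>n. \<bar>n\<bar> \<le> \<bar>\<omega> n\<bar>"
  obtains M where "\<And>n v. \<bar>Im v\<bar> < \<delta> \<Longrightarrow> norm (a n * exp (\<i> * of_int (\<omega> n) * v)) \<le> M n"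
    "M summable_on (UNIV :: int set)"
proof -
  define \<epsilon> where "\<epsilon> = (\<rho> - \<delta>) / 2"
  have \<epsilon>: "\<epsilon> > 0" "0 < \<delta> + \<epsilon>" "\<delta> + \<epsilon> < \<rho>" using \<delta> by (auto simp: \<epsilon>_def field_simps)
  obtain M where M: "\<forall>n. norm (a n) \<le> M * exp (- (\<delta> + \<epsilon>) * \<bar>of_int (\<omega> n)\<bar>)"
    using a \<epsilon> unfolding exp_decay_def by blast
  have M0: "M \<ge> 0" using M[rule_format, of 0] by (smt (verit) exp_gt_zero norm_ge_zero zero_le_mult_iff)
  show ?thesis
  proof (rule that[of "\<lambda>n. M * exp (- \<epsilon> * \<bar>of_int n\<bar>)"])
    show "(\<lambda>n. M * exp (- \<epsilon> * \<bar>of_int n\<bar>)) summable_on (UNIV :: int set)"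
      by (intro summable_on_cmult_right summable_on_exp_int \<epsilon>)
    fix n v assume v: "\<bar>Im v\<bar> < \<delta>"
    define x where "x = \<bar>real_of_int (\<omega> n)\<bar>"
    have "\<bar>of_int (\<omega> n) * Im v\<bar> \<le> x * \<delta>"
      unfolding x_def abs_mult using v by (intro mult_left_mono) auto
    hence "norm (exp (\<i> * of_int (\<omega> n) * v)) \<le> exp (x * \<delta>)" by simp
    hence "norm (a n * exp (\<i> * of_int (\<omega> n) * v)) \<le> (M * exp (- (\<delta> + \<epsilon>) * x)) * exp (x * \<delta>)"
      unfolding norm_mult using M[rule_format, of n] M0 by (intro mult_mono) (auto simp: x_def)
    also have "\<dots> = M * exp (- \<epsilon> * x)" unfolding mult.assoc exp_add[symmetric] by (simp add: algebra_simps)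
    also have "\<dots> \<le> M * exp (- \<epsilon> * \<bar>of_int n\<bar>)"
      using \<omega>[of n] \<epsilon> M0 unfolding x_def by (intro mult_left_mono) (auto simp flip: of_int_abs)
    finally show "norm (a n * exp (\<i> * of_int (\<omega> n) * v)) \<le> M * exp (- \<epsilon> * \<bar>of_int n\<bar>)" .
  qed
qed

lemma fourier_has_sum:
  assumes a: "exp_decay \<rho> \<omega> a" and \<omega>: "\<And>n. \<bar>n\<bar> \<le> \<bar>\<omega> n\<bar>" and v: "\<bar>Im v\<bar> < \<rho>"
  shows "((\<lambda>n. a n * exp (\<i> * of_int (\<omega> n) * v)) has_sum fourier \<omega> a v) UNIV"
proof -
  define \<delta> where "\<delta> = (\<bar>Im v\<bar> + \<rho>) / 2"
  have \<delta>: "0 < \<delta>" "\<delta> < \<rho>" "\<bar>Im v\<bar> < \<delta>" using v by (auto simp: \<delta>_def)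
  obtain M where M: "\<And>n v. \<bar>Im v\<bar> < \<delta> \<Longrightarrow> norm (a n * exp (\<i> * of_int (\<omega> n) * v)) \<le> M n"
    "M summable_on (UNIV :: int set)"
    using fourier_bound[OF a \<delta>(1,2) \<omega>] by blast
  have "(\<lambda>n. a n * exp (\<i> * of_int (\<omega> n) * v)) summable_on UNIV"
    by (rule abs_summable_summable, rule Infinite_Sum.abs_summable_on_comparison_test'[OF M(2)])
       (use M(1) \<delta>(3) in auto)
  thus ?thesis unfolding fourier_def by simp
qed

lemma exp_decay_summable:
  assumes "exp_decay \<rho> \<omega> a" "\<And>n. \<bar>n\<bar> \<le> \<bar>\<omega> n\<bar>" "\<rho> > 0"
  shows "a summable_on UNIV"
  using fourier_has_sum[OF assms(1,2), of 0] assms(3) by (auto dest: has_sum_imp_summable)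

lemma open_strip: "open {v. \<bar>Im v\<bar> < \<delta>}"
  by (intro open_Collect_less continuous_intros)

lemma fourier_holomorphic:
  assumes a: "exp_decay \<rho> \<omega> a" and \<omega>: "\<And>n. \<bar>n\<bar> \<le> \<bar>\<omega> n\<bar>"
  shows "fourier \<omega> a holomorphic_on {v. \<bar>Im v\<bar> < \<rho>}"
    and "\<bar>Im v\<bar> < \<rho> \<Longrightarrow> (deriv ^^ p) (fourier \<omega> a) v = fourier \<omega> (\<lambda>n. (\<i> * of_int (\<omega> n)) ^ p * a n) v"
proof -
  \<comment> \<open>The majorant exists only on strictly narrower strips; these exhaust the full
    strip, a suitable half-width being midway between \<open>\<bar>Im v\<bar>\<close> and
    \<open>\<rho>\<close>.\<close>
  have *: "fourier \<omega> a holomorphic_on {v. \<bar>Im v\<bar> < \<delta>} \<and>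
      (deriv ^^ p) (fourier \<omega> a) v = fourier \<omega> (\<lambda>n. (\<i> * of_int (\<omega> n)) ^ p * a n) v"
    if \<delta>: "\<delta> < \<rho>" "\<bar>Im v\<bar> < \<delta>" for \<delta> v
  proof -
    have \<delta>0: "0 < \<delta>" using \<delta>(2) by linarith
    obtain M where M: "\<And>n v. \<bar>Im v\<bar> < \<delta> \<Longrightarrow> norm (a n * exp (\<i> * of_int (\<omega> n) * v)) \<le> M n"
      "M summable_on (UNIV :: int set)"
      using fourier_bound[OF a \<delta>0 \<delta>(1) \<omega>] by blast
    let ?A = "{v. \<bar>Im v\<bar> < \<delta>}"
    have F: "fourier \<omega> a = (\<lambda>v. \<Sum>\<^sub>\<infinity>n. a n * exp (\<i> * of_int (\<omega> n) * v))"
      by (simp add: fourier_def fun_eq_iff)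
    have h1: "fourier \<omega> a holomorphic_on ?A" unfolding F
      by (rule termwise_higher_deriv(1)[OF open_strip _ M(1) M(2)]) (auto intro!: holomorphic_intros)
    have h2: "((\<lambda>n. (deriv ^^ p) (\<lambda>v. a n * exp (\<i> * of_int (\<omega> n) * v)) v) has_sum (deriv ^^ p) (fourier \<omega> a) v) UNIV"
      unfolding F
      by (rule termwise_higher_deriv(2)[OF open_strip _ M(1) M(2)]) (use \<delta> in \<open>auto intro!: holomorphic_intros\<close>)
    have e: "(deriv ^^ p) (\<lambda>v. a n * exp (c * v)) = (\<lambda>v. c ^ p * a n * exp (c * v))" for n c
    proof (induction p)
      case (Suc p)
      have "deriv (\<lambda>v. c ^ p * a n * exp (c * v)) v = c ^ Suc p * a n * exp (c * v)" for v
        by (rule DERIV_imp_deriv) (auto intro!: derivative_eq_intros)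
      thus ?case by (auto simp: Suc.IH)
    qed auto
    show ?thesis using h1 h2 unfolding e fourier_def by (auto dest!: infsumI)
  qed
  show "\<bar>Im v\<bar> < \<rho> \<Longrightarrow> (deriv ^^ p) (fourier \<omega> a) v = fourier \<omega> (\<lambda>n. (\<i> * of_int (\<omega> n)) ^ p * a n) v"
    using *[of "(\<bar>Im v\<bar> + \<rho>) / 2" v] by auto
  have "fourier \<omega> a field_differentiable at v" if "\<bar>Im v\<bar> < \<rho>" for v
    using *[of "(\<bar>Im v\<bar> + \<rho>) / 2" v] that open_strip
    by (auto intro!: holomorphic_on_imp_differentiable_at[of _ "{w. \<bar>Im w\<bar> < (\<bar>Im v\<bar> + \<rho>) / 2}"])
  thus "fourier \<omega> a holomorphic_on {v. \<bar>Im v\<bar> < \<rho>}"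
    by (auto simp: holomorphic_on_def field_differentiable_at_within)
qed

section \<open>Exponential bounds for sech and csch\<close>

lemma norm_cosh_sinh_ge:
  fixes z :: complex
  shows "norm (cosh z) \<ge> sinh \<bar>Re z\<bar>" "norm (sinh z) \<ge> sinh \<bar>Re z\<bar>"
proof -
  have *: "norm (exp z + exp (-z)) \<ge> 2 * sinh \<bar>Re z\<bar>" "norm (exp z - exp (-z)) \<ge> 2 * sinh \<bar>Re z\<bar>"
    using norm_diff_ineq[of "exp z" "exp (-z)"] norm_diff_ineq[of "exp (-z)" "exp z"]
      norm_triangle_ineq3[of "exp z" "exp (-z)"]
    by (auto simp: add.commute[of "exp (-z)"] sinh_def abs_if split: if_splits)
  have "2 * norm (cosh z) = norm (exp z + exp (-z))" "2 * norm (sinh z) = norm (exp z - exp (-z))"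
    by (simp_all add: cosh_def sinh_def scaleR_conv_of_real norm_mult norm_divide)
  thus "norm (cosh z) \<ge> sinh \<bar>Re z\<bar>" "norm (sinh z) \<ge> sinh \<bar>Re z\<bar>" using * by linarith+
qed

lemma sinh_ge_exp:
  assumes "x \<ge> (\<rho>::real)"
  shows "sinh x \<ge> (1 - exp (- 2 * \<rho>)) / 2 * exp x"
proof -
  have "exp (-x) = exp (-2 * x) * exp x" by (simp flip: exp_add)
  also have "\<dots> \<le> exp (-2 * \<rho>) * exp x" using assms by simp
  finally show ?thesis by (simp add: sinh_def field_simps)
qed

text \<open>The constant depends on \<open>\<rho>\<close> alone, so the bound is uniform on the half
  plane \<open>Re t \<ge> \<rho>\<close>. This uniformity is what termwise differentiation in
  \<open>t\<close> relies on.\<close>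

lemma norm_sech_csch_le:
  fixes t :: complex and k :: int
  assumes \<rho>: "0 < \<rho>" "\<rho> \<le> Re t" and k: "k \<noteq> 0"
  shows "norm (1 / cosh (of_int k * t)) \<le> 2 / (1 - exp (- 2 * \<rho>)) * exp (- \<rho> * \<bar>of_int k\<bar>)"
    and "norm (1 / sinh (of_int k * t)) \<le> 2 / (1 - exp (- 2 * \<rho>)) * exp (- \<rho> * \<bar>of_int k\<bar>)"
    and "cosh (of_int k * t) \<noteq> 0" "sinh (of_int k * t) \<noteq> 0"
proof -
  define x where "x = \<rho> * \<bar>of_int k\<bar>"
  have "\<bar>real_of_int k\<bar> \<ge> 1" using k by linarith
  hence x: "x \<ge> \<rho>" using \<rho> unfolding x_def by (simp add: mult_le_cancel_left1)
  have "x \<le> \<bar>Re (of_int k * t)\<bar>"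
    using \<rho> by (auto simp: x_def abs_mult mult.commute intro!: mult_right_mono)
  hence "sinh x \<le> sinh \<bar>Re (of_int k * t)\<bar>" by (simp only: sinh_real_le_iff)
  moreover define q where "q = (1 - exp (- 2 * \<rho>)) / 2 * exp x"
  moreover have "q \<le> sinh x" unfolding q_def by (rule sinh_ge_exp[OF x])
  ultimately have *: "q \<le> norm (cosh (of_int k * t))" "q \<le> norm (sinh (of_int k * t))"
    using norm_cosh_sinh_ge[of "of_int k * t"] by linarith+
  have q: "q > 0" using \<rho> by (simp add: q_def)
  show "cosh (of_int k * t) \<noteq> 0" "sinh (of_int k * t) \<noteq> 0" using * q by force+
  have "1 / q = 2 / (1 - exp (- 2 * \<rho>)) * exp (- \<rho> * \<bar>of_int k\<bar>)"
    by (simp add: q_def x_def exp_minus field_simps)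
  moreover have "1 / norm (cosh (of_int k * t)) \<le> 1 / q" "1 / norm (sinh (of_int k * t)) \<le> 1 / q"
    using * q by (auto intro!: divide_left_mono mult_pos_pos)
  ultimately show "norm (1 / cosh (of_int k * t)) \<le> 2 / (1 - exp (- 2 * \<rho>)) * exp (- \<rho> * \<bar>of_int k\<bar>)"
    "norm (1 / sinh (of_int k * t)) \<le> 2 / (1 - exp (- 2 * \<rho>)) * exp (- \<rho> * \<bar>of_int k\<bar>)"
    by (simp_all add: norm_divide)
qed

subsection \<open>Hyperbolic sums\<close>

definition odd_sech :: "complex \<Rightarrow> int \<Rightarrow> complex" where
  "odd_sech t n = 1 / cosh (of_int (2 * n + 1) * t)"

definition odd_tanh :: "complex \<Rightarrow> int \<Rightarrow> complex" where
  "odd_tanh t n = sinh (of_int (2 * n + 1) * t) / cosh (of_int (2 * n + 1) * t)"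

text \<open>At index 0 the junk value \<open>x / 0 = 0\<close> makes both functions below vanish.\<close>

definition even_csch :: "complex \<Rightarrow> int \<Rightarrow> complex" where
  "even_csch t n = 1 / sinh (of_int (2 * n) * t)"

definition even_coth :: "complex \<Rightarrow> int \<Rightarrow> complex" where
  "even_coth t n = cosh (of_int (2 * n) * t) / sinh (of_int (2 * n) * t)"

definition odd_sgn :: "int \<Rightarrow> complex" where
  "odd_sgn n = (if n \<ge> 0 then 1 else -1)"

text \<open>The values of tanh tend to the sign of the index; subtracting this limit leaves an
  exponentially small sequence.\<close>

definition odd_tanh_rem :: "complex \<Rightarrow> int \<Rightarrow> complex" where
  "odd_tanh_rem t n = odd_tanh t n - odd_sgn n"

definition odd_freq :: "int \<Rightarrow> int" where "odd_freq n = 2 * n + 1"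
definition even_freq :: "int \<Rightarrow> int" where "even_freq n = 2 * n"

lemma abs_le_freq: "\<bar>n\<bar> \<le> \<bar>odd_freq n\<bar>" "\<bar>n\<bar> \<le> \<bar>even_freq n\<bar>"
  by (auto simp: odd_freq_def even_freq_def)

lemma odd_freq_nonzero: "odd_freq n \<noteq> 0"
  unfolding odd_freq_def by presburger

lemma odd_freq_mult_reflect: "of_int (2 * (-1 - n) + 1) * t = - (of_int (2 * n + 1) * t)" for t :: complex
  by (simp add: algebra_simps)

lemma odd_sech_reflect: "odd_sech t (- 1 - n) = odd_sech t n"
  by (simp only: odd_sech_def odd_freq_mult_reflect cosh_minus)

lemma odd_tanh_reflect: "odd_tanh t (- 1 - n) = - odd_tanh t n"
  by (simp only: odd_tanh_def odd_freq_mult_reflect cosh_minus sinh_minus minus_divide_left)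

lemma odd_tanh_rem_reflect: "odd_tanh_rem t (- 1 - n) = - odd_tanh_rem t n"
  by (simp add: odd_tanh_rem_def odd_sgn_def odd_tanh_reflect)

locale right_half_plane =
  fixes t :: complex
  assumes t: "Re t > 0"
begin

abbreviation "s \<equiv> odd_sech t"
abbreviation "T \<equiv> odd_tanh t"
abbreviation "d \<equiv> even_csch t"
abbreviation "u \<equiv> even_coth t"

lemma cosh_odd_nz: "cosh (of_int (2 * n + 1) * t) \<noteq> 0"
  using norm_sech_csch_le(3)[OF t order_refl odd_freq_nonzero, of n] by (simp add: odd_freq_def)

lemma sinh_even_nz: "n \<noteq> 0 \<Longrightarrow> sinh (of_int (2 * n) * t) \<noteq> 0"
  using norm_sech_csch_le(4)[OF t order_refl, of "2 * n"] by simp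

lemma exp_decay_sech: "exp_decay (Re t) odd_freq s"
  by (rule exp_decayI, use norm_sech_csch_le(1)[OF t order_refl odd_freq_nonzero] in
      \<open>simp only: odd_sech_def odd_freq_def\<close>)

lemma exp_decay_csch: "exp_decay (Re t) even_freq d"
proof (rule exp_decayI)
  fix n
  show "norm (d n) \<le> 2 / (1 - exp (- 2 * Re t)) * exp (- Re t * \<bar>of_int (even_freq n)\<bar>)"
  proof (cases "n = 0")
    case True
    thus ?thesis using t by (simp add: even_csch_def)
  next
    case False
    thus ?thesis using norm_sech_csch_le(2)[OF t order_refl, of "2 * n"]
      by (simp only: even_csch_def even_freq_def)
  qed
qed

lemma odd_tanh_rem_eq:
  "odd_tanh_rem t n = - odd_sgn n * exp (- of_int \<bar>2 * n + 1\<bar> * t) * s n"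
proof -
  have "sinh (of_int (2 * n + 1) * t) - odd_sgn n * cosh (of_int (2 * n + 1) * t) =
          - odd_sgn n * exp (- of_int \<bar>2 * n + 1\<bar> * t)"
    by (cases "n \<ge> 0") (auto simp: odd_sgn_def sinh_def cosh_def scaleR_conv_of_real field_simps)
  moreover have "odd_tanh_rem t n =
      (sinh (of_int (2 * n + 1) * t) - odd_sgn n * cosh (of_int (2 * n + 1) * t)) / cosh (of_int (2 * n + 1) * t)"
    using cosh_odd_nz[of n] by (simp add: odd_tanh_rem_def odd_tanh_def diff_divide_distrib)
  ultimately show ?thesis by (simp add: odd_sech_def)
qed

lemma even_coth_rem_eq:
  "u n - of_int (sgn n) = exp (- of_int \<bar>2 * n\<bar> * t) * d n"
proof (cases "n = 0")
  case False
  have "cosh (of_int (2 * n) * t) - of_int (sgn n) * sinh (of_int (2 * n) * t) = exp (- of_int \<bar>2 * n\<bar> * t)"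
    using False by (cases "n > 0") (auto simp: sinh_def cosh_def scaleR_conv_of_real field_simps)
  moreover have "u n - of_int (sgn n) =
      (cosh (of_int (2 * n) * t) - of_int (sgn n) * sinh (of_int (2 * n) * t)) / sinh (of_int (2 * n) * t)"
    using sinh_even_nz[OF False] by (simp add: even_coth_def diff_divide_distrib)
  ultimately show ?thesis by (simp add: even_csch_def)
qed (simp add: even_coth_def even_csch_def)

lemma exp_decay_tanh_rem: "exp_decay (Re t) odd_freq (odd_tanh_rem t)"
  unfolding odd_tanh_rem_eq
  by (rule exp_decay_mult_bounded[OF exp_decay_sech, where B = 1])
     (use t in \<open>auto simp: odd_sgn_def norm_mult\<close>)

lemma exp_decay_coth_rem: "exp_decay (Re t) even_freq (\<lambda>n. u n - of_int (sgn n))"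
  unfolding even_coth_rem_eq
  by (rule exp_decay_mult_bounded[OF exp_decay_csch, where B = 1])
     (use t in \<open>simp add: norm_mult del: of_int_abs of_int_mult\<close>)

lemma odd_tanh_bounded: obtains B where "\<And>n. norm (T n) \<le> B"
proof -
  define b where "b = Re t / 2"
  have b: "0 < b" "b < Re t" using t by (auto simp: b_def)
  then obtain M where M: "norm (odd_tanh_rem t n) \<le> M * exp (- b * \<bar>of_int (odd_freq n)\<bar>)" for n
    using exp_decay_tanh_rem unfolding exp_decay_def by blast
  have "norm (T n) \<le> \<bar>M\<bar> + 1" for n
  proof -
    have "norm (T n) \<le> norm (odd_tanh_rem t n) + norm (odd_sgn n)"
      unfolding odd_tanh_rem_def by (metis diff_add_cancel norm_triangle_ineq)
    also have "norm (odd_tanh_rem t n) \<le> \<bar>M\<bar> * 1"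
      by (rule order_trans[OF M], rule mult_mono) (use b in auto)
    finally show ?thesis by (simp add: odd_sgn_def split: if_splits)
  qed
  thus ?thesis using that by blast
qed

lemma even_coth_bounded: obtains B where "\<And>n. norm (u n) \<le> B"
proof -
  define b where "b = Re t / 2"
  have b: "0 < b" "b < Re t" using t by (auto simp: b_def)
  then obtain M where M: "norm (u n - of_int (sgn n)) \<le> M * exp (- b * \<bar>of_int (even_freq n)\<bar>)" for n
    using exp_decay_coth_rem unfolding exp_decay_def by blast
  have "norm (u n) \<le> \<bar>M\<bar> + 1" for n
  proof -
    have "norm (u n) \<le> norm (u n - of_int (sgn n)) + norm (of_int (sgn n) :: complex)"
      by (metis diff_add_cancel norm_triangle_ineq)
    also have "norm (u n - of_int (sgn n)) \<le> \<bar>M\<bar> * 1"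
      by (rule order_trans[OF M], rule mult_mono) (use b in auto)
    finally show ?thesis by (auto simp: sgn_if split: if_splits)
  qed
  thus ?thesis using that by blast
qed

lemma odd_tanh_uminus: "T (- n) = - T (n - 1)"
proof -
  have "of_int (2 * (-n) + 1) * t = - (of_int (2 * (n - 1) + 1) * t)" by (simp add: algebra_simps)
  thus ?thesis by (simp only: odd_tanh_def sinh_minus cosh_minus minus_divide_left)
qed

lemma even_coth_uminus: "u (- n) = - u n"
  by (simp add: even_coth_def)

lemma even_csch_uminus: "d (- n) = - d n"
  by (simp add: even_csch_def)

lemma even_csch_0 [simp]: "d 0 = 0" and even_coth_0 [simp]: "u 0 = 0"
  by (simp_all add: even_csch_def even_coth_def)

section \<open>Telescoping sums of tanh and coth\<close>

lemma summable_decay: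
  assumes "exp_decay (Re t) odd_freq a \<or> exp_decay (Re t) even_freq a"
  shows "a summable_on UNIV"
  using assms exp_decay_summable[OF _ _ t] abs_le_freq by blast

text \<open>Telescoping between the limits -1 and 1 of \<open>T\<close>. As \<open>T\<close> is not
  summable, the shift is cancelled on the remainder, and the jump of the sign at index 0 supplies
  the value 2.\<close>

lemma has_sum_tanh_diff: "((\<lambda>n. T n - T (n - 1)) has_sum 2) UNIV"
proof -
  obtain S where S: "(odd_tanh_rem t has_sum S) UNIV"
    using summable_decay exp_decay_tanh_rem unfolding summable_on_def by blast
  have "((\<lambda>n. odd_sgn n - odd_sgn (n - 1)) has_sum 2) UNIV"
    by (rule has_sum_int_finite[of "{0}"]) (auto simp: odd_sgn_def)
  from has_sum_add[OF has_sum_add[OF S has_sum_uminusI[OF has_sum_int_shift[OF S, of "-1"]]] this]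
  show ?thesis by (simp add: odd_tanh_rem_def algebra_simps)
qed

lemma has_sum_index_tanh_diff: "((\<lambda>n. of_int n * (T n - T (n - 1))) has_sum 0) UNIV"
proof (rule has_sum_int_odd)
  have 1: "(\<lambda>n. of_int n * odd_tanh_rem t n) summable_on UNIV"
    by (intro summable_decay disjI1 exp_decay_mult_index exp_decay_tanh_rem abs_le_freq)
  have 2: "(\<lambda>n. of_int n * odd_tanh_rem t n + odd_tanh_rem t n) summable_on UNIV"
    by (intro summable_on_add 1 summable_decay disjI1 exp_decay_tanh_rem)
  have "(\<lambda>n. of_int (n - 1) * odd_tanh_rem t (n - 1) + odd_tanh_rem t (n - 1)) summable_on UNIV"
    using 2 has_sum_int_shift[of "\<lambda>n. of_int n * odd_tanh_rem t n + odd_tanh_rem t n" _ "-1"]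
    unfolding summable_on_def by auto
  from summable_on_add[OF 1 summable_on_uminus[THEN iffD2, OF this]]
  have "(\<lambda>n. of_int n * (odd_tanh_rem t n - odd_tanh_rem t (n - 1))) summable_on UNIV"
    by (simp add: algebra_simps)
  \<comment> \<open>The two differences disagree only at the jump of the sign, \<open>n = 0\<close>,
    where the factor \<open>n\<close> vanishes.\<close>
  moreover have "of_int n * (odd_tanh_rem t n - odd_tanh_rem t (n - 1)) = of_int n * (T n - T (n - 1))" for n
    by (cases "n = 0") (auto simp: odd_tanh_rem_def odd_sgn_def)
  ultimately show "(\<lambda>n. of_int n * (T n - T (n - 1))) summable_on UNIV" by simp
  show "of_int (- n) * (T (- n) - T (- n - 1)) = - (of_int n * (T n - T (n - 1)))" for n
  proof -
    have "- n - 1 = - 1 - n" by simp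
    thus ?thesis by (simp only: odd_tanh_uminus odd_tanh_reflect) (simp add: algebra_simps)
  qed
qed

lemma has_sum_coth_diff: "((\<lambda>n. u n - u (n - 1)) has_sum 2) UNIV"
proof -
  obtain S where S: "((\<lambda>n. u n - of_int (sgn n)) has_sum S) UNIV"
    using summable_decay exp_decay_coth_rem unfolding summable_on_def by blast
  \<comment> \<open>As \<open>sgn 0 = 0\<close>, in accordance with \<open>u 0 = 0\<close>, the jump
    of size 2 is split into unit jumps at the indices 0 and 1.\<close>
  have "((\<lambda>n. of_int (sgn n) - of_int (sgn (n - 1))) has_sum (2::complex)) UNIV"
    by (rule has_sum_int_finite[of "{0, 1}"]) (auto simp: sgn_if)
  from has_sum_add[OF has_sum_add[OF S has_sum_uminusI[OF has_sum_int_shift[OF S, of "-1"]]] this]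
  show ?thesis by (simp add: algebra_simps)
qed

text \<open>For \<open>N = 0\<close> the terms cancel by reflection, and passing from
  \<open>N\<close> to \<open>N + 1\<close> adds the telescoping sum 2. The step is an equivalence,
  so negative \<open>N\<close> are reached as well.\<close>

lemma has_sum_tanh_tanh: "((\<lambda>n. T n + T (N - 1 - n)) has_sum of_int (2 * N)) UNIV"
proof (induction N rule: int_bidirectional_induct)
  case 1
  show ?case using odd_tanh_reflect by simp
next
  case (2 N)
  have *: "((\<lambda>n. T (N - n) - T (N - 1 - n)) has_sum 2) UNIV"
    using has_sum_int_reflect[OF has_sum_tanh_diff, of N] by (simp add: algebra_simps)
  show ?case
  proof
    assume "((\<lambda>n. T n + T (N - 1 - n)) has_sum of_int (2 * N)) UNIV"
    from has_sum_add[OF this *] show "((\<lambda>n. T n + T (N + 1 - 1 - n)) has_sum of_int (2 * (N + 1))) UNIV"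
      by (simp add: algebra_simps)
  next
    assume "((\<lambda>n. T n + T (N + 1 - 1 - n)) has_sum of_int (2 * (N + 1))) UNIV"
    from has_sum_add[OF this has_sum_uminusI[OF *]] show "((\<lambda>n. T n + T (N - 1 - n)) has_sum of_int (2 * N)) UNIV"
      by (simp add: algebra_simps)
  qed
qed

lemma has_sum_coth_coth: "((\<lambda>n. u n + u (N - n)) has_sum of_int (2 * N)) UNIV"
proof (induction N rule: int_bidirectional_induct)
  case 1
  show ?case using even_coth_uminus by simp
next
  case (2 N)
  have *: "((\<lambda>n. u (N + 1 - n) - u (N - n)) has_sum 2) UNIV"
    using has_sum_int_reflect[OF has_sum_coth_diff, of "N + 1"] by (simp add: algebra_simps)
  show ?case
  proof
    assume "((\<lambda>n. u n + u (N - n)) has_sum of_int (2 * N)) UNIV"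
    from has_sum_add[OF this *] show "((\<lambda>n. u n + u (N + 1 - n)) has_sum of_int (2 * (N + 1))) UNIV"
      by (simp add: algebra_simps)
  next
    assume "((\<lambda>n. u n + u (N + 1 - n)) has_sum of_int (2 * (N + 1))) UNIV"
    from has_sum_add[OF this has_sum_uminusI[OF *]] show "((\<lambda>n. u n + u (N - n)) has_sum of_int (2 * N)) UNIV"
      by (simp add: algebra_simps)
  qed
qed

lemma exp_decay_coth_minus_tanh:
  "(\<lambda>n. u n + T (- n)) summable_on UNIV" "(\<lambda>n. of_int n * (u n + T (- n))) summable_on UNIV"
proof -
  let ?a = "\<lambda>n. u n - of_int (sgn n)" and ?b = "odd_tanh_rem t"
  have 1: "?a summable_on UNIV" "?b summable_on UNIV"
     "(\<lambda>n. of_int n * ?a n) summable_on UNIV" "(\<lambda>n. of_int n * ?b n) summable_on UNIV"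
    using exp_decay_coth_rem exp_decay_tanh_rem exp_decay_mult_index[OF exp_decay_coth_rem abs_le_freq(2)]
       exp_decay_mult_index[OF exp_decay_tanh_rem abs_le_freq(1)]
    by (auto intro: summable_decay)
  have 2: "(\<lambda>n. ?b (- n)) summable_on UNIV" "(\<lambda>n. of_int (-n) * ?b (- n)) summable_on UNIV"
    using 1(2,4) has_sum_int_reflect[of _ _ 0] unfolding summable_on_def by fastforce+
  have "(\<lambda>n. of_int (sgn n) + odd_sgn (-n)) summable_on UNIV"
    by (rule has_sum_imp_summable[OF has_sum_int_finite[of "{0}" _ 1]]) (auto simp: odd_sgn_def sgn_if)
  from summable_on_add[OF summable_on_add[OF 1(1) 2(1)] this]
  show "(\<lambda>n. u n + T (- n)) summable_on UNIV" by (simp add: odd_tanh_rem_def algebra_simps)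
  have "of_int n * ?a n + - (of_int (-n) * ?b (-n)) = of_int n * (u n + T (- n))" for n
    by (auto simp: odd_tanh_rem_def odd_sgn_def sgn_if algebra_simps)
  thus "(\<lambda>n. of_int n * (u n + T (- n))) summable_on UNIV"
    using summable_on_add[OF 1(3) summable_on_uminus[THEN iffD2, OF 2(2)]] by (simp only:)
qed

lemma has_sum_coth_tanh: "((\<lambda>j. u j + T (n - j)) has_sum of_int (2 * n + 1)) UNIV"
proof (induction n rule: int_bidirectional_induct)
  case 1
  \<comment> \<open>Here the terms do not cancel one by one. Adding the series to its own reflection
    removes \<open>u\<close> and leaves the telescoping sum, so \<open>2 S = 2\<close>.\<close>
  obtain S where S: "((\<lambda>n. u n + T (- n)) has_sum S) UNIV"
    using exp_decay_coth_minus_tanh(1) unfolding summable_on_def by blast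
  have "((\<lambda>n. T n - T (n - 1)) has_sum (S + S)) UNIV"
    using has_sum_add[OF S has_sum_int_reflect[OF S, of 0]] by (simp add: even_coth_uminus odd_tanh_uminus)
  hence "S + S = 2" using has_sum_tanh_diff has_sum_unique by blast
  hence "S = 1" by (simp add: field_simps)
  thus ?case using S by simp
next
  case (2 n)
  have *: "((\<lambda>j. T (n + 1 - j) - T (n - j)) has_sum 2) UNIV"
    using has_sum_int_reflect[OF has_sum_tanh_diff, of "n + 1"] by (simp add: algebra_simps)
  show ?case
  proof
    assume "((\<lambda>j. u j + T (n - j)) has_sum of_int (2 * n + 1)) UNIV"
    from has_sum_add[OF this *] show "((\<lambda>j. u j + T (n + 1 - j)) has_sum of_int (2 * (n + 1) + 1)) UNIV"
      by (simp add: algebra_simps)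
  next
    assume "((\<lambda>j. u j + T (n + 1 - j)) has_sum of_int (2 * (n + 1) + 1)) UNIV"
    from has_sum_add[OF this has_sum_uminusI[OF *]] show "((\<lambda>j. u j + T (n - j)) has_sum of_int (2 * n + 1)) UNIV"
      by (simp add: algebra_simps)
  qed
qed

text \<open>Each step in \<open>n\<close> telescopes to \<open>2 (n + 1)\<close>, which accounts for
  \<open>n^2 + n\<close>. The value \<open>A\<close> at \<open>n = 0\<close> is left open; it is
  absorbed by the coefficient \<open>K\<close> of the differential equation.\<close>

lemma has_sum_index_coth_tanh:
  obtains A where "\<And>n. ((\<lambda>j. of_int j * (u j + T (n - j))) has_sum (A + of_int (n ^ 2 + n))) UNIV"
proof -
  obtain A where A: "((\<lambda>n. of_int n * (u n + T (- n))) has_sum A) UNIV"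
    using exp_decay_coth_minus_tanh(2) unfolding summable_on_def by blast
  have "((\<lambda>j. of_int j * (u j + T (n - j))) has_sum (A + of_int (n ^ 2 + n))) UNIV" for n
  proof (induction n rule: int_bidirectional_induct)
    case 1
    show ?case using A by simp
  next
    case (2 n)
    have "((\<lambda>j. of_int (n + 1) * (T j - T (j - 1)) + - (of_int j * (T j - T (j - 1)))) has_sum
             (of_int (n + 1) * 2 + - 0)) UNIV"
      by (intro has_sum_add has_sum_uminusI has_sum_cmult_right has_sum_tanh_diff has_sum_index_tanh_diff)
    from has_sum_int_reflect[OF this, of "n + 1"]
    have *: "((\<lambda>j. of_int j * (T (n + 1 - j) - T (n - j))) has_sum of_int (2 * (n + 1))) UNIV"
      by (simp add: algebra_simps)
    show ?case
    proof
      assume "((\<lambda>j. of_int j * (u j + T (n - j))) has_sum A + of_int (n\<^sup>2 + n)) UNIV"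
      from has_sum_add[OF this *]
      show "((\<lambda>j. of_int j * (u j + T (n + 1 - j))) has_sum A + of_int ((n + 1)\<^sup>2 + (n + 1))) UNIV"
        by (simp add: algebra_simps power2_eq_square)
    next
      assume "((\<lambda>j. of_int j * (u j + T (n + 1 - j))) has_sum A + of_int ((n + 1)\<^sup>2 + (n + 1))) UNIV"
      from has_sum_add[OF this has_sum_uminusI[OF *]]
      show "((\<lambda>j. of_int j * (u j + T (n - j))) has_sum A + of_int (n\<^sup>2 + n)) UNIV"
        by (simp add: algebra_simps power2_eq_square)
    qed
  qed
  thus ?thesis using that by blast
qed

end

subsection \<open>Product identities for the hyperbolic Fourier series\<close>

text \<open>The offset \<open>h\<close> aligns indices with frequencies: two odd frequencies add up
  to an even one, \<open>(2 n + 1) + (2 (N - 1 - n) + 1) = 2 N\<close>, which asks for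
  \<open>h = -1\<close>; if a factor has even frequencies, \<open>h = 0\<close> fits.\<close>

lemma fourier_mult_has_sum:
  assumes a: "exp_decay \<rho> \<omega>1 a" "\<And>n. \<bar>n\<bar> \<le> \<bar>\<omega>1 n\<bar>"
    and b: "exp_decay \<rho> \<omega>2 b" "\<And>n. \<bar>n\<bar> \<le> \<bar>\<omega>2 n\<bar>"
    and v: "\<bar>Im v\<bar> < \<rho>"
    and \<omega>: "\<And>N n. \<omega>1 n + \<omega>2 (N + h - n) = \<omega>3 N"
    and c: "\<And>N. ((\<lambda>n. a n * b (N + h - n)) has_sum c N) UNIV"
  shows "((\<lambda>N. c N * exp (\<i> * of_int (\<omega>3 N) * v)) has_sum fourier \<omega>1 a v * fourier \<omega>2 b v) UNIV"
proof -
  let ?f = "\<lambda>n. a n * exp (\<i> * of_int (\<omega>1 n) * v)" and ?g = "\<lambda>n. b n * exp (\<i> * of_int (\<omega>2 n) * v)"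
  have f: "?f summable_on UNIV" and g: "?g summable_on UNIV"
    using fourier_has_sum[OF a v] fourier_has_sum[OF b v] by (auto dest: has_sum_imp_summable)
  have "((\<lambda>N. \<Sum>\<^sub>\<infinity>n. ?f n * ?g (N - n)) has_sum fourier \<omega>1 a v * fourier \<omega>2 b v) UNIV"
    using infsum_int_convolution(1)[OF f g] by (simp add: fourier_def)
  from has_sum_int_shift[OF this, of h]
  have "((\<lambda>N. \<Sum>\<^sub>\<infinity>n. ?f n * ?g (N + h - n)) has_sum fourier \<omega>1 a v * fourier \<omega>2 b v) UNIV" .
  moreover have "(\<Sum>\<^sub>\<infinity>n. ?f n * ?g (N + h - n)) = c N * exp (\<i> * of_int (\<omega>3 N) * v)" for N
  proof -
    have "exp (\<i> * of_int (\<omega>1 n) * v) * exp (\<i> * of_int (\<omega>2 (N + h - n)) * v) = exp (\<i> * of_int (\<omega>3 N) * v)" for n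
      unfolding \<omega>[of n N, symmetric] by (simp add: exp_add[symmetric] algebra_simps)
    hence "?f n * ?g (N + h - n) = (a n * b (N + h - n)) * exp (\<i> * of_int (\<omega>3 N) * v)" for n
      by (metis (no_types, lifting) mult.assoc mult.left_commute)
    hence "(\<lambda>n. ?f n * ?g (N + h - n)) = (\<lambda>n. (a n * b (N + h - n)) * exp (\<i> * of_int (\<omega>3 N) * v))"
      by blast
    thus ?thesis using has_sum_cmult_left[OF c] by (simp only: infsumI)
  qed
  ultimately show ?thesis by simp
qed

text \<open>Up to scaling of argument and value this is the Jacobi elliptic function cn with nome
  \<open>exp (-2 t)\<close>. Its differential equation is derived below from the Fourier
  coefficients alone.\<close>

definition sech_series :: "complex \<Rightarrow> complex \<Rightarrow> complex" where
  "sech_series t = fourier odd_freq (odd_sech t)"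

definition csch_series :: "complex \<Rightarrow> complex \<Rightarrow> complex" where
  "csch_series t = fourier even_freq (even_csch t)"

definition sech_tanh_series :: "complex \<Rightarrow> complex \<Rightarrow> complex" where
  "sech_tanh_series t = fourier odd_freq (\<lambda>n. odd_tanh t n * odd_sech t n)"

definition csch_coth_series :: "complex \<Rightarrow> complex \<Rightarrow> complex" where
  "csch_coth_series t = fourier even_freq (\<lambda>n. even_coth t n * even_csch t n)"

definition tanh_rem_series :: "complex \<Rightarrow> complex \<Rightarrow> complex" where
  "tanh_rem_series t v = \<i> * fourier odd_freq (odd_tanh_rem t) v"

definition sech_square_sum :: "complex \<Rightarrow> complex" where
  "sech_square_sum t = (\<Sum>\<^sub>\<infinity>n. odd_sech t n ^ 2)"

definition alt_sign :: "int \<Rightarrow> complex" where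
  "alt_sign n = (if even n then 1 else -1)"

context right_half_plane
begin

lemma exp_decay_sech_tanh: "exp_decay (Re t) odd_freq (\<lambda>n. T n * s n)"
proof -
  obtain B where "\<And>n. norm (T n) \<le> B" using odd_tanh_bounded by blast
  thus ?thesis by (rule exp_decay_mult_bounded[OF exp_decay_sech])
qed

lemma exp_decay_csch_coth: "exp_decay (Re t) even_freq (\<lambda>n. u n * d n)"
proof -
  obtain B where "\<And>n. norm (u n) \<le> B" using even_coth_bounded by blast
  thus ?thesis by (rule exp_decay_mult_bounded[OF exp_decay_csch])
qed

lemma sech_series_higher_deriv:
  assumes "\<bar>Im v\<bar> < Re t"
  shows "((\<lambda>n. (\<i> * of_int (odd_freq n)) ^ p * s n * exp (\<i> * of_int (odd_freq n) * v)) has_sum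
           (deriv ^^ p) (sech_series t) v) UNIV"
  unfolding sech_series_def fourier_holomorphic(2)[OF exp_decay_sech abs_le_freq(1) assms]
  by (rule fourier_has_sum[OF exp_decay_mult_freq_power[OF exp_decay_sech] abs_le_freq(1) assms])

lemma csch_series_higher_deriv:
  assumes "\<bar>Im v\<bar> < Re t"
  shows "((\<lambda>n. (\<i> * of_int (even_freq n)) ^ p * d n * exp (\<i> * of_int (even_freq n) * v)) has_sum
           (deriv ^^ p) (csch_series t) v) UNIV"
  unfolding csch_series_def fourier_holomorphic(2)[OF exp_decay_csch abs_le_freq(2) assms]
  by (rule fourier_has_sum[OF exp_decay_mult_freq_power[OF exp_decay_csch] abs_le_freq(2) assms])

text \<open>With \<open>a + b = 2 N t\<close>, the addition formula for \<open>sinh (a + b)\<close>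
  separates the product into a factor that depends only on \<open>N\<close> and a sum that
  telescopes over \<open>n\<close>.\<close>

lemma sech_mult_sech:
  assumes "N \<noteq> 0"
  shows "s n * s (N - 1 - n) = d N * (T n + T (N - 1 - n))"
proof -
  define a where "a = of_int (2 * n + 1) * t"
  define b where "b = of_int (2 * (N - 1 - n) + 1) * t"
  have ab: "of_int (2 * N) * t = a + b" by (simp add: a_def b_def algebra_simps)
  have nz: "cosh a \<noteq> 0" "cosh b \<noteq> 0" "sinh (a + b) \<noteq> 0"
    using cosh_odd_nz[of n] cosh_odd_nz[of "N - 1 - n"] sinh_even_nz[OF assms] unfolding ab a_def[symmetric] b_def[symmetric] by simp_all
  show ?thesis
    unfolding odd_sech_def odd_tanh_def even_csch_def ab a_def[symmetric] b_def[symmetric]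
    using nz by (simp add: divide_simps) (simp add: sinh_add algebra_simps)
qed

text \<open>For \<open>j \<noteq> 0\<close> this is the addition formula for
  \<open>cosh (a + b)\<close>. At \<open>j = 0\<close> the value \<open>d 0 = 0\<close> makes the
  left side vanish while \<open>u 0 + T n\<close> is \<open>T n\<close>, hence the
  correction.\<close>

lemma csch_mult_sech:
  "d j * s (n - j) = s n * (u j + T (n - j)) - (if j = 0 then s n * T n else 0)"
proof (cases "j = 0")
  case False
  define a where "a = of_int (2 * j) * t"
  define b where "b = of_int (2 * (n - j) + 1) * t"
  have ab: "of_int (2 * n + 1) * t = a + b" by (simp add: a_def b_def algebra_simps)
  have nz: "sinh a \<noteq> 0" "cosh b \<noteq> 0" "cosh (a + b) \<noteq> 0"
    using cosh_odd_nz[of n] cosh_odd_nz[of "n - j"] sinh_even_nz[OF False] unfolding ab a_def[symmetric] b_def[symmetric] by simp_all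
  have "d j * s (n - j) = s n * (u j + T (n - j))"
    unfolding odd_sech_def odd_tanh_def even_csch_def even_coth_def ab a_def[symmetric] b_def[symmetric]
    using nz by (simp add: divide_simps) (simp add: cosh_add algebra_simps)
  thus ?thesis using False by simp
qed (simp add: even_csch_def even_coth_def)

lemma csch_mult_csch:
  assumes "N \<noteq> 0"
  shows "d n * d (N - n) = d N * (u n + u (N - n)) - (if n \<in> {0, N} then d N * u N else 0)"
proof (cases "n = 0 \<or> n = N")
  case False
  define a where "a = of_int (2 * n) * t"
  define b where "b = of_int (2 * (N - n)) * t"
  have ab: "of_int (2 * N) * t = a + b" by (simp add: a_def b_def algebra_simps)
  have nz: "sinh a \<noteq> 0" "sinh b \<noteq> 0" "sinh (a + b) \<noteq> 0"
    using False assms sinh_even_nz[of n] sinh_even_nz[of "N - n"] sinh_even_nz[of N]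
    unfolding ab a_def[symmetric] b_def[symmetric] by simp_all
  have "d n * d (N - n) = d N * (u n + u (N - n))"
    unfolding even_csch_def even_coth_def ab a_def[symmetric] b_def[symmetric]
    using nz by (simp add: divide_simps) (simp add: sinh_add algebra_simps)
  thus ?thesis using False by simp
qed (use assms in \<open>auto simp: even_csch_def even_coth_def\<close>)

lemma sech_square_has_sum: "((\<lambda>n. s n ^ 2) has_sum sech_square_sum t) UNIV"
proof -
  obtain B where B: "\<And>n. norm (s n) \<le> B"
  proof -
    have "(\<lambda>n. norm (s n)) summable_on UNIV"
      using summable_decay exp_decay_sech summable_on_iff_abs_summable_on_complex by blast
    then obtain S where S: "((\<lambda>n. norm (s n)) has_sum S) UNIV" unfolding summable_on_def by blast
    have "norm (s n) \<le> S" for n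
      using finite_sum_le_has_sum[OF S, of "{n}"] by simp
    thus ?thesis using that by blast
  qed
  have "exp_decay (Re t) odd_freq (\<lambda>n. s n * s n)"
    by (rule exp_decay_mult_bounded[OF exp_decay_sech B])
  hence "(\<lambda>n. s n * s n) summable_on UNIV" using summable_decay by blast
  thus ?thesis by (simp add: sech_square_sum_def power2_eq_square)
qed

text \<open>The convolution coefficient at \<open>N \<noteq> 0\<close> is \<open>2 N * d N\<close>,
  up to a factor that of the derivative of the csch series. At \<open>N = 0\<close> it is the sum of
  squares, a separate constant because \<open>d 0 = 0\<close>.\<close>

lemma sech_series_square:
  assumes v: "\<bar>Im v\<bar> < Re t"
  shows "sech_series t v ^ 2 = sech_square_sum t - \<i> * deriv (csch_series t) v"
proof -
  have c: "((\<lambda>n. s n * s (N + -1 - n)) has_sum (of_int (2 * N) * d N + (if N = 0 then sech_square_sum t else 0))) UNIV" for N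
  proof (cases "N = 0")
    case True
    thus ?thesis using sech_square_has_sum odd_sech_reflect by (simp add: power2_eq_square)
  next
    case False
    have "((\<lambda>n. d N * (T n + T (N - 1 - n))) has_sum d N * of_int (2 * N)) UNIV"
      by (intro has_sum_cmult_right has_sum_tanh_tanh t)
    thus ?thesis using False sech_mult_sech[OF False] by (simp add: mult.commute)
  qed
  have 1: "((\<lambda>N. (of_int (2 * N) * d N + (if N = 0 then sech_square_sum t else 0)) *
      exp (\<i> * of_int (even_freq N) * v)) has_sum sech_series t v * sech_series t v) UNIV"
    unfolding sech_series_def
    by (rule fourier_mult_has_sum[OF exp_decay_sech abs_le_freq(1) exp_decay_sech abs_le_freq(1) v _ c])
       (simp add: odd_freq_def even_freq_def)
  have "((\<lambda>N. (if N = 0 then sech_square_sum t else 0)) has_sum sech_square_sum t) (UNIV::int set)"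
    by (rule has_sum_int_finite[of "{0}"]) auto
  from has_sum_add[OF has_sum_cmult_right[OF csch_series_higher_deriv[OF v, of 1], of "-\<i>"] this]
  have "((\<lambda>N. - \<i> * ((\<i> * of_int (even_freq N)) ^ 1 * d N * exp (\<i> * of_int (even_freq N) * v)) +
           (if N = 0 then sech_square_sum t else 0)) has_sum (- \<i> * deriv (csch_series t) v + sech_square_sum t)) UNIV"
    by simp
  hence 2: "((\<lambda>N. (of_int (2 * N) * d N + (if N = 0 then sech_square_sum t else 0)) *
      exp (\<i> * of_int (even_freq N) * v)) has_sum (- \<i> * deriv (csch_series t) v + sech_square_sum t)) UNIV"
  proof (subst (asm) has_sum_cong)
    fix N :: int
    show "- \<i> * ((\<i> * of_int (even_freq N)) ^ 1 * d N * exp (\<i> * of_int (even_freq N) * v)) +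
           (if N = 0 then sech_square_sum t else 0) =
         (of_int (2 * N) * d N + (if N = 0 then sech_square_sum t else 0)) * exp (\<i> * of_int (even_freq N) * v)"
      by (auto simp: even_freq_def algebra_simps)
  qed simp
  show ?thesis using has_sum_unique[OF 1 2] by (simp add: power2_eq_square)
qed

text \<open>Up to a factor of the frequency, \<open>T n * s n\<close> is the derivative of
  \<open>s n\<close> in \<open>t\<close>. The identity expresses that series through derivatives and
  products in \<open>v\<close>; in this way derivatives in \<open>t\<close> become
  algebraic.\<close>

lemma csch_series_mult_sech_series:
  assumes v: "\<bar>Im v\<bar> < Re t"
  shows "csch_series t v * sech_series t v = - \<i> * deriv (sech_series t) v - sech_tanh_series t v"
proof -
  have c: "((\<lambda>j. d j * s (n + 0 - j)) has_sum (s n * of_int (2 * n + 1) + - (s n * T n))) UNIV" for n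
  proof -
    have "((\<lambda>j. s n * (u j + T (n - j)) + - (if j = 0 then s n * T n else 0)) has_sum
            (s n * of_int (2 * n + 1) + - (s n * T n))) UNIV"
      by (intro has_sum_add has_sum_uminusI has_sum_cmult_right has_sum_coth_tanh t has_sum_int_finite[of "{0}"]) auto
    thus ?thesis by (simp add: csch_mult_sech)
  qed
  have 1: "((\<lambda>n. (s n * of_int (2 * n + 1) + - (s n * T n)) * exp (\<i> * of_int (odd_freq n) * v)) has_sum
      csch_series t v * sech_series t v) UNIV"
    unfolding sech_series_def csch_series_def
    by (rule fourier_mult_has_sum[OF exp_decay_csch abs_le_freq(2) exp_decay_sech abs_le_freq(1) v _ c])
       (simp add: odd_freq_def even_freq_def)
  have "((\<lambda>n. (T n * s n) * exp (\<i> * of_int (odd_freq n) * v)) has_sum sech_tanh_series t v) UNIV"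
    unfolding sech_tanh_series_def by (rule fourier_has_sum[OF exp_decay_sech_tanh abs_le_freq(1) v])
  from has_sum_add[OF has_sum_cmult_right[OF sech_series_higher_deriv[OF v, of 1], of "-\<i>"] has_sum_uminusI[OF this]]
  have 2: "((\<lambda>n. (s n * of_int (2 * n + 1) + - (s n * T n)) * exp (\<i> * of_int (odd_freq n) * v)) has_sum
      (- \<i> * deriv (sech_series t) v + - sech_tanh_series t v)) UNIV"
    by (simp add: odd_freq_def algebra_simps)
  show ?thesis using has_sum_unique[OF 1 2] by simp
qed

text \<open>The counterpart for the derivative of the csch series in \<open>t\<close>. The constant
  \<open>z\<close> touches only the coefficient of order 0, whereas the derivative of
  \<open>e\<close> is read off at order 2.\<close>

lemma csch_series_square:
  obtains z where "\<And>v. \<bar>Im v\<bar> < Re t \<Longrightarrow>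
    csch_series t v ^ 2 = z - \<i> * deriv (csch_series t) v - 2 * csch_coth_series t v"
proof -
  define z where "z = (\<Sum>\<^sub>\<infinity>n. d n * d (0 - n))"
  have dd: "(\<lambda>n. d n * d (N - n)) summable_on UNIV" for N
    by (rule infsum_int_convolution(2)) (use summable_decay exp_decay_csch in auto)
  have c: "((\<lambda>n. d n * d (N + 0 - n)) has_sum
      (d N * of_int (2 * N) + - (2 * (d N * u N)) + (if N = 0 then z else 0))) UNIV" for N
  proof (cases "N = 0")
    case True
    thus ?thesis using dd[of 0] unfolding z_def by (simp add: t)
  next
    case False
    have "((\<lambda>n. d N * (u n + u (N - n)) + - (if n \<in> {0, N} then d N * u N else 0)) has_sum
            (d N * of_int (2 * N) + - (2 * (d N * u N)))) UNIV"
      by (intro has_sum_add has_sum_uminusI has_sum_cmult_right has_sum_coth_coth t has_sum_int_finite[of "{0, N}"])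
         (use False in auto)
    thus ?thesis using False csch_mult_csch[OF False] by simp
  qed
  show ?thesis
  proof (rule that[of z])
    fix v assume v: "\<bar>Im v\<bar> < Re t"
    have 1: "((\<lambda>N. (d N * of_int (2 * N) + - (2 * (d N * u N)) + (if N = 0 then z else 0)) *
        exp (\<i> * of_int (even_freq N) * v)) has_sum csch_series t v * csch_series t v) UNIV"
      unfolding csch_series_def
      by (rule fourier_mult_has_sum[OF exp_decay_csch abs_le_freq(2) exp_decay_csch abs_le_freq(2) v _ c])
         (simp add: even_freq_def)
    have "((\<lambda>n. (u n * d n) * exp (\<i> * of_int (even_freq n) * v)) has_sum csch_coth_series t v) UNIV"
      unfolding csch_coth_series_def by (rule fourier_has_sum[OF exp_decay_csch_coth abs_le_freq(2) v])
    moreover have "((\<lambda>N. (if N = 0 then z else 0)) has_sum z) (UNIV::int set)"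
      by (rule has_sum_int_finite[of "{0}"]) auto
    ultimately have "((\<lambda>N. - \<i> * ((\<i> * of_int (even_freq N)) ^ 1 * d N * exp (\<i> * of_int (even_freq N) * v)) +
       -2 * ((u N * d N) * exp (\<i> * of_int (even_freq N) * v)) + (if N = 0 then z else 0)) has_sum
       (- \<i> * (deriv ^^ 1) (csch_series t) v + -2 * csch_coth_series t v + z)) UNIV"
      by (intro has_sum_add has_sum_cmult_right csch_series_higher_deriv v)
    hence 2: "((\<lambda>N. (d N * of_int (2 * N) + - (2 * (d N * u N)) + (if N = 0 then z else 0)) *
        exp (\<i> * of_int (even_freq N) * v)) has_sum (- \<i> * deriv (csch_series t) v + -2 * csch_coth_series t v + z)) UNIV"
    proof (subst (asm) has_sum_cong)
      fix N :: int
      show "- \<i> * ((\<i> * of_int (even_freq N)) ^ 1 * d N * exp (\<i> * of_int (even_freq N) * v)) +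
         -2 * ((u N * d N) * exp (\<i> * of_int (even_freq N) * v)) + (if N = 0 then z else 0) =
         (d N * of_int (2 * N) + - (2 * (d N * u N)) + (if N = 0 then z else 0)) * exp (\<i> * of_int (even_freq N) * v)"
        by (auto simp: even_freq_def algebra_simps)
    qed simp
    show "csch_series t v ^ 2 = z - \<i> * deriv (csch_series t) v - 2 * csch_coth_series t v"
      using has_sum_unique[OF 1 2] by (simp add: power2_eq_square)
  qed
qed

text \<open>The square identity times \<open>C\<close> turns the cube into the product of
  \<open>C\<close> with the derivative of the csch series. The convolution sums of this product are
  \<open>s n\<close> times a quadratic polynomial in \<open>n\<close>, so they combine
  \<open>C\<close> and its second derivative.\<close>

lemma sech_series_ODE:
  obtains K where "\<And>v. \<bar>Im v\<bar> < Re t \<Longrightarrow>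
    (deriv ^^ 2) (sech_series t) v = K * sech_series t v - 2 * sech_series t v ^ 3"
proof -
  obtain A where A: "\<And>n. ((\<lambda>j. of_int j * (u j + T (n - j))) has_sum (A + of_int (n ^ 2 + n))) UNIV"
    using has_sum_index_coth_tanh by blast
  let ?d = "\<lambda>j. (\<i> * of_int (even_freq j)) ^ 1 * d j"
  have c: "((\<lambda>j. ?d j * s (n + 0 - j)) has_sum (2 * \<i> * s n * (A + of_int (n ^ 2 + n)))) UNIV" for n
  proof -
    have "((\<lambda>j. 2 * \<i> * s n * (of_int j * (u j + T (n - j)))) has_sum (2 * \<i> * s n * (A + of_int (n ^ 2 + n)))) UNIV"
      by (intro has_sum_cmult_right A)
    \<comment> \<open>The factor \<open>j\<close> that comes from the derivative removes the
      correction at \<open>j = 0\<close>.\<close>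
    moreover have "2 * \<i> * s n * (of_int j * (u j + T (n - j))) = ?d j * s (n + 0 - j)" for j
      using csch_mult_sech[of j n] by (cases "j = 0") (auto simp: even_freq_def algebra_simps)
    ultimately show ?thesis by simp
  qed
  show ?thesis
  proof (rule that)
    fix v assume v: "\<bar>Im v\<bar> < Re t"
    have D: "deriv (csch_series t) v = fourier even_freq ?d v"
      unfolding csch_series_def using fourier_holomorphic(2)[OF exp_decay_csch abs_le_freq(2) v, of 1] by simp
    have 1: "((\<lambda>n. (2 * \<i> * s n * (A + of_int (n ^ 2 + n))) * exp (\<i> * of_int (odd_freq n) * v)) has_sum
        deriv (csch_series t) v * sech_series t v) UNIV"
      unfolding D sech_series_def
      by (rule fourier_mult_has_sum[OF exp_decay_mult_freq_power[OF exp_decay_csch] abs_le_freq(2)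
            exp_decay_sech abs_le_freq(1) v _ c])
         (simp add: odd_freq_def even_freq_def)
    \<comment> \<open>From \<open>n^2 + n = ((2 n + 1)^2 - 1) / 4\<close>: the squared frequency is
      minus a second derivative, and the remaining \<open>- 1 / 4\<close> joins
      \<open>A\<close>.\<close>
    have "((\<lambda>n. 2 * \<i> * (A - 1 / 4) * ((\<i> * of_int (odd_freq n)) ^ 0 * s n * exp (\<i> * of_int (odd_freq n) * v)) +
            - \<i> / 2 * ((\<i> * of_int (odd_freq n)) ^ 2 * s n * exp (\<i> * of_int (odd_freq n) * v))) has_sum
         (2 * \<i> * (A - 1 / 4) * (deriv ^^ 0) (sech_series t) v + - \<i> / 2 * (deriv ^^ 2) (sech_series t) v)) UNIV"
      by (intro has_sum_add has_sum_cmult_right sech_series_higher_deriv v)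
    hence 2: "((\<lambda>n. (2 * \<i> * s n * (A + of_int (n ^ 2 + n))) * exp (\<i> * of_int (odd_freq n) * v)) has_sum
         (2 * \<i> * (A - 1 / 4) * (deriv ^^ 0) (sech_series t) v + - \<i> / 2 * (deriv ^^ 2) (sech_series t) v)) UNIV"
    proof (subst (asm) has_sum_cong)
      fix n :: int
      show "2 * \<i> * (A - 1 / 4) * ((\<i> * of_int (odd_freq n)) ^ 0 * s n * exp (\<i> * of_int (odd_freq n) * v)) +
            - \<i> / 2 * ((\<i> * of_int (odd_freq n)) ^ 2 * s n * exp (\<i> * of_int (odd_freq n) * v)) =
          (2 * \<i> * s n * (A + of_int (n ^ 2 + n))) * exp (\<i> * of_int (odd_freq n) * v)"
        by (simp add: odd_freq_def algebra_simps power2_eq_square)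
    qed simp
    have 3: "deriv (csch_series t) v * sech_series t v =
          2 * \<i> * (A - 1 / 4) * sech_series t v - \<i> / 2 * (deriv ^^ 2) (sech_series t) v"
      using has_sum_unique[OF 1 2] by simp
    have "sech_series t v ^ 3 = (sech_square_sum t - \<i> * deriv (csch_series t) v) * sech_series t v"
      using sech_series_square[OF v] by (simp add: power3_eq_cube power2_eq_square)
    also have "\<dots> = sech_square_sum t * sech_series t v - \<i> * (deriv (csch_series t) v * sech_series t v)"
      by (simp add: algebra_simps)
    also have "\<i> * (deriv (csch_series t) v * sech_series t v) =
        (deriv ^^ 2) (sech_series t) v / 2 - 2 * (A - 1 / 4) * sech_series t v"
      unfolding 3 by (simp add: algebra_simps)
    finally have "2 * sech_series t v ^ 3 = 2 * (sech_square_sum t * sech_series t v -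
        ((deriv ^^ 2) (sech_series t) v / 2 - 2 * (A - 1 / 4) * sech_series t v))"
      by (simp only:)
    thus "(deriv ^^ 2) (sech_series t) v =
         (2 * sech_square_sum t + 4 * (A - 1 / 4)) * sech_series t v - 2 * sech_series t v ^ 3"
      by (simp add: algebra_simps)
  qed
qed

section \<open>The product of the shifted sech series with the tanh remainder series\<close>

lemma alt_sign_reflect: "alt_sign (N - 1 - n) = alt_sign (N - 1) * alt_sign n"
  by (auto simp: alt_sign_def)

lemma alt_sign_cases: "alt_sign N = 1 \<or> alt_sign N = -1"
  by (auto simp: alt_sign_def)

lemma exp_decay_alt_sech: "exp_decay (Re t) odd_freq (\<lambda>n. alt_sign n * s n)"
  by (rule exp_decay_mult_bounded[OF exp_decay_sech, where B = 1]) (auto simp: alt_sign_def)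

text \<open>Reflection changes the alternating sign and preserves \<open>s\<close>, so the sum
  equals its own negative. In other words, \<open>C\<close> vanishes at
  \<open>\<pi>/2\<close>.\<close>

lemma alt_sech_has_sum: "((\<lambda>n. alt_sign n * s n) has_sum 0) UNIV"
proof -
  obtain S where S: "((\<lambda>n. alt_sign n * s n) has_sum S) UNIV"
    using summable_decay exp_decay_alt_sech unfolding summable_on_def by blast
  have "((\<lambda>n. - (alt_sign n * s n)) has_sum S) UNIV"
    using has_sum_int_reflect[OF S, of "-1"] alt_sign_reflect[of 0] odd_sech_reflect
    by (simp add: alt_sign_def)
  hence "S = - S" using has_sum_uminusI[OF S] has_sum_unique by blast
  thus ?thesis using S by simp
qed

text \<open>The substitution \<open>n \<mapsto> N - 1 - n\<close> reproduces the sum below up to the factor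
  \<open>\<mp>cosh (2 N t) \<noteq> 1\<close>, which forces it to vanish.\<close>

lemma alt_sech_tanh_has_sum:
  assumes "N \<noteq> 0"
  shows "((\<lambda>n. alt_sign n * s n * T (N - 1 - n)) has_sum 0) UNIV"
proof -
  let ?f = "\<lambda>n. alt_sign n * s n * T (N - 1 - n)"
  obtain B where B: "\<And>n. norm (T n) \<le> B" using odd_tanh_bounded by blast
  have "exp_decay (Re t) odd_freq (\<lambda>n. T (N - 1 - n) * (alt_sign n * s n))"
    by (rule exp_decay_mult_bounded[OF exp_decay_alt_sech B])
  hence "?f summable_on UNIV" using summable_decay by (simp add: mult.commute)
  then obtain X where X: "(?f has_sum X) UNIV" unfolding summable_on_def by blast
  define C S where "C = cosh (of_int (2 * N) * t)" and "S = sinh (of_int (2 * N) * t)"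
  have *: "s n * T (N - 1 - n) = S * s (N - 1 - n) - C * (T n * s (N - 1 - n))" for n
  proof -
    define a where "a = of_int (2 * n + 1) * t"
    define b where "b = of_int (2 * (N - 1 - n) + 1) * t"
    have ab: "of_int (2 * N) * t = a + b" by (simp add: a_def b_def algebra_simps)
    have nz: "cosh a \<noteq> 0" "cosh b \<noteq> 0"
      using cosh_odd_nz[of n] cosh_odd_nz[of "N - 1 - n"] unfolding a_def b_def by simp_all
    have "sinh b = sinh (a + b) * cosh a - cosh (a + b) * sinh a"
      using sinh_diff[of "a + b" a] by simp
    thus ?thesis
      unfolding odd_sech_def odd_tanh_def C_def S_def ab a_def[symmetric] b_def[symmetric]
      using nz by (simp add: field_simps)
  qed
  have "((\<lambda>n. S * alt_sign (N - 1) * (alt_sign (N - 1 - n) * s (N - 1 - n)) +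
            - (C * alt_sign (N - 1) * ?f (N - 1 - n))) has_sum
          (S * alt_sign (N - 1) * 0 + - (C * alt_sign (N - 1) * X))) UNIV"
    by (intro has_sum_add has_sum_uminusI has_sum_cmult_right has_sum_int_reflect[OF alt_sech_has_sum]
          has_sum_int_reflect[OF X])
  moreover have "S * alt_sign (N - 1) * (alt_sign (N - 1 - n) * s (N - 1 - n)) +
            - (C * alt_sign (N - 1) * ?f (N - 1 - n)) = ?f n" for n
  proof -
    have "alt_sign (N - 1) * alt_sign (N - 1) = 1" using alt_sign_cases[of "N - 1"] by auto
    hence 1: "alt_sign (N - 1) * alt_sign (N - 1 - n) = alt_sign n"
      by (simp add: alt_sign_reflect mult.assoc[symmetric])
    have "S * alt_sign (N - 1) * (alt_sign (N - 1 - n) * s (N - 1 - n)) + - (C * alt_sign (N - 1) * ?f (N - 1 - n)) =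
       (alt_sign (N - 1) * alt_sign (N - 1 - n)) * (S * s (N - 1 - n) - C * (T n * s (N - 1 - n)))"
      by (simp add: algebra_simps)
    thus ?thesis unfolding 1 *[symmetric] by simp
  qed
  ultimately have "(?f has_sum (- (C * alt_sign (N - 1) * X))) UNIV" by simp
  hence "X = - (C * alt_sign (N - 1) * X)" using X has_sum_unique by blast
  hence "X + C * alt_sign (N - 1) * X = 0" by (simp only: eq_neg_iff_add_eq_0)
  hence "X * (1 + C * alt_sign (N - 1)) = 0" by (simp add: algebra_simps)
  moreover have "C ^ 2 \<noteq> 1" using sinh_even_nz[OF assms] cosh_square_eq[of "of_int (2 * N) * t"] by (simp add: C_def)
  hence "1 + C * alt_sign (N - 1) \<noteq> 0"
    using alt_sign_cases[of "N - 1"] by (auto simp: add_eq_0_iff)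
  ultimately show ?thesis using X by simp
qed

lemma exp_odd_freq_half_pi:
  "exp (\<i> * of_int (odd_freq n) * of_real (pi / 2)) = \<i> * alt_sign n"
proof -
  have "\<i> * of_int (odd_freq n) * of_real (pi / 2) = \<i> * of_real (of_int n * pi) + \<i> * of_real (pi / 2)"
    by (simp add: odd_freq_def algebra_simps)
  also have "exp \<dots> = cis (of_int n * pi) * \<i>"
    by (simp only: exp_add cis_conv_exp[symmetric] cis_pi_half)
  also have "cis (of_int n * pi) = alt_sign n"
  proof (cases "even n")
    case True
    then obtain b where n: "n = 2 * b" by (elim evenE)
    have *: "of_int n * pi = 2 * pi * of_int b" by (simp add: n)
    show ?thesis using True unfolding * by (simp add: alt_sign_def complex_eq_iff cos_int_2pin sin_int_2pin)
  next
    case False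
    then obtain b where n: "n = 2 * b + 1" by (elim oddE)
    have *: "of_int n * pi = 2 * pi * of_int b + pi" by (simp add: n algebra_simps)
    show ?thesis using False unfolding * by (simp add: alt_sign_def complex_eq_iff cos_int_2pin sin_int_2pin)
  qed
  finally show ?thesis by simp
qed

text \<open>Multiplication by \<open>2 \<i> sin w\<close> takes differences of neighbouring
  coefficients. The part of the convolution that comes from the sign is a running sum of the
  coefficients of \<open>C\<close>, so its differences give \<open>C\<close> back; the part that
  comes from tanh is supported at \<open>N = 0\<close> and yields the multiple of
  \<open>sin w\<close>.\<close>

lemma sech_series_mult_tanh_rem:
  obtains X where "\<And>w. \<bar>Im w\<bar> < Re t \<Longrightarrow>
    sech_series t (of_real (pi / 2) + w) * (1 - sin w * tanh_rem_series t w) = X * sin w"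
proof -
  let ?a = "\<lambda>n. alt_sign n * s n"
  have sm: "(\<lambda>n. ?a n * b (N - 1 - n)) summable_on UNIV" if "\<And>n. norm (b n) \<le> B" for b :: "int \<Rightarrow> complex" and B N
  proof -
    have "exp_decay (Re t) odd_freq (\<lambda>n. b (N - 1 - n) * (alt_sign n * s n))"
      by (rule exp_decay_mult_bounded[OF exp_decay_alt_sech that])
    thus ?thesis using summable_decay by (simp add: mult.commute)
  qed
  define Y where "Y N = (\<Sum>\<^sub>\<infinity>n. ?a n * odd_sgn (N - 1 - n))" for N
  define X where "X N = (\<Sum>\<^sub>\<infinity>n. ?a n * T (N - 1 - n))" for N
  have Y: "((\<lambda>n. ?a n * odd_sgn (N - 1 - n)) has_sum Y N) UNIV" for N
    unfolding Y_def by (intro has_sum_infsum sm[of _ 1]) (auto simp: odd_sgn_def)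
  have X: "((\<lambda>n. ?a n * T (N - 1 - n)) has_sum X N) UNIV" for N
    unfolding X_def by (intro has_sum_infsum) (metis sm odd_tanh_bounded)
  have X0: "X N = 0" if "N \<noteq> 0" for N using has_sum_unique[OF X alt_sech_tanh_has_sum[OF that]] .
  have c: "((\<lambda>n. ?a n * odd_tanh_rem t (N + -1 - n)) has_sum (X N - Y N)) UNIV" for N
    using has_sum_add[OF X[of N] has_sum_uminusI[OF Y[of N]]] by (simp add: odd_tanh_rem_def algebra_simps)
  \<comment> \<open>Raising \<open>N\<close> by one changes \<open>odd_sgn (N - 1 - n)\<close> only
    at \<open>n = N\<close>, from -1 to 1.\<close>
  have YY: "Y (N + 1) - Y N = 2 * ?a N" for N
  proof -
    have "((\<lambda>n. ?a n * odd_sgn (N - n) + - (?a n * odd_sgn (N - 1 - n))) has_sum (Y (N + 1) + - Y N)) UNIV"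
      using has_sum_add[OF Y[of "N + 1"] has_sum_uminusI[OF Y[of N]]] by simp
    moreover have "((\<lambda>n. ?a n * odd_sgn (N - n) + - (?a n * odd_sgn (N - 1 - n))) has_sum 2 * ?a N) UNIV"
      by (rule has_sum_int_finite[of "{N}"]) (auto simp: odd_sgn_def)
    ultimately show ?thesis using has_sum_unique by fastforce
  qed
  show ?thesis
  proof (rule that[of "X 0"])
    fix w assume w: "\<bar>Im w\<bar> < Re t"
    define g where "g = fourier odd_freq ?a w"
    define R where "R = fourier odd_freq (odd_tanh_rem t) w"
    define e where "e = (\<lambda>N. exp (\<i> * of_int (odd_freq N) * w))"
    have g: "sech_series t (of_real (pi / 2) + w) = \<i> * g"
    proof -
      have "s n * exp (\<i> * of_int (odd_freq n) * (of_real (pi / 2) + w)) = \<i> * (?a n * exp (\<i> * of_int (odd_freq n) * w))" for n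
        unfolding distrib_left exp_add exp_odd_freq_half_pi by simp
      hence "(\<lambda>n. s n * exp (\<i> * of_int (odd_freq n) * (of_real (pi / 2) + w))) =
          (\<lambda>n. \<i> * (?a n * exp (\<i> * of_int (odd_freq n) * w)))" by blast
      thus ?thesis unfolding sech_series_def g_def fourier_def by (simp only: infsum_cmult_right')
    qed
    have gR: "((\<lambda>N. (X N - Y N) * exp (\<i> * of_int (even_freq N) * w)) has_sum g * R) UNIV"
      unfolding g_def R_def
      by (rule fourier_mult_has_sum[OF exp_decay_alt_sech abs_le_freq(1) exp_decay_tanh_rem abs_le_freq(1) w _ c])
         (simp add: odd_freq_def even_freq_def)
    have "((\<lambda>N. (X N - Y N) * e N) has_sum exp (\<i> * w) * (g * R)) UNIV"
    proof -
      have eq: "exp (\<i> * w) * ((X N - Y N) * exp (\<i> * of_int (even_freq N) * w)) = (X N - Y N) * e N" for N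
        by (simp add: e_def even_freq_def odd_freq_def exp_add algebra_simps)
      thus ?thesis using has_sum_cmult_right[OF gR, of "exp (\<i> * w)"] by (simp only: eq)
    qed
    moreover have "((\<lambda>N. (X (N + 1) - Y (N + 1)) * e N) has_sum exp (- \<i> * w) * (g * R)) UNIV"
    proof -
      have "exp (- \<i> * w) * exp (\<i> * of_int (even_freq (N + 1)) * w) = e N" for N
        by (simp add: e_def even_freq_def odd_freq_def exp_add[symmetric] algebra_simps)
      hence eq: "exp (- \<i> * w) * ((X (N + 1) - Y (N + 1)) * exp (\<i> * of_int (even_freq (N + 1)) * w)) =
          (X (N + 1) - Y (N + 1)) * e N" for N
        by (metis mult.left_commute)
      thus ?thesis using has_sum_cmult_right[OF has_sum_int_shift[OF gR, of 1], of "exp (- \<i> * w)"] by (simp only: eq)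
    qed
    ultimately have "((\<lambda>N. (X N - Y N) * e N + - ((X (N + 1) - Y (N + 1)) * e N)) has_sum
        (exp (\<i> * w) * (g * R) + - (exp (- \<i> * w) * (g * R)))) UNIV"
      by (intro has_sum_add has_sum_uminusI)
    moreover have "(X N - Y N) * e N + - ((X (N + 1) - Y (N + 1)) * e N) = 2 * (?a N * e N) + (X N - X (N + 1)) * e N" for N
    proof -
      have "(X N - Y N) * e N + - ((X (N + 1) - Y (N + 1)) * e N) = (Y (N + 1) - Y N) * e N + (X N - X (N + 1)) * e N"
        by (simp add: algebra_simps)
      thus ?thesis by (simp add: YY)
    qed
    ultimately have 1: "((\<lambda>N. 2 * (?a N * e N) + (X N - X (N + 1)) * e N) has_sum
        (exp (\<i> * w) * (g * R) + - (exp (- \<i> * w) * (g * R)))) UNIV" by simp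
    have "((\<lambda>N. ?a N * e N) has_sum g) UNIV"
      unfolding g_def e_def by (rule fourier_has_sum[OF exp_decay_alt_sech abs_le_freq(1) w])
    \<comment> \<open>Only \<open>X 0\<close> can be nonzero; it enters at \<open>N = 0\<close> with
      frequency 1 and at \<open>N = -1\<close> with frequency -1 and the opposite sign.\<close>
    moreover have "((\<lambda>N. (X N - X (N + 1)) * e N) has_sum (X 0 * (exp (\<i> * w) - exp (- \<i> * w)))) UNIV"
      by (rule has_sum_int_finite[of "{-1, 0}"]) (auto simp: X0 e_def odd_freq_def algebra_simps)
    ultimately have 2: "((\<lambda>N. 2 * (?a N * e N) + (X N - X (N + 1)) * e N) has_sum
        (2 * g + X 0 * (exp (\<i> * w) - exp (- \<i> * w)))) UNIV"
      by (intro has_sum_add has_sum_cmult_right)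
    have sn: "exp (\<i> * w) - exp (- \<i> * w) = 2 * \<i> * sin w"
      by (simp add: sin_exp_eq)
    have "(exp (\<i> * w) - exp (- \<i> * w)) * (g * R) = 2 * g + X 0 * (exp (\<i> * w) - exp (- \<i> * w))"
      using has_sum_unique[OF 1 2] by (simp add: algebra_simps)
    hence "2 * (\<i> * sin w * (g * R)) = 2 * (g + X 0 * (\<i> * sin w))" unfolding sn by (simp add: algebra_simps)
    hence "\<i> * sin w * (g * R) = g + X 0 * (\<i> * sin w)" by (simp only: mult_cancel_left) simp
    hence "\<i> * (\<i> * sin w * (g * R)) = \<i> * (g + X 0 * (\<i> * sin w))" by simp
    thus "sech_series t (of_real (pi / 2) + w) * (1 - sin w * tanh_rem_series t w) = X 0 * sin w"
      unfolding g tanh_rem_series_def R_def[symmetric] by (simp add: algebra_simps)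
  qed
qed

end

subsection \<open>Taylor expansions at the zero of the cosine series\<close>

lemma fps_expansion_deriv: "fps_expansion (deriv f) z = fps_deriv (fps_expansion f z)"
proof (rule fps_ext)
  fix n
  have "(deriv ^^ n) (deriv f) z = (deriv ^^ Suc n) f z"
    by (simp add: funpow_swap1)
  thus "fps_nth (fps_expansion (deriv f) z) n = fps_nth (fps_deriv (fps_expansion f z)) n"
    by (simp add: fps_expansion_def fact_Suc del: funpow.simps of_nat_Suc)
qed

lemma fps_expansion_unique:
  assumes "f has_fps_expansion F" "g has_fps_expansion G" "open A" "0 \<in> A" "\<And>z. z \<in> A \<Longrightarrow> f z = g z"
  shows "F = (G :: complex fps)"
proof -
  have "\<forall>\<^sub>F z in nhds 0. f z = g z"
    using assms(3-5) by (intro eventually_nhds[THEN iffD2]) blast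
  hence "f has_fps_expansion G" using assms(2) has_fps_expansion_cong by blast
  thus ?thesis using assms(1) fps_expansion_eqI by metis
qed

lemma fps_mult_nth_small:
  fixes F G :: "'a::comm_ring_1 fps"
  shows "fps_nth (F * G) 0 = fps_nth F 0 * fps_nth G 0"
    "fps_nth (F * G) 1 = fps_nth F 0 * fps_nth G 1 + fps_nth F 1 * fps_nth G 0"
    "fps_nth (F * G) 2 = fps_nth F 0 * fps_nth G 2 + fps_nth F 1 * fps_nth G 1 + fps_nth F 2 * fps_nth G 0"
    "fps_nth (F * G) 3 = fps_nth F 0 * fps_nth G 3 + fps_nth F 1 * fps_nth G 2 + fps_nth F 2 * fps_nth G 1 + fps_nth F 3 * fps_nth G 0"
    "fps_nth (F * G) 4 = fps_nth F 0 * fps_nth G 4 + fps_nth F 1 * fps_nth G 3 + fps_nth F 2 * fps_nth G 2 + fps_nth F 3 * fps_nth G 1 + fps_nth F 4 * fps_nth G 0"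
  by (simp_all add: fps_mult_nth atLeast0_atMost_Suc eval_nat_numeral add_ac)

lemma fps_deriv_nth_small:
  fixes F :: "complex fps"
  shows "fps_nth (fps_deriv F) 0 = fps_nth F 1" "fps_nth (fps_deriv F) 1 = 2 * fps_nth F 2"
    "fps_nth (fps_deriv F) 2 = 3 * fps_nth F 3" "fps_nth (fps_deriv F) 3 = 4 * fps_nth F 4"
    "fps_nth (fps_deriv F) 4 = 5 * fps_nth F 5"
  by (simp_all only: fps_deriv_nth) (simp_all add: eval_nat_numeral)

lemma fps_const_nth_small:
  "fps_nth (fps_const c) 0 = c" "fps_nth (fps_const c) 1 = 0" "fps_nth (fps_const c) 2 = 0"
  by simp_all

abbreviation half_pi :: complex where "half_pi \<equiv> complex_of_real (pi / 2)"

text \<open>At \<open>\<pi>/2\<close> the exponentials become \<open>\<i> * (-1)^n\<close>, the sign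
  carried by the residues of the secant; these coefficients serve odd \<open>m\<close>. The residues
  of the squared secant have no sign, so for even \<open>m\<close> the expansion of
  \<open>tanh_rem_fps\<close> is at 0.\<close>

definition sech_fps :: "complex \<Rightarrow> complex fps" where
  "sech_fps t = fps_expansion (sech_series t) half_pi"

definition csch_fps :: "complex \<Rightarrow> complex fps" where
  "csch_fps t = fps_expansion (csch_series t) half_pi"

definition sech_tanh_fps :: "complex \<Rightarrow> complex fps" where
  "sech_tanh_fps t = fps_expansion (sech_tanh_series t) half_pi"

definition csch_coth_fps :: "complex \<Rightarrow> complex fps" where
  "csch_coth_fps t = fps_expansion (csch_coth_series t) half_pi"

definition tanh_rem_fps :: "complex \<Rightarrow> complex fps" where
  "tanh_rem_fps t = fps_expansion (tanh_rem_series t) 0"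

context right_half_plane
begin

lemma strip_shift: "\<bar>Im v\<bar> < Re t \<Longrightarrow> \<bar>Im (half_pi + v)\<bar> < Re t"
  by simp

lemma fourier_has_fps:
  assumes "exp_decay (Re t) \<omega> a" "\<And>n. \<bar>n\<bar> \<le> \<bar>\<omega> n\<bar>"
  shows "(\<lambda>w. fourier \<omega> a (of_real x + w)) has_fps_expansion fps_expansion (fourier \<omega> a) (of_real x)"
    and "(\<lambda>w. deriv (fourier \<omega> a) (of_real x + w)) has_fps_expansion fps_deriv (fps_expansion (fourier \<omega> a) (of_real x))"
    and "(\<lambda>w. (deriv ^^ 2) (fourier \<omega> a) (of_real x + w)) has_fps_expansion fps_deriv (fps_deriv (fps_expansion (fourier \<omega> a) (of_real x)))"
proof -
  have "fourier \<omega> a analytic_on {of_real x}"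
    using fourier_holomorphic(1)[OF assms] t open_strip by (intro analytic_on_open[THEN iffD2, THEN analytic_on_subset]) auto
  thus "(\<lambda>w. fourier \<omega> a (of_real x + w)) has_fps_expansion fps_expansion (fourier \<omega> a) (of_real x)"
    and "(\<lambda>w. deriv (fourier \<omega> a) (of_real x + w)) has_fps_expansion fps_deriv (fps_expansion (fourier \<omega> a) (of_real x))"
    and "(\<lambda>w. (deriv ^^ 2) (fourier \<omega> a) (of_real x + w)) has_fps_expansion fps_deriv (fps_deriv (fps_expansion (fourier \<omega> a) (of_real x)))"
    unfolding fps_expansion_deriv[symmetric]
    by (auto intro!: analytic_at_imp_has_fps_expansion analytic_deriv simp: numeral_2_eq_2)
qed

lemmas sech_has_fps = fourier_has_fps[OF exp_decay_sech abs_le_freq(1), of "pi / 2", folded sech_series_def, folded sech_fps_def]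
lemmas csch_has_fps = fourier_has_fps[OF exp_decay_csch abs_le_freq(2), of "pi / 2", folded csch_series_def, folded csch_fps_def]
lemmas sech_tanh_has_fps = fourier_has_fps[OF exp_decay_sech_tanh abs_le_freq(1), of "pi / 2", folded sech_tanh_series_def, folded sech_tanh_fps_def]
lemmas csch_coth_has_fps = fourier_has_fps[OF exp_decay_csch_coth abs_le_freq(2), of "pi / 2", folded csch_coth_series_def, folded csch_coth_fps_def]

lemma tanh_rem_has_fps: "tanh_rem_series t has_fps_expansion tanh_rem_fps t"
proof -
  have "fourier odd_freq (odd_tanh_rem t) analytic_on {0}"
    using fourier_holomorphic(1)[OF exp_decay_tanh_rem abs_le_freq(1)] t open_strip
    by (intro analytic_on_open[THEN iffD2, THEN analytic_on_subset]) auto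
  hence "tanh_rem_series t analytic_on {0}"
    unfolding tanh_rem_series_def by (intro analytic_intros)
  thus ?thesis using analytic_at_imp_has_fps_expansion[of "tanh_rem_series t" 0] by (simp add: tanh_rem_fps_def)
qed

lemma zero_in_strip: "0 \<in> {v. \<bar>Im v\<bar> < Re t}" using t by simp

lemma sech_fps_square: "sech_fps t ^ 2 = fps_const (sech_square_sum t) - fps_const \<i> * fps_deriv (csch_fps t)"
proof (rule fps_expansion_unique[OF _ _ open_strip zero_in_strip])
  show "(\<lambda>w. sech_series t (half_pi + w) ^ 2) has_fps_expansion sech_fps t ^ 2"
    by (intro fps_expansion_intros sech_has_fps)
  show "(\<lambda>w. sech_square_sum t - \<i> * deriv (csch_series t) (half_pi + w)) has_fps_expansion
          fps_const (sech_square_sum t) - fps_const \<i> * fps_deriv (csch_fps t)"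
    by (intro fps_expansion_intros csch_has_fps)
qed (use sech_series_square strip_shift in auto)

lemma csch_fps_mult_sech_fps: "csch_fps t * sech_fps t = - fps_const \<i> * fps_deriv (sech_fps t) - sech_tanh_fps t"
proof (rule fps_expansion_unique[OF _ _ open_strip zero_in_strip])
  show "(\<lambda>w. csch_series t (half_pi + w) * sech_series t (half_pi + w)) has_fps_expansion csch_fps t * sech_fps t"
    by (intro fps_expansion_intros sech_has_fps csch_has_fps)
  show "(\<lambda>w. - \<i> * deriv (sech_series t) (half_pi + w) - sech_tanh_series t (half_pi + w)) has_fps_expansion
          - fps_const \<i> * fps_deriv (sech_fps t) - sech_tanh_fps t"
    by (simp only: fps_const_neg, intro fps_expansion_intros sech_has_fps sech_tanh_has_fps)
qed (use csch_series_mult_sech_series strip_shift in auto)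

lemma csch_fps_square: obtains z where
  "csch_fps t ^ 2 = fps_const z - fps_const \<i> * fps_deriv (csch_fps t) - fps_const 2 * csch_coth_fps t"
proof -
  obtain z where z: "\<And>v. \<bar>Im v\<bar> < Re t \<Longrightarrow>
    csch_series t v ^ 2 = z - \<i> * deriv (csch_series t) v - 2 * csch_coth_series t v"
    using csch_series_square by blast
  have "csch_fps t ^ 2 = fps_const z - fps_const \<i> * fps_deriv (csch_fps t) - fps_const 2 * csch_coth_fps t"
  proof (rule fps_expansion_unique[OF _ _ open_strip zero_in_strip])
    show "(\<lambda>w. csch_series t (half_pi + w) ^ 2) has_fps_expansion csch_fps t ^ 2"
      by (intro fps_expansion_intros csch_has_fps)
    show "(\<lambda>w. z - \<i> * deriv (csch_series t) (half_pi + w) - 2 * csch_coth_series t (half_pi + w)) has_fps_expansion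
        fps_const z - fps_const \<i> * fps_deriv (csch_fps t) - fps_const 2 * csch_coth_fps t"
      by (intro fps_expansion_intros csch_has_fps csch_coth_has_fps)
  qed (use z strip_shift in auto)
  thus ?thesis using that by blast
qed

lemma sech_fps_ODE_exists: obtains K where
  "fps_deriv (fps_deriv (sech_fps t)) = fps_const K * sech_fps t - fps_const 2 * sech_fps t ^ 3"
  "\<And>v. \<bar>Im v\<bar> < Re t \<Longrightarrow> (deriv ^^ 2) (sech_series t) v = K * sech_series t v - 2 * sech_series t v ^ 3"
proof -
  obtain K where K: "\<And>v. \<bar>Im v\<bar> < Re t \<Longrightarrow>
    (deriv ^^ 2) (sech_series t) v = K * sech_series t v - 2 * sech_series t v ^ 3"
    using sech_series_ODE by blast
  have "fps_deriv (fps_deriv (sech_fps t)) = fps_const K * sech_fps t - fps_const 2 * sech_fps t ^ 3"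
  proof (rule fps_expansion_unique[OF _ _ open_strip zero_in_strip])
    show "(\<lambda>w. (deriv ^^ 2) (sech_series t) (half_pi + w)) has_fps_expansion fps_deriv (fps_deriv (sech_fps t))"
      by (intro fps_expansion_intros sech_has_fps)
    show "(\<lambda>w. K * sech_series t (half_pi + w) - 2 * sech_series t (half_pi + w) ^ 3) has_fps_expansion
        fps_const K * sech_fps t - fps_const 2 * sech_fps t ^ 3"
      by (intro fps_expansion_intros sech_has_fps)
  qed (use K strip_shift in auto)
  thus ?thesis using that K by blast
qed

lemma sech_fps_nth_0: "fps_nth (sech_fps t) 0 = 0"
proof -
  have "((\<lambda>n. s n * exp (\<i> * of_int (odd_freq n) * half_pi)) has_sum sech_series t half_pi) UNIV"
    using sech_series_higher_deriv[of half_pi 0] t by simp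
  moreover have "((\<lambda>n. s n * exp (\<i> * of_int (odd_freq n) * half_pi)) has_sum (\<i> * 0)) UNIV"
    using has_sum_cmult_right[OF alt_sech_has_sum, of \<i>] unfolding exp_odd_freq_half_pi by (simp add: mult_ac)
  ultimately show ?thesis using has_sum_unique by (fastforce simp: sech_fps_def fps_expansion_def)
qed

lemma exp_even_freq_half_pi: "exp (\<i> * of_int (even_freq n) * half_pi) = alt_sign n"
proof -
  have "\<i> * of_int (even_freq n) * half_pi = \<i> * of_int (odd_freq n) * half_pi - \<i> * half_pi"
    by (simp add: even_freq_def odd_freq_def algebra_simps)
  also have "exp \<dots> = alt_sign n"
    by (simp only: exp_diff exp_odd_freq_half_pi cis_conv_exp[symmetric] cis_pi_half) simp
  finally show ?thesis .
qed

lemma csch_fps_nth_0: "fps_nth (csch_fps t) 0 = 0"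
proof -
  have *: "((\<lambda>n. d n * alt_sign n) has_sum csch_series t half_pi) UNIV"
    using csch_series_higher_deriv[of half_pi 0] t by (simp add: exp_even_freq_half_pi del: of_real_divide)
  hence "((\<lambda>n. d n * alt_sign n) has_sum 0) UNIV"
    by (intro has_sum_int_odd has_sum_imp_summable[OF *]) (simp add: even_csch_uminus alt_sign_def)
  with * have "csch_series t half_pi = 0" using has_sum_unique by blast
  thus ?thesis by (simp add: csch_fps_def fps_expansion_def)
qed

text \<open>\<open>L\<close>, \<open>K\<close>, \<open>e\<close> sit in the coefficients 1 and 3 of
  the sech series and 1 of the csch series. Their derivatives in \<open>t\<close> involve the
  coefficients 2 and 4 of the sech-tanh series and 2 of the csch-coth series; the differential
  equation and the three product identities determine these at low orders.\<close>

lemma sech_fps_coeffs: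
  assumes K: "fps_deriv (fps_deriv (sech_fps t)) = fps_const K * sech_fps t - fps_const 2 * sech_fps t ^ 3"
  defines "L \<equiv> fps_nth (sech_fps t) 1" and "e \<equiv> sech_square_sum t"
  shows "fps_nth (sech_fps t) 3 = K * L / 6"
    and "2 * fps_nth (sech_tanh_fps t) 2 = 2 * \<i> * e * L - \<i> * K * L"
    and "24 * fps_nth (sech_tanh_fps t) 4 = 4 * \<i> * e * K * L + 4 * \<i> * L ^ 3 - \<i> * K ^ 2 * L"
    and "fps_nth (csch_fps t) 1 = - \<i> * e"
    and "2 * fps_nth (csch_coth_fps t) 2 = L ^ 2 + e ^ 2"
proof -
  define C where "C = fps_nth (sech_fps t)"
  define D where "D = fps_nth (csch_fps t)"
  have C0: "C 0 = 0" and D0: "D 0 = 0" using sech_fps_nth_0 csch_fps_nth_0 by (auto simp: C_def D_def)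
  have L: "C 1 = L" by (simp add: L_def C_def)
  note nth = fps_sub_nth fps_mult_left_const_nth fps_mult_nth_small fps_deriv_nth_small fps_const_nth_small
    power2_eq_square power3_eq_cube mult.assoc fps_neg_nth fps_const_neg
  note fold_names = C_def[THEN fun_cong, symmetric] D_def[THEN fun_cong, symmetric] C0 D0 L mult_zero_left mult_zero_right
    add_0_left add_0_right diff_zero diff_0
  note ODE = arg_cong[OF K, of "\<lambda>F. fps_nth F n" for n, unfolded nth]
  have C2: "C 2 = 0" using ODE[of 0, unfolded nth fold_names] by simp
  note names = fold_names C2
  have C3: "6 * C 3 = K * L" using ODE[of 1, unfolded nth names] by simp
  have C4: "C 4 = 0" using ODE[of 2, unfolded nth names] by simp
  have C5: "20 * C 5 = K * C 3 - 2 * L ^ 3"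
    using ODE[of 3, unfolded nth names] by (simp add: power3_eq_cube)
  note sq = arg_cong[OF sech_fps_square, of "\<lambda>F. fps_nth F n" for n, unfolded nth]
  have D1': "D 1 = - \<i> * e"
  proof -
    have "e - \<i> * D 1 = 0" using sq[of 0, unfolded nth names] unfolding e_def by simp
    hence "e = \<i> * D 1" by simp
    thus ?thesis by simp
  qed
  have D2: "D 2 = 0"
  proof -
    have "\<i> * (2 * D 2) = 0" using sq[of 1, unfolded nth names] by (metis neg_0_equal_iff_equal)
    thus ?thesis by simp
  qed
  have D3': "D 3 = \<i> * L ^ 2 / 3"
  proof -
    have "L ^ 2 = - (\<i> * (3 * D 3))" using sq[of 2, unfolded nth names] unfolding power2_eq_square .
    hence "\<i> * L ^ 2 / 3 = \<i> * (- (\<i> * (3 * D 3))) / 3" by (simp only:)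
    thus ?thesis by simp
  qed
  have C3': "C 3 = K * L / 6" using C3 by (simp add: field_simps)
  note DC = arg_cong[OF csch_fps_mult_sech_fps, of "\<lambda>F. fps_nth F n" for n, unfolded nth]
  have V2: "D 1 * L = - \<i> * (3 * C 3) - fps_nth (sech_tanh_fps t) 2"
    using DC[of 2, unfolded nth names] by simp
  have V4: "D 1 * C 3 + D 3 * L = - \<i> * (5 * C 5) - fps_nth (sech_tanh_fps t) 4"
    using DC[of 4, unfolded nth names C4 D2] by simp
  obtain z where z: "csch_fps t ^ 2 = fps_const z - fps_const \<i> * fps_deriv (csch_fps t) - fps_const 2 * csch_coth_fps t"
    using csch_fps_square by blast
  have W2: "D 1 * D 1 = - (\<i> * (3 * D 3)) - 2 * fps_nth (csch_coth_fps t) 2"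
    using arg_cong[OF z, of "\<lambda>F. fps_nth F 2", unfolded nth names] by simp
  show "fps_nth (sech_fps t) 3 = K * L / 6" using C3' by (simp add: C_def)
  show "fps_nth (csch_fps t) 1 = - \<i> * e" using D1' by (simp add: D_def)
  have "fps_nth (sech_tanh_fps t) 2 = - \<i> * (3 * C 3) - D 1 * L" using V2 by (simp add: algebra_simps)
  hence "2 * fps_nth (sech_tanh_fps t) 2 = 2 * (- \<i> * (3 * C 3) - D 1 * L)" by (simp only:)
  thus "2 * fps_nth (sech_tanh_fps t) 2 = 2 * \<i> * e * L - \<i> * K * L"
    unfolding C3' D1' by (simp add: algebra_simps)
  have "fps_nth (sech_tanh_fps t) 4 = - \<i> * (5 * C 5) - (D 1 * C 3 + D 3 * L)" using V4 by (simp add: algebra_simps)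
  hence "24 * fps_nth (sech_tanh_fps t) 4 = 24 * (- \<i> * (5 * C 5) - (D 1 * C 3 + D 3 * L))" by (simp only:)
  also have "\<dots> = - 6 * \<i> * (20 * C 5) - 24 * (D 1 * C 3 + D 3 * L)"
    by (simp add: algebra_simps)
  finally have "24 * fps_nth (sech_tanh_fps t) 4 = - 6 * \<i> * (20 * C 5) - 24 * (D 1 * C 3 + D 3 * L)" .
  thus "24 * fps_nth (sech_tanh_fps t) 4 = 4 * \<i> * e * K * L + 4 * \<i> * L ^ 3 - \<i> * K ^ 2 * L"
    unfolding C5 C3' D1' D3' by (simp add: power2_eq_square power3_eq_cube algebra_simps)
  have "2 * fps_nth (csch_coth_fps t) 2 = - (\<i> * (3 * D 3)) - D 1 * D 1" unfolding W2 by simp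
  thus "2 * fps_nth (csch_coth_fps t) 2 = L ^ 2 + e ^ 2"
    unfolding D1' D3' by (simp add: power2_eq_square algebra_simps)
qed

text \<open>Comparison at first order: \<open>C\<close> has no constant term at
  \<open>\<pi>/2\<close>, and the factor \<open>1 - sin w * \<Psi>(w)\<close> has constant term 1,
  so the constant of the product identity is the slope.\<close>

lemma sech_series_mult_tanh_rem_slope:
  shows "\<And>w. \<bar>Im w\<bar> < Re t \<Longrightarrow> sech_series t (half_pi + w) * (1 - sin w * tanh_rem_series t w) = fps_nth (sech_fps t) 1 * sin w"
  and sech_fps_mult_tanh_rem_fps:
  "sech_fps t * (1 - fps_sin 1 * tanh_rem_fps t) = fps_const (fps_nth (sech_fps t) 1) * fps_sin 1"
proof -
  obtain X where X: "\<And>w. \<bar>Im w\<bar> < Re t \<Longrightarrow>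
    sech_series t (half_pi + w) * (1 - sin w * tanh_rem_series t w) = X * sin w"
    using sech_series_mult_tanh_rem by blast
  have *: "sech_fps t * (fps_const 1 - fps_sin 1 * tanh_rem_fps t) = fps_const X * fps_sin 1"
  proof (rule fps_expansion_unique[OF _ _ open_strip zero_in_strip])
    show "(\<lambda>w. sech_series t (half_pi + w) * (1 - sin w * tanh_rem_series t w)) has_fps_expansion
            sech_fps t * (fps_const 1 - fps_sin 1 * tanh_rem_fps t)"
      by (intro fps_expansion_intros sech_has_fps tanh_rem_has_fps)
    show "(\<lambda>w. X * sin w) has_fps_expansion fps_const X * fps_sin 1"
      by (intro fps_expansion_intros)
  qed (use X in auto)
  have "fps_nth (sech_fps t) 1 = X"
    using arg_cong[OF *, of "\<lambda>F. fps_nth F 1"] sech_fps_nth_0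
    by (simp only: fps_mult_nth_small fps_mult_left_const_nth fps_sub_nth) (simp add: fps_sin_def)
  thus "\<And>w. \<bar>Im w\<bar> < Re t \<Longrightarrow> sech_series t (half_pi + w) * (1 - sin w * tanh_rem_series t w) = fps_nth (sech_fps t) 1 * sin w"
    and "sech_fps t * (1 - fps_sin 1 * tanh_rem_fps t) = fps_const (fps_nth (sech_fps t) 1) * fps_sin 1"
    using * X by auto
qed

end

subsection \<open>Differentiation with respect to the parameter\<close>

lemma open_right_half_plane: "open {t. \<rho> < Re t}"
  by (intro open_Collect_less continuous_intros)

text \<open>Derivatives in \<open>t\<close> are taken termwise on half planes
  \<open>Re t > \<rho>\<close>, where the bound is uniform. It degenerates at the imaginary axis, so
  \<open>Re t > 0\<close> is reached by exhaustion.\<close>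

lemma half_plane_series:
  fixes \<phi> :: "int \<Rightarrow> complex \<Rightarrow> complex"
  assumes hol: "\<And>k. \<phi> k holomorphic_on {t. 0 < Re t}"
    and bound: "\<And>\<rho>. \<rho> > 0 \<Longrightarrow> \<exists>M. \<forall>k t. \<rho> \<le> Re t \<longrightarrow> norm (\<phi> k t) \<le> M * exp (- \<rho> * \<bar>of_int (\<omega> k)\<bar>)"
    and \<omega>: "\<And>k. \<bar>k\<bar> \<le> \<bar>\<omega> k\<bar>" and c: "\<And>k. norm (c k) \<le> 1"
  shows "(\<lambda>t. \<Sum>\<^sub>\<infinity>k. c k * (\<i> * of_int (\<omega> k)) ^ n * \<phi> k t) holomorphic_on {t. 0 < Re t}"
    and "0 < Re t \<Longrightarrow> ((\<lambda>k. c k * (\<i> * of_int (\<omega> k)) ^ n * (deriv ^^ b) (\<phi> k) t) has_sum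
           (deriv ^^ b) (\<lambda>t. \<Sum>\<^sub>\<infinity>k. c k * (\<i> * of_int (\<omega> k)) ^ n * \<phi> k t) t) UNIV"
proof -
  let ?F = "\<lambda>t. \<Sum>\<^sub>\<infinity>k. c k * (\<i> * of_int (\<omega> k)) ^ n * \<phi> k t"
  have *: "?F holomorphic_on {t. \<rho> < Re t} \<and>
     (\<rho> < Re t \<longrightarrow> ((\<lambda>k. c k * (\<i> * of_int (\<omega> k)) ^ n * (deriv ^^ b) (\<phi> k) t) has_sum (deriv ^^ b) ?F t) UNIV)"
    if \<rho>: "\<rho> > 0" for \<rho> t
  proof -
    obtain M where M: "\<And>k t. \<rho> \<le> Re t \<Longrightarrow> norm (\<phi> k t) \<le> M * exp (- \<rho> * \<bar>of_int (\<omega> k)\<bar>)"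
      using bound[OF \<rho>] by blast
    define m where "m = (\<lambda>k. norm ((\<i> * of_int (\<omega> k)) ^ n * of_real (M * exp (- \<rho> * \<bar>of_int (\<omega> k)\<bar>)) :: complex))"
    have "exp_decay \<rho> \<omega> (\<lambda>k. of_real (M * exp (- \<rho> * \<bar>of_int (\<omega> k)\<bar>)))"
      by (rule exp_decayI[of _ "\<bar>M\<bar>"]) (simp add: norm_mult)
    from exp_decay_summable[OF exp_decay_mult_freq_power[OF this] \<omega> \<rho>]
    have m: "m summable_on UNIV"
      unfolding m_def summable_on_iff_abs_summable_on_complex .
    have hol': "\<phi> k holomorphic_on {t. \<rho> < Re t}" for k
      using hol by (rule holomorphic_on_subset) (use \<rho> in auto)
    have le: "norm (c k * (\<i> * of_int (\<omega> k)) ^ n * \<phi> k t) \<le> m k" if "t \<in> {t. \<rho> < Re t}" for k t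
    proof -
      have "norm (\<phi> k t) \<le> \<bar>M * exp (- \<rho> * \<bar>of_int (\<omega> k)\<bar>)\<bar>" using M[of t k] that by simp
      hence "norm (c k) * (norm ((\<i> * of_int (\<omega> k)) ^ n :: complex) * norm (\<phi> k t)) \<le>
          1 * (norm ((\<i> * of_int (\<omega> k)) ^ n :: complex) * \<bar>M * exp (- \<rho> * \<bar>of_int (\<omega> k)\<bar>)\<bar>)"
        using c[of k] by (intro mult_mono) auto
      thus ?thesis by (simp add: m_def norm_mult abs_mult mult.assoc)
    qed
    have hol'': "(\<lambda>t. c k * (\<i> * of_int (\<omega> k)) ^ n * \<phi> k t) holomorphic_on {t. \<rho> < Re t}" for k
      by (intro holomorphic_intros hol')
    have 1: "?F holomorphic_on {t. \<rho> < Re t}"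
      by (rule termwise_higher_deriv(1)[OF open_right_half_plane hol'' le m])
    have "((\<lambda>k. (deriv ^^ b) (\<lambda>t. c k * (\<i> * of_int (\<omega> k)) ^ n * \<phi> k t) t) has_sum (deriv ^^ b) ?F t) UNIV"
      if "\<rho> < Re t"
      by (rule termwise_higher_deriv(2)[OF open_right_half_plane hol'' le m]) (use that in auto)
    moreover have "(deriv ^^ b) (\<lambda>t. c k * (\<i> * of_int (\<omega> k)) ^ n * \<phi> k t) t =
        c k * (\<i> * of_int (\<omega> k)) ^ n * (deriv ^^ b) (\<phi> k) t" if "\<rho> < Re t" for k
      by (rule higher_deriv_cmult[OF hol' _ open_right_half_plane]) (use that in auto)
    ultimately show ?thesis using 1 by simp
  qed
  show "0 < Re t \<Longrightarrow> ((\<lambda>k. c k * (\<i> * of_int (\<omega> k)) ^ n * (deriv ^^ b) (\<phi> k) t) has_sum (deriv ^^ b) ?F t) UNIV"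
    using *[of "Re t / 2" t] by simp
  have "?F field_differentiable at t" if "0 < Re t" for t
    using *[of "Re t / 2" t] that open_right_half_plane
    by (auto intro!: holomorphic_on_imp_differentiable_at[of _ "{w. Re t / 2 < Re w}"])
  thus "?F holomorphic_on {t. 0 < Re t}"
    by (auto simp: holomorphic_on_def field_differentiable_at_within)
qed

lemma odd_sech_uniform_decay:
  assumes "\<rho> > 0"
  shows "\<exists>M. \<forall>k t. \<rho> \<le> Re t \<longrightarrow> norm (odd_sech t k) \<le> M * exp (- \<rho> * \<bar>of_int (odd_freq k)\<bar>)"
  using norm_sech_csch_le(1)[OF assms _ odd_freq_nonzero] unfolding odd_sech_def odd_freq_def by blast

lemma even_csch_uniform_decay:
  assumes "\<rho> > 0"
  shows "\<exists>M. \<forall>k t. \<rho> \<le> Re t \<longrightarrow> norm (even_csch t k) \<le> M * exp (- \<rho> * \<bar>of_int (even_freq k)\<bar>)"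
proof (intro exI allI impI)
  fix k t assume t: "\<rho> \<le> Re t"
  show "norm (even_csch t k) \<le> 2 / (1 - exp (- 2 * \<rho>)) * exp (- \<rho> * \<bar>of_int (even_freq k)\<bar>)"
  proof (cases "k = 0")
    case True
    thus ?thesis using assms by (simp add: even_csch_def)
  next
    case False
    thus ?thesis using norm_sech_csch_le(2)[OF assms t, of "2 * k"] by (simp only: even_csch_def even_freq_def)
  qed
qed

lemma odd_tanh_rem_uniform_decay:
  assumes "\<rho> > 0"
  shows "\<exists>M. \<forall>k t. \<rho> \<le> Re t \<longrightarrow> norm (odd_tanh_rem t k) \<le> M * exp (- \<rho> * \<bar>of_int (odd_freq k)\<bar>)"
proof -
  obtain M where M: "\<And>k t. \<rho> \<le> Re t \<Longrightarrow> norm (odd_sech t k) \<le> M * exp (- \<rho> * \<bar>of_int (odd_freq k)\<bar>)"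
    using odd_sech_uniform_decay[OF assms] by blast
  have "norm (odd_tanh_rem t k) \<le> M * exp (- \<rho> * \<bar>of_int (odd_freq k)\<bar>)" if \<rho>: "\<rho> \<le> Re t" for k t
  proof -
    have t0: "Re t > 0" using \<rho> assms by simp
    interpret right_half_plane t by standard (rule t0)
    have "norm (odd_tanh_rem t k) \<le> 1 * norm (odd_sech t k)"
      unfolding odd_tanh_rem_eq norm_mult
      by (intro mult_right_mono) (use t0 in \<open>auto simp: odd_sgn_def\<close>)
    thus ?thesis using M[OF \<rho>, of k] by simp
  qed
  thus ?thesis by blast
qed

lemma odd_sech_deriv:
  assumes "Re t > 0"
  shows "((\<lambda>t. odd_sech t k) has_field_derivative - of_int (odd_freq k) * (odd_tanh t k * odd_sech t k)) (at t)"
proof -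
  interpret right_half_plane t by standard (rule assms)
  show ?thesis unfolding odd_sech_def odd_tanh_def odd_freq_def using cosh_odd_nz[of k]
    by (auto intro!: derivative_eq_intros simp: field_simps)
qed

lemma even_csch_deriv:
  assumes "Re t > 0"
  shows "((\<lambda>t. even_csch t k) has_field_derivative - of_int (even_freq k) * (even_coth t k * even_csch t k)) (at t)"
proof (cases "k = 0")
  case False
  interpret right_half_plane t by standard (rule assms)
  show ?thesis unfolding even_csch_def even_coth_def even_freq_def using sinh_even_nz[OF False]
    by (auto intro!: derivative_eq_intros simp: field_simps)
qed (simp add: even_csch_def)

lemma odd_tanh_rem_deriv:
  assumes "Re t > 0"
  shows "((\<lambda>t. odd_tanh_rem t k) has_field_derivative of_int (odd_freq k) * odd_sech t k ^ 2) (at t)"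
proof -
  interpret right_half_plane t by standard (rule assms)
  show ?thesis unfolding odd_tanh_rem_def odd_tanh_def odd_sech_def odd_freq_def using cosh_odd_nz[of k]
    by (auto intro!: derivative_eq_intros simp: cosh_square_eq power2_eq_square[symmetric] field_simps)
qed

lemma holomorphic_onI_deriv:
  assumes "\<And>t. 0 < Re t \<Longrightarrow> (f has_field_derivative f' t) (at t)"
  shows "f holomorphic_on {t. 0 < Re t}"
  using assms open_right_half_plane[of 0] unfolding holomorphic_on_def field_differentiable_def
  by (metis at_within_open mem_Collect_eq)

lemmas odd_sech_half_plane_series =
  half_plane_series[of "\<lambda>k t. odd_sech t k" odd_freq, OF holomorphic_onI_deriv[OF odd_sech_deriv] odd_sech_uniform_decay abs_le_freq(1)]
lemmas even_csch_half_plane_series =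
  half_plane_series[of "\<lambda>k t. even_csch t k" even_freq, OF holomorphic_onI_deriv[OF even_csch_deriv] even_csch_uniform_decay abs_le_freq(2)]
lemmas odd_tanh_rem_half_plane_series =
  half_plane_series[of "\<lambda>k t. odd_tanh_rem t k" odd_freq, OF holomorphic_onI_deriv[OF odd_tanh_rem_deriv] odd_tanh_rem_uniform_decay abs_le_freq(1)]

lemma fps_expansion_fourier_half_pi:
  assumes a: "exp_decay \<rho> \<omega> a" and \<rho>: "\<rho> > 0"
    and \<omega>: "\<omega> = odd_freq \<and> \<sigma> = (\<lambda>k. \<i> * alt_sign k) \<or> \<omega> = even_freq \<and> \<sigma> = alt_sign"
  shows "((\<lambda>k. \<sigma> k * (\<i> * of_int (\<omega> k)) ^ n * a k) has_sum fact n * fps_nth (fps_expansion (fourier \<omega> a) half_pi) n) UNIV"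
proof -
  have im: "\<bar>Im half_pi\<bar> < \<rho>" using \<rho> by simp
  have \<omega>': "\<bar>n\<bar> \<le> \<bar>\<omega> n\<bar>" for n using \<omega> abs_le_freq by auto
  have "((\<lambda>k. (\<i> * of_int (\<omega> k)) ^ n * a k * exp (\<i> * of_int (\<omega> k) * half_pi)) has_sum
          fourier \<omega> (\<lambda>k. (\<i> * of_int (\<omega> k)) ^ n * a k) half_pi) UNIV"
    by (rule fourier_has_sum[OF exp_decay_mult_freq_power[OF a] \<omega>' im])
  moreover have "exp (\<i> * of_int (\<omega> k) * half_pi) = \<sigma> k" for k
    using \<omega> right_half_plane.exp_odd_freq_half_pi[of 1 k] right_half_plane.exp_even_freq_half_pi[of 1 k]
    by (auto simp: right_half_plane_def)
  ultimately show ?thesis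
    unfolding fourier_holomorphic(2)[OF a \<omega>' im, of n, symmetric]
    by (simp add: fps_expansion_def mult_ac)
qed

lemma sech_fps_nth_eq:
  assumes "Re t > 0"
  shows "fact n * fps_nth (sech_fps t) n = (\<Sum>\<^sub>\<infinity>k. (\<i> * alt_sign k) * (\<i> * of_int (odd_freq k)) ^ n * odd_sech t k)"
proof -
  interpret right_half_plane t by standard (rule assms)
  show ?thesis unfolding sech_fps_def sech_series_def
    by (rule infsumI[symmetric], rule fps_expansion_fourier_half_pi[OF exp_decay_sech assms]) auto
qed

lemma csch_fps_nth_eq:
  assumes "Re t > 0"
  shows "fact n * fps_nth (csch_fps t) n = (\<Sum>\<^sub>\<infinity>k. alt_sign k * (\<i> * of_int (even_freq k)) ^ n * even_csch t k)"
proof -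
  interpret right_half_plane t by standard (rule assms)
  show ?thesis unfolding csch_fps_def csch_series_def
    by (rule infsumI[symmetric], rule fps_expansion_fourier_half_pi[OF exp_decay_csch assms]) auto
qed

lemma tanh_rem_fps_nth_eq:
  assumes "Re t > 0"
  shows "fact n * fps_nth (tanh_rem_fps t) n = (\<Sum>\<^sub>\<infinity>k. \<i> * (\<i> * of_int (odd_freq k)) ^ n * odd_tanh_rem t k)"
proof -
  interpret right_half_plane t by standard (rule assms)
  have h: "fourier odd_freq (odd_tanh_rem t) holomorphic_on {v. \<bar>Im v\<bar> < Re t}"
    by (rule fourier_holomorphic(1)[OF exp_decay_tanh_rem abs_le_freq(1)])
  have "(deriv ^^ n) (tanh_rem_series t) 0 = \<i> * (deriv ^^ n) (fourier odd_freq (odd_tanh_rem t)) 0"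
    unfolding tanh_rem_series_def by (rule higher_deriv_cmult[OF h zero_in_strip open_strip])
  also have "(deriv ^^ n) (fourier odd_freq (odd_tanh_rem t)) 0 =
      fourier odd_freq (\<lambda>k. (\<i> * of_int (odd_freq k)) ^ n * odd_tanh_rem t k) 0"
    by (rule fourier_holomorphic(2)[OF exp_decay_tanh_rem abs_le_freq(1)]) (use assms in simp)
  also have "\<i> * \<dots> = (\<Sum>\<^sub>\<infinity>k. \<i> * (\<i> * of_int (odd_freq k)) ^ n * odd_tanh_rem t k)"
    by (simp add: fourier_def infsum_cmult_right'[symmetric] mult.assoc)
  finally show ?thesis by (simp add: tanh_rem_fps_def fps_expansion_def)
qed

lemma norm_alt_sign: "norm (\<i> * alt_sign k) \<le> 1" "norm (alt_sign k) \<le> 1"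
  by (auto simp: alt_sign_def)

text \<open>The derivative \<open>- \<omega> T s = \<i> (\<i> \<omega>) T s\<close> of a sech term
  costs one power of the frequency, that is, one more derivative in \<open>v\<close>. So the index
  moves from \<open>n\<close> to \<open>n + 1\<close>, and the quotient of the factorials is
  \<open>n + 1\<close>.\<close>

lemma sech_fps_nth_deriv:
  assumes t: "Re t > 0"
  shows "((\<lambda>t. fps_nth (sech_fps t) n) has_field_derivative \<i> * of_nat (n + 1) * fps_nth (sech_tanh_fps t) (n + 1)) (at t)"
proof -
  interpret right_half_plane t by standard (rule t)
  let ?F = "\<lambda>t. \<Sum>\<^sub>\<infinity>k. (\<i> * alt_sign k) * (\<i> * of_int (odd_freq k)) ^ n * odd_sech t k"
  have "?F holomorphic_on {t. 0 < Re t}" by (rule odd_sech_half_plane_series(1)) (use norm_alt_sign in auto)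
  hence "(?F has_field_derivative deriv ?F t) (at t)"
    using t open_right_half_plane[of 0] by (auto intro: holomorphic_derivI)
  moreover have "deriv ?F t = \<i> * (fact (n + 1) * fps_nth (sech_tanh_fps t) (n + 1))"
  proof -
    have h: "((\<lambda>k. (\<i> * alt_sign k) * (\<i> * of_int (odd_freq k)) ^ n * (deriv ^^ 1) (\<lambda>t. odd_sech t k) t) has_sum
            (deriv ^^ 1) ?F t) UNIV"
      by (rule odd_sech_half_plane_series(2)) (use norm_alt_sign t in auto)
    have eq: "(\<i> * alt_sign k) * (\<i> * of_int (odd_freq k)) ^ n * (deriv ^^ 1) (\<lambda>t. odd_sech t k) t =
        \<i> * ((\<i> * alt_sign k) * (\<i> * of_int (odd_freq k)) ^ (n + 1) * (odd_tanh t k * odd_sech t k))" for k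
    proof -
      have "(deriv ^^ 1) (\<lambda>t. odd_sech t k) t = - of_int (odd_freq k) * (odd_tanh t k * odd_sech t k)"
        using DERIV_imp_deriv[OF odd_sech_deriv[OF t, of k]] by simp
      thus ?thesis by (simp only:) (simp add: algebra_simps)
    qed
    have h': "((\<lambda>k. \<i> * ((\<i> * alt_sign k) * (\<i> * of_int (odd_freq k)) ^ (n + 1) * (odd_tanh t k * odd_sech t k))) has_sum
         \<i> * (fact (n + 1) * fps_nth (sech_tanh_fps t) (n + 1))) UNIV"
      unfolding sech_tanh_fps_def sech_tanh_series_def
      by (intro has_sum_cmult_right fps_expansion_fourier_half_pi[OF exp_decay_sech_tanh t]) auto
    show ?thesis using has_sum_unique[OF h[unfolded eq] h'] by simp
  qed
  ultimately have "((\<lambda>t. ?F t / fact n) has_field_derivative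
      \<i> * (fact (n + 1) * fps_nth (sech_tanh_fps t) (n + 1)) / fact n) (at t)"
    by (intro DERIV_cdivide) simp
  moreover have "\<i> * (fact (n + 1) * fps_nth (sech_tanh_fps t) (n + 1)) / fact n =
      \<i> * of_nat (n + 1) * fps_nth (sech_tanh_fps t) (n + 1)"
    by (simp add: fact_Suc del: of_nat_Suc)
  ultimately have "((\<lambda>t. ?F t / fact n) has_field_derivative
      \<i> * of_nat (n + 1) * fps_nth (sech_tanh_fps t) (n + 1)) (at t)" by (simp only:)
  thus ?thesis
  proof (rule has_field_derivative_transform_within_open[OF _ open_right_half_plane[of 0]])
    show "?F t / fact n = fps_nth (sech_fps t) n" if "t \<in> {t. 0 < Re t}" for t
      using that sech_fps_nth_eq[of t n, symmetric] by simp
  qed (use t in auto)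
qed

lemma csch_fps_nth_deriv:
  assumes t: "Re t > 0"
  shows "((\<lambda>t. fps_nth (csch_fps t) n) has_field_derivative \<i> * of_nat (n + 1) * fps_nth (csch_coth_fps t) (n + 1)) (at t)"
proof -
  interpret right_half_plane t by standard (rule t)
  let ?F = "\<lambda>t. \<Sum>\<^sub>\<infinity>k. alt_sign k * (\<i> * of_int (even_freq k)) ^ n * even_csch t k"
  have "?F holomorphic_on {t. 0 < Re t}" by (rule even_csch_half_plane_series(1)) (use norm_alt_sign in auto)
  hence "(?F has_field_derivative deriv ?F t) (at t)"
    using t open_right_half_plane[of 0] by (auto intro: holomorphic_derivI)
  moreover have "deriv ?F t = \<i> * (fact (n + 1) * fps_nth (csch_coth_fps t) (n + 1))"
  proof -
    have h: "((\<lambda>k. alt_sign k * (\<i> * of_int (even_freq k)) ^ n * (deriv ^^ 1) (\<lambda>t. even_csch t k) t) has_sum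
            (deriv ^^ 1) ?F t) UNIV"
      by (rule even_csch_half_plane_series(2)) (use norm_alt_sign t in auto)
    have eq: "alt_sign k * (\<i> * of_int (even_freq k)) ^ n * (deriv ^^ 1) (\<lambda>t. even_csch t k) t =
        \<i> * (alt_sign k * (\<i> * of_int (even_freq k)) ^ (n + 1) * (even_coth t k * even_csch t k))" for k
    proof -
      have "(deriv ^^ 1) (\<lambda>t. even_csch t k) t = - of_int (even_freq k) * (even_coth t k * even_csch t k)"
        using DERIV_imp_deriv[OF even_csch_deriv[OF t, of k]] by simp
      thus ?thesis by (simp only:) (simp add: algebra_simps)
    qed
    have h': "((\<lambda>k. \<i> * (alt_sign k * (\<i> * of_int (even_freq k)) ^ (n + 1) * (even_coth t k * even_csch t k))) has_sum
         \<i> * (fact (n + 1) * fps_nth (csch_coth_fps t) (n + 1))) UNIV"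
      unfolding csch_coth_fps_def csch_coth_series_def
      by (intro has_sum_cmult_right fps_expansion_fourier_half_pi[OF exp_decay_csch_coth t]) auto
    show ?thesis using has_sum_unique[OF h[unfolded eq] h'] by simp
  qed
  ultimately have "((\<lambda>t. ?F t / fact n) has_field_derivative
      \<i> * (fact (n + 1) * fps_nth (csch_coth_fps t) (n + 1)) / fact n) (at t)"
    by (intro DERIV_cdivide) simp
  moreover have "\<i> * (fact (n + 1) * fps_nth (csch_coth_fps t) (n + 1)) / fact n =
      \<i> * of_nat (n + 1) * fps_nth (csch_coth_fps t) (n + 1)"
    by (simp add: fact_Suc del: of_nat_Suc)
  ultimately have "((\<lambda>t. ?F t / fact n) has_field_derivative
      \<i> * of_nat (n + 1) * fps_nth (csch_coth_fps t) (n + 1)) (at t)" by (simp only:)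
  thus ?thesis
  proof (rule has_field_derivative_transform_within_open[OF _ open_right_half_plane[of 0]])
    show "?F t / fact n = fps_nth (csch_fps t) n" if "t \<in> {t. 0 < Re t}" for t
      using that csch_fps_nth_eq[of t n, symmetric] by simp
  qed (use t in auto)
qed

definition sech_slope :: "complex \<Rightarrow> complex" where
  "sech_slope t = fps_nth (sech_fps t) 1"

text \<open>At first order the differential equation reads \<open>6 C_3 = K L\<close>. Solving for
  \<open>K\<close> gives an explicit function of \<open>t\<close> that can be differentiated. For
  real \<open>t\<close> it is a positive multiple of \<open>2 k^2 - 1\<close>, where
  \<open>k\<close> is the Jacobi modulus.\<close>

definition sech_modulus :: "complex \<Rightarrow> complex" where
  "sech_modulus t = 6 * fps_nth (sech_fps t) 3 / sech_slope t"

text \<open>Here the quotient that defines \<open>K\<close> is meaningful; the set is open, so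
  identities on it may be differentiated.\<close>

definition regular_domain :: "complex set" where
  "regular_domain = {t. 0 < Re t \<and> sech_slope t \<noteq> 0}"

lemma open_regular_domain: "open regular_domain"
proof -
  have "continuous_on {t. 0 < Re t} sech_slope"
    unfolding sech_slope_def using sech_fps_nth_deriv[of _ 1]
    by (intro continuous_at_imp_continuous_on ballI DERIV_isCont) auto
  hence "open ({t. 0 < Re t} \<inter> sech_slope -` (- {0}))"
    using open_right_half_plane[of 0] continuous_on_open_vimage by (metis Int_commute open_Compl closed_singleton)
  also have "{t. 0 < Re t} \<inter> sech_slope -` (- {0}) = regular_domain"
    by (auto simp: regular_domain_def)
  finally show ?thesis .
qed

lemma sech_fps_ODE:
  assumes "t \<in> regular_domain"
  shows "fps_deriv (fps_deriv (sech_fps t)) = fps_const (sech_modulus t) * sech_fps t - fps_const 2 * sech_fps t ^ 3"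
    and "\<And>v. \<bar>Im v\<bar> < Re t \<Longrightarrow> (deriv ^^ 2) (sech_series t) v = sech_modulus t * sech_series t v - 2 * sech_series t v ^ 3"
proof -
  have dom: "0 < Re t" "sech_slope t \<noteq> 0" using assms by (auto simp: regular_domain_def)
  interpret right_half_plane t by standard (rule dom)
  obtain K where K: "fps_deriv (fps_deriv (sech_fps t)) = fps_const K * sech_fps t - fps_const 2 * sech_fps t ^ 3"
    "\<And>v. \<bar>Im v\<bar> < Re t \<Longrightarrow> (deriv ^^ 2) (sech_series t) v = K * sech_series t v - 2 * sech_series t v ^ 3"
    using sech_fps_ODE_exists by blast
  have "sech_modulus t = K"
    using sech_fps_coeffs(1)[OF K(1)] dom(2) unfolding sech_modulus_def sech_slope_def by (simp add: field_simps)
  thus "fps_deriv (fps_deriv (sech_fps t)) = fps_const (sech_modulus t) * sech_fps t - fps_const 2 * sech_fps t ^ 3"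
    and "\<And>v. \<bar>Im v\<bar> < Re t \<Longrightarrow> (deriv ^^ 2) (sech_series t) v = sech_modulus t * sech_series t v - 2 * sech_series t v ^ 3"
    using K by auto
qed

text \<open>An analogue of Ramanujan's system for the Eisenstein series: polynomials in
  \<open>L\<close>, \<open>K\<close>, \<open>e\<close> are closed under differentiation, with
  \<open>e\<close> in the role of the quasimodular generator. For \<open>K\<close> the quotient rule
  applies, and the denominators \<open>L^2\<close> cancel.\<close>

lemma slope_modulus_energy_deriv:
  assumes "t \<in> regular_domain"
  shows "(sech_slope has_field_derivative (sech_modulus t - 2 * sech_square_sum t) * sech_slope t) (at t)"
    and "(sech_modulus has_field_derivative - 2 * sech_square_sum t * sech_modulus t - 4 * sech_slope t ^ 2) (at t)"
    and "(sech_square_sum has_field_derivative - (sech_square_sum t ^ 2) - sech_slope t ^ 2) (at t)"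
proof -
  have dom: "0 < Re t" "sech_slope t \<noteq> 0" using assms by (auto simp: regular_domain_def)
  interpret right_half_plane t by standard (rule dom)
  define L K e where "L = sech_slope t" and "K = sech_modulus t" and "e = sech_square_sum t"
  note co = sech_fps_coeffs[OF sech_fps_ODE(1)[OF assms], folded sech_slope_def, folded L_def K_def e_def]
  have L': "(sech_slope has_field_derivative (K - 2 * e) * L) (at t)"
  proof -
    have "\<i> * (2 * fps_nth (sech_tanh_fps t) 2) = (K - 2 * e) * L"
      unfolding co(2) by (simp add: algebra_simps)
    thus ?thesis using sech_fps_nth_deriv[OF dom(1), of 1] unfolding sech_slope_def
      by (simp add: mult.assoc numeral_2_eq_2)
  qed
  thus "(sech_slope has_field_derivative (sech_modulus t - 2 * sech_square_sum t) * sech_slope t) (at t)"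
    unfolding L_def K_def e_def .
  have C3: "((\<lambda>t. 6 * fps_nth (sech_fps t) 3) has_field_derivative - 4 * e * K * L - 4 * L ^ 3 + K ^ 2 * L) (at t)"
  proof -
    have "6 * (\<i> * of_nat (3 + 1) * fps_nth (sech_tanh_fps t) (3 + 1)) = \<i> * (24 * fps_nth (sech_tanh_fps t) 4)" by simp
    also have "\<dots> = - 4 * e * K * L - 4 * L ^ 3 + K ^ 2 * L"
      unfolding co(3) by (simp add: algebra_simps)
    finally show ?thesis using DERIV_cmult[OF sech_fps_nth_deriv[OF dom(1), of 3], of 6] by (simp only:)
  qed
  have "((\<lambda>t. 6 * fps_nth (sech_fps t) 3 / sech_slope t) has_field_derivative
     ((- 4 * e * K * L - 4 * L ^ 3 + K ^ 2 * L) * L - (6 * fps_nth (sech_fps t) 3) * ((K - 2 * e) * L)) / (L * L)) (at t)"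
    using DERIV_divide[OF C3 L'] dom(2) unfolding L_def by simp
  moreover have "((- 4 * e * K * L - 4 * L ^ 3 + K ^ 2 * L) * L - (6 * fps_nth (sech_fps t) 3) * ((K - 2 * e) * L)) / (L * L)
     = - 2 * e * K - 4 * L ^ 2"
  proof -
    have "(- 4 * e * K * L - 4 * L ^ 3 + K ^ 2 * L) * L - (6 * (K * L / 6)) * ((K - 2 * e) * L) = (- 2 * e * K - 4 * L ^ 2) * (L * L)"
      by (simp add: algebra_simps power2_eq_square power3_eq_cube)
    thus ?thesis unfolding co(1) using dom(2) by (simp add: L_def)
  qed
  ultimately show "(sech_modulus has_field_derivative - 2 * sech_square_sum t * sech_modulus t - 4 * sech_slope t ^ 2) (at t)"
    unfolding sech_modulus_def[abs_def] L_def K_def e_def by simp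
  have "((\<lambda>t. \<i> * fps_nth (csch_fps t) 1) has_field_derivative \<i> * (\<i> * of_nat (1 + 1) * fps_nth (csch_coth_fps t) (1 + 1))) (at t)"
    by (rule DERIV_cmult[OF csch_fps_nth_deriv[OF dom(1)]])
  moreover have "\<i> * (\<i> * of_nat (1 + 1) * fps_nth (csch_coth_fps t) (1 + 1)) = - (e ^ 2) - L ^ 2"
  proof -
    have "\<i> * (\<i> * of_nat (1 + 1) * fps_nth (csch_coth_fps t) (1 + 1)) = - (2 * fps_nth (csch_coth_fps t) 2)"
      by (simp only: one_add_one of_nat_numeral) (simp add: mult.assoc[symmetric])
    thus ?thesis unfolding co(5) by simp
  qed
  ultimately have *: "((\<lambda>t. \<i> * fps_nth (csch_fps t) 1) has_field_derivative - (e ^ 2) - L ^ 2) (at t)" by simp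
  have "(sech_square_sum has_field_derivative - (e ^ 2) - L ^ 2) (at t)"
  proof (rule has_field_derivative_transform_within_open[OF * open_regular_domain assms])
    fix x assume x: "x \<in> regular_domain"
    interpret x: right_half_plane x using x by unfold_locales (auto simp: regular_domain_def)
    show "\<i> * fps_nth (csch_fps x) 1 = sech_square_sum x"
      using x.sech_fps_coeffs(4)[OF sech_fps_ODE(1)[OF x]] by simp
  qed
  thus "(sech_square_sum has_field_derivative - (sech_square_sum t ^ 2) - sech_slope t ^ 2) (at t)"
    unfolding L_def e_def .
qed

subsection \<open>Rational spans and isobaric forms\<close>

text \<open>Rational combinations are built one term at a time, so that linear facts follow by
  induction without index sets and coefficient families.\<close>

inductive_set rspan :: "('a \<Rightarrow> complex) set \<Rightarrow> ('a \<Rightarrow> complex) set" for B where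
  rspan_zero: "(\<lambda>_. 0) \<in> rspan B"
| rspan_step: "b \<in> B \<Longrightarrow> f \<in> rspan B \<Longrightarrow> (\<lambda>x. of_rat r * b x + f x) \<in> rspan B"

lemma rspan_base: "b \<in> B \<Longrightarrow> b \<in> rspan B"
  using rspan_step[OF _ rspan_zero, of b B 1] by simp

lemma rspan_add: "f \<in> rspan B \<Longrightarrow> g \<in> rspan B \<Longrightarrow> (\<lambda>x. f x + g x) \<in> rspan B"
proof (induction f rule: rspan.induct)
  case (rspan_step b f r)
  show ?case using rspan.rspan_step[OF rspan_step(1) rspan_step(3)[OF rspan_step(4)], of r]
    by (simp add: add.assoc)
qed simp

lemma rspan_scale: "f \<in> rspan B \<Longrightarrow> (\<lambda>x. of_rat r * f x) \<in> rspan B"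
proof (induction f rule: rspan.induct)
  case (rspan_step b f q)
  show ?case using rspan.rspan_step[OF rspan_step(1) rspan_step(3), of "r * q"]
    by (simp add: algebra_simps of_rat_mult)
qed (simp add: rspan_zero)

text \<open>Equality is asked for on \<open>U\<close> only, since outside the domain of definition
  the functions take default values that satisfy no identities.\<close>

definition rspan_on :: "'a set \<Rightarrow> ('a \<Rightarrow> complex) set \<Rightarrow> ('a \<Rightarrow> complex) set" where
  "rspan_on U B = {F. \<exists>f\<in>rspan B. \<forall>x\<in>U. F x = f x}"

lemma rspan_onI: "f \<in> rspan B \<Longrightarrow> (\<And>x. x \<in> U \<Longrightarrow> F x = f x) \<Longrightarrow> F \<in> rspan_on U B"
  by (auto simp: rspan_on_def)

lemma rspan_on_cong: "F \<in> rspan_on U B \<Longrightarrow> (\<And>x. x \<in> U \<Longrightarrow> G x = F x) \<Longrightarrow> G \<in> rspan_on U B"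
  by (auto simp: rspan_on_def)

lemma rspan_on_base: "b \<in> B \<Longrightarrow> b \<in> rspan_on U B"
  by (rule rspan_onI[OF rspan_base]) auto

lemma rspan_on_zero: "(\<lambda>_. 0) \<in> rspan_on U B"
  by (rule rspan_onI[OF rspan_zero]) auto

lemma rspan_on_add: "F \<in> rspan_on U B \<Longrightarrow> G \<in> rspan_on U B \<Longrightarrow> (\<lambda>x. F x + G x) \<in> rspan_on U B"
  unfolding rspan_on_def using rspan_add by fastforce

lemma rspan_on_scale: "F \<in> rspan_on U B \<Longrightarrow> (\<lambda>x. of_rat r * F x) \<in> rspan_on U B"
  unfolding rspan_on_def using rspan_scale by fastforce

lemma rspan_on_uminus: "F \<in> rspan_on U B \<Longrightarrow> (\<lambda>x. - F x) \<in> rspan_on U B"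
  using rspan_on_scale[of F U B "-1"] by (simp add: of_rat_minus)

lemma rspan_on_scale_of_nat: "F \<in> rspan_on U B \<Longrightarrow> (\<lambda>x. of_nat n * F x) \<in> rspan_on U B"
  using rspan_on_scale[of F U B "of_nat n"] by simp

lemma rspan_on_scale_numeral: "F \<in> rspan_on U B \<Longrightarrow> (\<lambda>x. numeral n * F x) \<in> rspan_on U B"
  using rspan_on_scale[of F U B "numeral n"] by simp

lemma rspan_on_sum:
  "(\<And>i. i \<in> I \<Longrightarrow> F i \<in> rspan_on U B) \<Longrightarrow> (\<lambda>x. \<Sum>i\<in>I. F i x) \<in> rspan_on U B"
  by (induction I rule: infinite_finite_induct) (auto intro: rspan_on_zero rspan_on_add)

text \<open>A linear map that sends a spanning set into a span sends the whole span there.\<close>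

lemma rspan_on_linear_image:
  assumes F: "F \<in> rspan_on U B"
    and L: "\<And>b. b \<in> B \<Longrightarrow> L b \<in> rspan_on V D"
    and zero: "\<And>x. x \<in> V \<Longrightarrow> L (\<lambda>_. 0) x = 0"
    and step: "\<And>b f r x. b \<in> B \<Longrightarrow> f \<in> rspan B \<Longrightarrow> x \<in> V \<Longrightarrow> L (\<lambda>x. of_rat r * b x + f x) x = of_rat r * L b x + L f x"
    and cong: "\<And>f x. f \<in> rspan B \<Longrightarrow> (\<And>x. x \<in> U \<Longrightarrow> F x = f x) \<Longrightarrow> x \<in> V \<Longrightarrow> L F x = L f x"
  shows "L F \<in> rspan_on V D"
proof -
  obtain f where f: "f \<in> rspan B" "\<And>x. x \<in> U \<Longrightarrow> F x = f x" using F by (auto simp: rspan_on_def)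
  have "L f \<in> rspan_on V D" using f(1)
  proof (induction f rule: rspan.induct)
    case rspan_zero
    show ?case by (rule rspan_on_cong[OF rspan_on_zero]) (rule zero)
  next
    case (rspan_step b f r)
    show ?case
      by (rule rspan_on_cong[OF rspan_on_add[OF rspan_on_scale[OF L[OF rspan_step(1)], of r] rspan_step(3)]])
         (rule step[OF rspan_step(1,2)])
  qed
  thus ?thesis by (rule rspan_on_cong) (rule cong[OF f])
qed

lemma rspan_on_deriv:
  assumes U: "open U" and F: "F \<in> rspan_on U B"
    and diff: "\<And>b x. b \<in> B \<Longrightarrow> x \<in> U \<Longrightarrow> b field_differentiable at x"
    and deriv: "\<And>b. b \<in> B \<Longrightarrow> deriv b \<in> rspan_on U D"
  shows "deriv F \<in> rspan_on U D"
proof (rule rspan_on_linear_image[OF F, where L = deriv])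
  have diff': "f field_differentiable at x" if "f \<in> rspan B" "x \<in> U" for f x
    using that(1)
  proof (induction f rule: rspan.induct)
    case (rspan_step b f r)
    have "b field_differentiable at x" using rspan_step(1) diff that(2) by blast
    thus ?case using rspan_step(3) by (intro derivative_intros)
  qed simp
  fix b f r x assume bf: "b \<in> B" "f \<in> rspan B" "x \<in> U"
  have "b field_differentiable at x" "f field_differentiable at x"
    using diff[OF bf(1,3)] diff'[OF bf(2,3)] by blast+
  thus "deriv (\<lambda>x. of_rat r * b x + f x) x = of_rat r * deriv b x + deriv f x"
    by (simp add: field_differentiable_mult field_differentiable_const)
next
  fix f x assume "f \<in> rspan B" "\<And>x. x \<in> U \<Longrightarrow> F x = f x" "x \<in> U"
  thus "deriv F x = deriv f x"
    by (intro deriv_cong_ev refl eventually_nhds[THEN iffD2]) (use U in blast)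
qed (use deriv in auto)

lemma rspan_on_mono:
  assumes "F \<in> rspan_on U B" "\<And>b. b \<in> B \<Longrightarrow> b \<in> rspan_on U D"
  shows "F \<in> rspan_on U D"
  using rspan_on_linear_image[of F U B "\<lambda>f. f" U D] assms by auto

lemma rspan_on_subset: "F \<in> rspan_on U B \<Longrightarrow> B \<subseteq> D \<Longrightarrow> F \<in> rspan_on U D"
  using rspan_on_mono[of F U B D] rspan_on_base by blast

lemma rspan_on_mult:
  assumes F: "F \<in> rspan_on U B" and G: "G \<in> rspan_on U B'"
    and mult: "\<And>b b'. b \<in> B \<Longrightarrow> b' \<in> B' \<Longrightarrow> (\<lambda>x. b x * b' x) \<in> rspan_on U D"
  shows "(\<lambda>x. F x * G x) \<in> rspan_on U D"
proof (rule rspan_on_linear_image[OF F, where L = "\<lambda>f x. f x * G x"])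
  fix b assume b: "b \<in> B"
  show "(\<lambda>x. b x * G x) \<in> rspan_on U D"
    by (rule rspan_on_linear_image[OF G, where L = "\<lambda>g x. b x * g x"])
       (use mult[OF b] in \<open>auto simp: algebra_simps\<close>)
qed (auto simp: algebra_simps)

section \<open>Isobaric polynomials in slope, modulus and energy\<close>

definition sme_monomial :: "nat \<Rightarrow> nat \<Rightarrow> nat \<Rightarrow> complex \<Rightarrow> complex" where
  "sme_monomial i j l t = sech_slope t ^ i * sech_modulus t ^ j * sech_square_sum t ^ l"

text \<open>An analogue of quasimodular forms: \<open>w\<close> is the weight, each generator having
  weight 1, and \<open>dp\<close> bounds the depth, the degree in \<open>e\<close>. The degree in
  \<open>L\<close> keeps its parity under differentiation, and this parity becomes that of the
  exponent of \<open>X\<close>.\<close>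

definition quasi_forms :: "nat \<Rightarrow> bool \<Rightarrow> nat \<Rightarrow> (complex \<Rightarrow> complex) set" where
  "quasi_forms w par dp = {sme_monomial i j l | i j l. i + j + l = w \<and> even i = par \<and> l \<le> dp}"

lemma quasi_formsI: "i + j + l = w \<Longrightarrow> even i = par \<Longrightarrow> l \<le> dp \<Longrightarrow> sme_monomial i j l \<in> quasi_forms w par dp"
  unfolding quasi_forms_def by blast

lemma sme_monomial_deriv:
  assumes t: "t \<in> regular_domain"
  shows "(sme_monomial i j l has_field_derivative
     (of_nat i * sme_monomial i (j + 1) l t - of_nat (2 * i + 2 * j + l) * sme_monomial i j (l + 1) t
       - of_nat (4 * j) * sme_monomial (i + 2) (j - 1) l t - of_nat l * sme_monomial (i + 2) j (l - 1) t)) (at t)"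
proof -
  note [derivative_intros] = DERIV_power[OF slope_modulus_energy_deriv(1)[OF t]]
    DERIV_power[OF slope_modulus_energy_deriv(2)[OF t]] DERIV_power[OF slope_modulus_energy_deriv(3)[OF t]]
  define L K e where "L = sech_slope t" and "K = sech_modulus t" and "e = sech_square_sum t"
  have h: "(sme_monomial i j l has_field_derivative
     ((of_nat i * ((K - 2 * e) * L * L ^ (i - 1))) * (K ^ j * e ^ l) +
      (L ^ i * (of_nat j * ((- 2 * e * K - 4 * L ^ 2) * K ^ (j - 1)))) * e ^ l +
      (L ^ i * K ^ j) * (of_nat l * ((- (e ^ 2) - L ^ 2) * e ^ (l - 1))))) (at t)"
    unfolding sme_monomial_def[abs_def] L_def K_def e_def
    by (rule derivative_eq_intros refl)+ (simp add: algebra_simps)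
  have f1: "(of_nat i * ((K - 2 * e) * L * L ^ (i - 1))) = of_nat i * (K - 2 * e) * L ^ i"
    by (cases i) (auto simp: mult_ac)
  have f2: "of_nat j * ((- 2 * e * K - 4 * L ^ 2) * K ^ (j - 1)) =
     - 2 * of_nat j * e * K ^ j - 4 * of_nat j * L ^ 2 * K ^ (j - 1)"
    by (cases j) (auto simp: algebra_simps)
  have f3: "of_nat l * ((- (e ^ 2) - L ^ 2) * e ^ (l - 1)) = - of_nat l * e ^ (l + 1) - of_nat l * L ^ 2 * e ^ (l - 1)"
    by (cases l) (auto simp: algebra_simps power2_eq_square)
  have "of_nat i * (K - 2 * e) * L ^ i * (K ^ j * e ^ l) +
      L ^ i * (- 2 * of_nat j * e * K ^ j - 4 * of_nat j * L ^ 2 * K ^ (j - 1)) * e ^ l +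
      L ^ i * K ^ j * (- of_nat l * e ^ (l + 1) - of_nat l * L ^ 2 * e ^ (l - 1)) =
      of_nat i * sme_monomial i (j + 1) l t - of_nat (2 * i + 2 * j + l) * sme_monomial i j (l + 1) t
       - of_nat (4 * j) * sme_monomial (i + 2) (j - 1) l t - of_nat l * sme_monomial (i + 2) j (l - 1) t"
    unfolding sme_monomial_def L_def[symmetric] K_def[symmetric] e_def[symmetric]
    by (simp add: algebra_simps power2_eq_square)
  thus ?thesis using h unfolding f1 f2 f3 by (simp only:)
qed

lemma quasi_forms_deriv:
  assumes "b \<in> quasi_forms w p d"
  shows "deriv b \<in> rspan_on regular_domain (quasi_forms (w + 1) p (d + 1))"
proof -
  obtain i j l where b: "b = sme_monomial i j l" "i + j + l = w" "even i = p" "l \<le> d"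
    using assms unfolding quasi_forms_def by blast
  let ?R = "rspan_on regular_domain (quasi_forms (w + 1) p (d + 1))"
  \<comment> \<open>For \<open>j = 0\<close> the truncated difference \<open>j - 1\<close> would
    give the wrong weight, but then the coefficient \<open>4 * j\<close> vanishes; the same happens
    for \<open>l\<close> below.\<close>
  have 3: "(\<lambda>t. of_nat (4 * j) * sme_monomial (i + 2) (j - 1) l t) \<in> ?R"
  proof (cases "j = 0")
    case True
    thus ?thesis by (intro rspan_on_cong[OF rspan_on_zero]) simp
  qed (intro rspan_on_scale_of_nat rspan_on_base quasi_formsI, use b in auto)
  have 4: "(\<lambda>t. of_nat l * sme_monomial (i + 2) j (l - 1) t) \<in> ?R"
  proof (cases "l = 0")
    case True
    thus ?thesis by (intro rspan_on_cong[OF rspan_on_zero]) simp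
  qed (intro rspan_on_scale_of_nat rspan_on_base quasi_formsI, use b in auto)
  have "(\<lambda>t. of_nat i * sme_monomial i (j + 1) l t + - (of_nat (2 * i + 2 * j + l) * sme_monomial i j (l + 1) t)
       + - (of_nat (4 * j) * sme_monomial (i + 2) (j - 1) l t) + - (of_nat l * sme_monomial (i + 2) j (l - 1) t)) \<in> ?R"
    by (intro rspan_on_add rspan_on_uminus 3 4 rspan_on_scale_of_nat rspan_on_base quasi_formsI) (use b in auto)
  thus ?thesis unfolding b(1)
    by (rule rspan_on_cong) (simp add: DERIV_imp_deriv[OF sme_monomial_deriv])
qed

lemma rspan_on_quasi_forms_deriv:
  assumes F: "F \<in> rspan_on regular_domain (quasi_forms w p d)"
  shows "deriv F \<in> rspan_on regular_domain (quasi_forms (w + 1) p (d + 1))"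
proof (rule rspan_on_deriv[OF open_regular_domain F _ quasi_forms_deriv])
  fix b x assume "b \<in> quasi_forms w p d" "x \<in> regular_domain"
  thus "b field_differentiable at x"
    using sme_monomial_deriv unfolding quasi_forms_def field_differentiable_def by blast
qed

lemma rspan_on_quasi_forms_higher_deriv:
  assumes "F \<in> rspan_on regular_domain (quasi_forms w p d)"
  shows "(deriv ^^ b) F \<in> rspan_on regular_domain (quasi_forms (w + b) p (d + b))"
proof (induction b)
  case (Suc b)
  show ?case using rspan_on_quasi_forms_deriv[OF Suc.IH] by simp
qed (use assms in simp)

text \<open>In the Taylor expansion the coefficient of index \<open>n\<close> has weight \<open>(n + 1) / 2\<close>; this is an
  integer for odd \<open>n\<close> only, and for even \<open>n\<close> the spanning set is empty.\<close>

definition taylor_forms :: "nat \<Rightarrow> bool \<Rightarrow> (complex \<Rightarrow> complex) set" where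
  "taylor_forms n par = {sme_monomial i j 0 | i j. 2 * i + 2 * j = n \<and> even i = par}"

lemma taylor_forms_mult:
  assumes "b \<in> taylor_forms n p" "b' \<in> taylor_forms n' p'"
  shows "(\<lambda>x. b x * b' x) \<in> rspan_on U (taylor_forms (n + n') (p = p'))"
proof -
  obtain i j i' j' where 1: "b = sme_monomial i j 0" "2 * i + 2 * j = n" "even i = p"
     "b' = sme_monomial i' j' 0" "2 * i' + 2 * j' = n'" "even i' = p'"
    using assms unfolding taylor_forms_def by blast
  have "(\<lambda>x. b x * b' x) = sme_monomial (i + i') (j + j') 0"
    by (simp add: fun_eq_iff 1 sme_monomial_def power_add mult_ac)
  moreover have "sme_monomial (i + i') (j + j') 0 \<in> taylor_forms (n + n') (p = p')"
    unfolding taylor_forms_def using 1 by fastforce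
  ultimately show ?thesis by (simp only: rspan_on_base)
qed

lemma rspan_on_taylor_forms_mult:
  assumes "F \<in> rspan_on U (taylor_forms n p)" "G \<in> rspan_on U (taylor_forms n' p')"
  shows "(\<lambda>x. F x * G x) \<in> rspan_on U (taylor_forms (n + n') (p = p'))"
  by (rule rspan_on_mult[OF assms taylor_forms_mult])

text \<open>The differential equation is the recursion
  \<open>(k + 2) (k + 1) c_(k+2) = K c_k - 2 (c^3)_k\<close>. Both terms on the right have the
  required weight, and oddness in \<open>L\<close> persists because \<open>K\<close> is even and a
  product of three odd forms is odd.\<close>

lemma sech_fps_nth_forms:
  "(\<lambda>t. fps_nth (sech_fps t) n) \<in> rspan_on regular_domain (taylor_forms (n + 1) False)"
proof (induction n rule: less_induct)
  case (less n)
  let ?c = "\<lambda>n t. fps_nth (sech_fps t) n" and ?U = regular_domain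
  show ?case
  proof (cases "n < 2")
    case True
    then consider "n = 0" | "n = 1" by linarith
    thus ?thesis
    proof cases
      case 1
      show ?thesis unfolding 1
      proof (rule rspan_on_cong[OF rspan_on_zero])
        fix t assume "t \<in> ?U"
        then interpret right_half_plane t by unfold_locales (auto simp: regular_domain_def)
        show "?c 0 t = 0" by (rule sech_fps_nth_0)
      qed
    next
      case 2
      have "sme_monomial 1 0 0 \<in> taylor_forms (n + 1) False" unfolding taylor_forms_def 2 by fastforce
      thus ?thesis unfolding 2
        by (rule rspan_on_cong[OF rspan_on_base]) (auto simp: sme_monomial_def sech_slope_def)
    qed
  next
    case False
    define k where "k = n - 2"
    have n: "n = k + 2" using False by (simp add: k_def)
    have IH: "?c i \<in> rspan_on ?U (taylor_forms (i + 1) False)" if "i \<le> k" for i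
      using less.IH[of i] that n by simp
    have sq: "(\<lambda>t. ?c i t * ?c j t) \<in> rspan_on ?U (taylor_forms (i + j + 2) True)" if "i \<le> k" "j \<le> k" for i j
      using rspan_on_taylor_forms_mult[OF IH IH, OF that] by simp
    have "(\<lambda>t. ?c i t * (?c j t * ?c (k - i - j) t)) \<in> rspan_on ?U (taylor_forms (n + 1) False)"
      if "i \<le> k" "j \<le> k - i" for i j
    proof -
      have "(\<lambda>t. ?c i t * (?c j t * ?c (k - i - j) t)) \<in>
         rspan_on ?U (taylor_forms (i + 1 + (j + (k - i - j) + 2)) (False = True))"
        by (rule rspan_on_taylor_forms_mult[OF IH sq]) (use that in auto)
      moreover have "i + 1 + (j + (k - i - j) + 2) = n + 1" using that n by simp
      ultimately show ?thesis by simp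
    qed
    hence cube: "(\<lambda>t. \<Sum>i=0..k. \<Sum>j=0..k - i. ?c i t * (?c j t * ?c (k - i - j) t)) \<in> rspan_on ?U (taylor_forms (n + 1) False)"
      by (intro rspan_on_sum) auto
    have "sme_monomial 0 1 0 \<in> taylor_forms 2 True" unfolding taylor_forms_def by fastforce
    hence "sech_modulus \<in> rspan_on ?U (taylor_forms 2 True)"
      by (rule rspan_on_cong[OF rspan_on_base]) (auto simp: sme_monomial_def)
    from rspan_on_taylor_forms_mult[OF this IH[of k]]
    have "(\<lambda>t. sech_modulus t * ?c k t) \<in> rspan_on ?U (taylor_forms (n + 1) False)" by (simp add: n)
    from rspan_on_scale[OF rspan_on_add[OF this rspan_on_uminus[OF rspan_on_scale_numeral[OF cube, of "Num.Bit0 Num.One"]]], of "1 / of_nat ((k + 2) * (k + 1))"]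
    show ?thesis
    proof (rule rspan_on_cong)
      fix t assume t: "t \<in> ?U"
      have "fps_nth (sech_fps t ^ 3) k = (\<Sum>i=0..k. \<Sum>j=0..k - i. ?c i t * (?c j t * ?c (k - i - j) t))"
        by (simp add: power3_eq_cube mult.assoc fps_mult_nth sum_distrib_left)
      hence "of_nat ((k + 2) * (k + 1)) * ?c n t = sech_modulus t * ?c k t +
         - (2 * (\<Sum>i=0..k. \<Sum>j=0..k - i. ?c i t * (?c j t * ?c (k - i - j) t)))"
        using arg_cong[OF sech_fps_ODE(1)[OF t], of "\<lambda>F. fps_nth F k"]
        by (simp add: n algebra_simps numeral_2_eq_2)
      moreover have "(of_nat ((k + 2) * (k + 1)) :: complex) \<noteq> 0"
        unfolding of_nat_eq_0_iff by simp
      ultimately show "?c n t = of_rat (1 / of_nat ((k + 2) * (k + 1))) * (sech_modulus t * ?c k t +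
         - (2 * (\<Sum>i=0..k. \<Sum>j=0..k - i. ?c i t * (?c j t * ?c (k - i - j) t))))"
        by (simp only: of_rat_divide of_rat_1 of_rat_of_nat_eq) (simp add: field_simps del: of_nat_mult of_nat_add)
    qed
  qed
qed

text \<open>This is \<open>C(\<pi>/2 + w) / (L w)\<close>. Removing one factor \<open>L\<close>
  makes the coefficients even in \<open>L\<close> and the constant term 1, so that inversion
  introduces no denominators.\<close>

definition sech_quotient_fps :: "complex \<Rightarrow> complex fps" where
  "sech_quotient_fps t = fps_const (1 / sech_slope t) * fps_shift 1 (sech_fps t)"

lemma sech_quotient_fps_nth_forms:
  "(\<lambda>t. fps_nth (sech_quotient_fps t) n) \<in> rspan_on regular_domain (taylor_forms n True)"
proof (rule rspan_on_cong[OF rspan_on_linear_image[OF sech_fps_nth_forms[of "n + 1"], where L = "\<lambda>f t. f t / sech_slope t"]])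
  fix b assume "b \<in> taylor_forms (n + 1 + 1) False"
  then obtain i j where b: "b = sme_monomial i j 0" "2 * i + 2 * j = n + 2" "odd i" unfolding taylor_forms_def by auto
  then obtain k where k: "i = Suc k" by (cases i) auto
  have "sme_monomial k j 0 \<in> taylor_forms n True" unfolding taylor_forms_def using b k by fastforce
  thus "(\<lambda>t. b t / sech_slope t) \<in> rspan_on regular_domain (taylor_forms n True)"
    by (rule rspan_on_cong[OF rspan_on_base]) (auto simp: b k sme_monomial_def regular_domain_def)
qed (auto simp: sech_quotient_fps_def add_divide_distrib)

lemma sech_quotient_fps_nth_0: "t \<in> regular_domain \<Longrightarrow> fps_nth (sech_quotient_fps t) 0 = 1"
  by (simp add: sech_quotient_fps_def sech_slope_def regular_domain_def)

text \<open>With constant term 1, the equation \<open>A * inverse A = 1\<close> is a recursion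
  without division, and each of its terms is isobaric.\<close>

lemma inverse_sech_quotient_fps_nth_forms:
  "(\<lambda>t. fps_nth (inverse (sech_quotient_fps t)) n) \<in> rspan_on regular_domain (taylor_forms n True)"
proof (induction n rule: less_induct)
  case (less n)
  let ?a = "\<lambda>n t. fps_nth (sech_quotient_fps t) n" and ?b = "\<lambda>n t. fps_nth (inverse (sech_quotient_fps t)) n"
  show ?case
  proof (cases "n = 0")
    case True
    have "sme_monomial 0 0 0 \<in> taylor_forms n True" unfolding taylor_forms_def True by fastforce
    thus ?thesis unfolding True
      by (rule rspan_on_cong[OF rspan_on_base]) (auto simp: sme_monomial_def sech_quotient_fps_nth_0)
  next
    case False
    have "(\<lambda>t. ?a i t * ?b (n - i) t) \<in> rspan_on regular_domain (taylor_forms n True)" if "i \<in> {1..n}" for i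
    proof -
      have "(\<lambda>t. ?a i t * ?b (n - i) t) \<in> rspan_on regular_domain (taylor_forms (i + (n - i)) (True = True))"
        by (intro rspan_on_taylor_forms_mult sech_quotient_fps_nth_forms less.IH) (use that in auto)
      thus ?thesis using that by simp
    qed
    hence "(\<lambda>t. - (\<Sum>i\<in>{1..n}. ?a i t * ?b (n - i) t)) \<in> rspan_on regular_domain (taylor_forms n True)"
      by (intro rspan_on_uminus rspan_on_sum)
    thus ?thesis
    proof (rule rspan_on_cong)
      fix t assume t: "t \<in> regular_domain"
      have "sech_quotient_fps t * inverse (sech_quotient_fps t) = 1"
        using sech_quotient_fps_nth_0[OF t] by (intro inverse_mult_eq_1') simp
      hence "fps_nth (sech_quotient_fps t * inverse (sech_quotient_fps t)) n = 0" using False by simp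
      hence "(\<Sum>i=0..n. ?a i t * ?b (n - i) t) = 0" by (simp add: fps_mult_nth)
      also have "{0..n} = insert 0 {1..n}" by auto
      finally show "?b n t = - (\<Sum>i\<in>{1..n}. ?a i t * ?b (n - i) t)"
        using sech_quotient_fps_nth_0[OF t] by (simp add: eq_neg_iff_add_eq_0)
    qed
  qed
qed

text \<open>The product identity amounts to
  \<open>1 / sin w - \<Psi>(w) = L / C(\<pi>/2 + w)\<close>. Multiplied by \<open>w\<close>, the
  right side is the inverse of the normalised quotient; the constant \<open>c\<close> is a
  coefficient of \<open>w / sin w\<close>.\<close>

lemma tanh_rem_fps_nth_forms:
  obtains c where "(\<lambda>t. c - fps_nth (tanh_rem_fps t) n) \<in> rspan_on regular_domain (taylor_forms (n + 1) True)"
proof -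
  define \<sigma> :: "complex fps" where "\<sigma> = fps_shift 1 (fps_sin 1)"
  have sin: "fps_sin 1 = fps_X * \<sigma>"
    unfolding \<sigma>_def by (rule fps_ext) (simp add: fps_sin_def fps_X_mult_nth)
  have s0: "fps_nth \<sigma> 0 = 1" by (simp add: \<sigma>_def fps_sin_def)
  have "(\<lambda>t. fps_nth (inverse \<sigma>) (n + 1) - fps_nth (tanh_rem_fps t) n) \<in> rspan_on regular_domain (taylor_forms (n + 1) True)"
  proof (rule rspan_on_cong[OF inverse_sech_quotient_fps_nth_forms])
    fix t assume dom: "t \<in> regular_domain"
    interpret right_half_plane t using dom by unfold_locales (auto simp: regular_domain_def)
    define A where "A = sech_quotient_fps t"
    define L where "L = sech_slope t"
    have L: "L \<noteq> 0" using dom by (simp add: L_def regular_domain_def)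
    have C: "sech_fps t = fps_const L * (fps_X * A)"
      unfolding A_def sech_quotient_fps_def L_def[symmetric] using L sech_fps_nth_0
      by (intro fps_ext) (simp add: fps_X_mult_nth)
    have "fps_const L * (fps_X * (A * (1 - fps_X * \<sigma> * tanh_rem_fps t))) = fps_const L * (fps_X * \<sigma>)"
      using sech_fps_mult_tanh_rem_fps[folded sech_slope_def, folded L_def] unfolding C sin by (simp add: mult.assoc)
    moreover have "fps_const L \<noteq> 0" "(fps_X :: complex fps) \<noteq> 0" using L by auto
    ultimately have "A * (1 - fps_X * \<sigma> * tanh_rem_fps t) = \<sigma>"
      by (metis mult_left_cancel)
    hence "inverse A * A * (1 - fps_X * \<sigma> * tanh_rem_fps t) * inverse \<sigma> = inverse A * (\<sigma> * inverse \<sigma>)"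
      by (simp only: mult.assoc)
    moreover have "inverse A * A = 1" using sech_quotient_fps_nth_0[OF dom] by (simp add: A_def inverse_mult_eq_1)
    moreover have s: "\<sigma> * inverse \<sigma> = 1" using s0 by (simp add: inverse_mult_eq_1')
    ultimately have "(1 - fps_X * \<sigma> * tanh_rem_fps t) * inverse \<sigma> = inverse A"
      by (simp only: mult_1_left mult_1_right)
    moreover have "(1 - fps_X * \<sigma> * tanh_rem_fps t) * inverse \<sigma> = inverse \<sigma> - fps_X * tanh_rem_fps t * (\<sigma> * inverse \<sigma>)"
      by (simp add: algebra_simps)
    ultimately have "inverse A = inverse \<sigma> - fps_X * tanh_rem_fps t" using s by simp
    thus "fps_nth (inverse \<sigma>) (n + 1) - fps_nth (tanh_rem_fps t) n = fps_nth (inverse (sech_quotient_fps t)) (n + 1)"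
      unfolding A_def[symmetric] by (simp add: fps_X_mult_nth)
  qed
  thus ?thesis by (rule that)
qed

lemma taylor_forms_quasi_forms: "taylor_forms (2 * w) p \<subseteq> quasi_forms w p 0"
proof
  fix b assume "b \<in> taylor_forms (2 * w) p"
  then obtain i j where "b = sme_monomial i j 0" "i + j = w" "even i = p" unfolding taylor_forms_def by auto
  thus "b \<in> quasi_forms w p 0" by (auto intro!: quasi_formsI)
qed

lemma sech_fps_nth_higher_deriv_forms:
  assumes "odd n"
  shows "(deriv ^^ b) (\<lambda>t. fps_nth (sech_fps t) n) \<in> rspan_on regular_domain (quasi_forms ((n + 1) div 2 + b) False b)"
proof -
  have "(\<lambda>t. fps_nth (sech_fps t) n) \<in> rspan_on regular_domain (quasi_forms ((n + 1) div 2) False 0)"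
    by (rule rspan_on_subset[OF sech_fps_nth_forms]) (use taylor_forms_quasi_forms[of "(n + 1) div 2"] assms in simp)
  from rspan_on_quasi_forms_higher_deriv[OF this, of b] show ?thesis by simp
qed

text \<open>At least one derivative in \<open>t\<close> is taken; it removes the constant
  \<open>c\<close>, which does not have the weight of the other terms.\<close>

lemma tanh_rem_fps_nth_higher_deriv_forms:
  assumes "odd n"
  shows "(deriv ^^ (b + 1)) (\<lambda>t. fps_nth (tanh_rem_fps t) n) \<in>
     rspan_on regular_domain (quasi_forms ((n + 1) div 2 + (b + 1)) True (b + 1))"
proof -
  obtain c where "(\<lambda>t. c - fps_nth (tanh_rem_fps t) n) \<in> rspan_on regular_domain (taylor_forms (n + 1) True)"
    using tanh_rem_fps_nth_forms by blast
  hence "(\<lambda>t. c - fps_nth (tanh_rem_fps t) n) \<in> rspan_on regular_domain (quasi_forms ((n + 1) div 2) True 0)"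
    by (rule rspan_on_subset) (use taylor_forms_quasi_forms[of "(n + 1) div 2"] assms in simp)
  from rspan_on_uminus[OF rspan_on_quasi_forms_higher_deriv[OF this, of "b + 1"]]
  have *: "(\<lambda>t. - (deriv ^^ (b + 1)) (\<lambda>t. c - fps_nth (tanh_rem_fps t) n) t) \<in>
      rspan_on regular_domain (quasi_forms ((n + 1) div 2 + (b + 1)) True (b + 1))" by simp
  have hol: "(\<lambda>t. fps_nth (tanh_rem_fps t) n) holomorphic_on {t. 0 < Re t}"
  proof -
    have "(\<lambda>t. (\<Sum>\<^sub>\<infinity>k. \<i> * (\<i> * of_int (odd_freq k)) ^ n * odd_tanh_rem t k) / fact n) holomorphic_on {t. 0 < Re t}"
      by (intro holomorphic_intros odd_tanh_rem_half_plane_series(1)) auto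
    thus ?thesis by (rule holomorphic_transform) (simp add: tanh_rem_fps_nth_eq[symmetric])
  qed
  show ?thesis
  proof (rule rspan_on_cong[OF *])
    fix t assume "t \<in> regular_domain"
    hence t: "t \<in> {t. 0 < Re t}" by (simp add: regular_domain_def)
    have "(deriv ^^ (b + 1)) (\<lambda>t. c - fps_nth (tanh_rem_fps t) n) t =
        (deriv ^^ (b + 1)) (\<lambda>_. c) t - (deriv ^^ (b + 1)) (\<lambda>t. fps_nth (tanh_rem_fps t) n) t"
      by (rule higher_deriv_diff[OF _ hol open_right_half_plane t]) auto
    thus "(deriv ^^ (b + 1)) (\<lambda>t. fps_nth (tanh_rem_fps t) n) t = - (deriv ^^ (b + 1)) (\<lambda>t. c - fps_nth (tanh_rem_fps t) n) t"
      by (simp del: funpow.simps)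
  qed
qed

subsection \<open>Contour integration\<close>

definition cos_zero :: "nat \<Rightarrow> complex" where
  "cos_zero n = of_real ((2 * real n + 1) * pi / 2)"

lemma Re_cos_zero [simp]: "Re (cos_zero n) = (2 * real n + 1) * pi / 2"
  and Im_cos_zero [simp]: "Im (cos_zero n) = 0"
  unfolding cos_zero_def by (simp_all only: Re_complex_of_real Im_complex_of_real)

lemma Re_cos_zero_pos: "(2 * real n + 1) * pi / 2 > 0"
  by (intro divide_pos_pos mult_pos_pos) auto

text \<open>An open convex neighbourhood of the quadrant \<open>\<bar>Im z\<bar> \<le> Re z\<close>.
  Its margin 1 is less than \<open>\<pi>/2\<close>, which keeps out the zeros of cosh and the
  negative zeros of cos.\<close>

definition sector :: "complex set" where
  "sector = {z. \<bar>Im z\<bar> < Re z + 1}"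

text \<open>The far edge has real part \<open>N \<pi>\<close>, midway between two zeros of the
  cosine, where \<open>\<bar>cos z\<bar> = cosh (Im z) \<ge> 1\<close>. The upper corner is
  \<open>\<i>\<close> times the lower one, so the two rays differ by a quarter turn.\<close>

definition corner :: "nat \<Rightarrow> complex" where
  "corner N = of_real (real N * pi) * (1 - \<i>)"

definition triangle_path :: "nat \<Rightarrow> real \<Rightarrow> complex" where
  "triangle_path N = linepath 0 (corner N) +++ linepath (corner N) (\<i> * corner N) +++ linepath (\<i> * corner N) 0"

lemma sector_alt: "sector = {z. Im z < Re z + 1} \<inter> {z. - Im z < Re z + 1}"
  by (auto simp: sector_def abs_less_iff)

lemma open_sector: "open sector"
  unfolding sector_alt by (intro open_Int open_Collect_less continuous_intros)

lemma convex_sector: "convex sector"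
proof (rule convexI)
  fix x y and u v :: real
  assume *: "x \<in> sector" "y \<in> sector" "0 \<le> u" "0 \<le> v" "u + v = 1"
  have "\<bar>u * Im x + v * Im y\<bar> \<le> u * \<bar>Im x\<bar> + v * \<bar>Im y\<bar>"
    using *(3,4) by (intro order_trans[OF abs_triangle_ineq]) (auto simp: abs_mult)
  also have "\<dots> < u * (Re x + 1) + v * (Re y + 1)"
  proof (cases "u = 0")
    case True
    thus ?thesis using * by (auto simp: sector_def)
  next
    case False
    hence "u * \<bar>Im x\<bar> < u * (Re x + 1)" using * by (auto simp: sector_def)
    moreover have "v * \<bar>Im y\<bar> \<le> v * (Re y + 1)" using * by (auto simp: sector_def intro!: mult_left_mono)
    ultimately show ?thesis by linarith
  qed
  also have "\<dots> = u * Re x + v * Re y + (u + v)" by (simp add: algebra_simps)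
  finally show "u *\<^sub>R x + v *\<^sub>R y \<in> sector" using *(5) by (simp add: sector_def)
qed

lemma cos_zero_in_sector: "cos_zero n \<in> sector"
  using Re_cos_zero_pos[of n] by (simp only: sector_def mem_Collect_eq Re_cos_zero Im_cos_zero abs_zero)

lemma sin_cos_zero: "sin (cos_zero n) = (-1) ^ n" "cos (cos_zero n) = 0"
proof -
  have 1: "cos_zero n = of_nat n * of_real pi + of_real pi / 2"
    by (simp add: cos_zero_def field_simps)
  have "cos_zero n = complex_of_real (real n * pi + pi / 2)"
    unfolding 1 by simp
  hence "sin (cos_zero n) = of_real (sin (real n * pi + pi / 2))" "cos (cos_zero n) = of_real (cos (real n * pi + pi / 2))"
    by (simp_all only: sin_of_real cos_of_real)
  thus "sin (cos_zero n) = (-1) ^ n" "cos (cos_zero n) = 0"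
    by (simp_all add: sin_add cos_add)
qed

lemma cos_eq_0_sector:
  assumes "z \<in> sector" "cos z = 0"
  obtains n where "z = cos_zero n"
proof -
  obtain k :: int where k: "z = of_real (of_int k * pi) + of_real pi / 2"
    using assms(2) by (auto simp: cos_eq_0)
  have "Re z > -1" using assms(1) by (auto simp: sector_def)
  hence "(2 * of_int k + 1) * pi > -2" using k by (simp add: field_simps)
  have "k \<ge> 0"
  proof (rule ccontr)
    assume "\<not> k \<ge> 0"
    hence "real_of_int (2 * k + 1) \<le> of_int (-1)" unfolding of_int_le_iff by simp
    hence "(2 * of_int k + 1) * pi \<le> - 1 * pi" by (intro mult_right_mono) auto
    thus False using \<open>(2 * of_int k + 1) * pi > -2\<close> pi_gt3 by linarith
  qed
  hence "z = cos_zero (nat k)" using k by (simp add: cos_zero_def field_simps)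
  thus ?thesis by (rule that)
qed

lemma cosh_nonzero_sector:
  assumes "z \<in> sector"
  shows "cosh z \<noteq> 0"
proof
  assume "cosh z = 0"
  hence "cos (\<i> * z) = 0" by (simp add: cosh_conv_cos)
  then obtain k :: int where k: "\<i> * z = of_real (of_int k * pi) + of_real pi / 2"
    by (auto simp: cos_eq_0)
  have "Re z = 0" using arg_cong[OF k, of Im] by simp
  hence "\<bar>Im z\<bar> < 1" using assms by (simp add: sector_def)
  moreover have "Im z = - (of_int (2 * k + 1) * pi / 2)" using arg_cong[OF k, of Re] by (simp add: field_simps)
  ultimately have "\<bar>of_int (2 * k + 1)\<bar> * pi < 2" by (simp add: abs_mult)
  moreover have "1 \<le> \<bar>real_of_int (2 * k + 1)\<bar>"
    by (metis abs_le_square_iff abs_of_nonneg even_add even_mult_iff even_numeral linorder_not_le odd_one of_int_1_le_iff of_int_abs zero_less_abs_iff zero_less_one_class.zero_le_one int_one_le_iff_zero_less even_zero)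
  hence "1 * pi \<le> \<bar>of_int (2 * k + 1)\<bar> * pi" by (intro mult_right_mono) auto
  ultimately show False using pi_gt3 by linarith
qed

lemma valid_triangle_path: "valid_path (triangle_path N)"
  and loop_triangle_path: "pathfinish (triangle_path N) = pathstart (triangle_path N)"
  by (simp_all add: triangle_path_def valid_path_join)

lemma path_image_triangle_path:
  "path_image (triangle_path N) = closed_segment 0 (corner N) \<union> closed_segment (corner N) (\<i> * corner N) \<union> closed_segment (\<i> * corner N) 0"
  by (simp add: triangle_path_def path_image_join Un_assoc)

lemma closed_segment_corners:
  "z \<in> closed_segment 0 (corner N) \<Longrightarrow> Im z = - Re z \<and> 0 \<le> Re z \<and> Re z \<le> N * pi"
  "z \<in> closed_segment (corner N) (\<i> * corner N) \<Longrightarrow> Re z = N * pi \<and> \<bar>Im z\<bar> \<le> N * pi"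
  "z \<in> closed_segment (\<i> * corner N) 0 \<Longrightarrow> Im z = Re z \<and> 0 \<le> Re z \<and> Re z \<le> N * pi"
proof -
  show "Im z = - Re z \<and> 0 \<le> Re z \<and> Re z \<le> N * pi" if "z \<in> closed_segment 0 (corner N)"
    using that by (auto simp: closed_segment_def corner_def intro!: mult_left_le_one_le)
  show "Im z = Re z \<and> 0 \<le> Re z \<and> Re z \<le> N * pi" if "z \<in> closed_segment (\<i> * corner N) 0"
  proof -
    have "\<exists>u. z = (1 - u) *\<^sub>R (\<i> * corner N) + u *\<^sub>R 0 \<and> 0 \<le> u \<and> u \<le> 1"
      using that by (simp only: closed_segment_def mem_Collect_eq)
    then obtain u where u: "0 \<le> u" "u \<le> 1" "z = (1 - u) *\<^sub>R (\<i> * corner N) + u *\<^sub>R 0"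
      by (elim exE conjE)
    have "Re z = (1 - u) * (N * pi)" "Im z = (1 - u) * (N * pi)" using u(3) by (auto simp: corner_def)
    moreover have "(1 - u) * (N * pi) \<le> 1 * (N * pi)" using u by (intro mult_right_mono) auto
    moreover have "0 \<le> (1 - u) * (N * pi)" using u by (intro mult_nonneg_nonneg) auto
    ultimately show ?thesis by simp
  qed
  show "Re z = N * pi \<and> \<bar>Im z\<bar> \<le> N * pi" if z: "z \<in> closed_segment (corner N) (\<i> * corner N)"
  proof -
    obtain u where u: "0 \<le> u" "u \<le> 1" "z = (1 - u) *\<^sub>R corner N + u *\<^sub>R (\<i> * corner N)"
      using z by (auto simp: closed_segment_def)
    have "Re z = N * pi" "Im z = (2 * u - 1) * (N * pi)"
      unfolding u(3) by (simp_all add: corner_def algebra_simps)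
    moreover have "\<bar>2 * u - 1\<bar> * (N * pi) \<le> 1 * (N * pi)" using u by (intro mult_right_mono) auto
    ultimately show ?thesis by (simp add: abs_mult)
  qed
qed

lemma path_image_triangle_path_subset:
  assumes "z \<in> path_image (triangle_path N)"
  shows "z \<in> sector" "Re z \<le> N * pi" "cos z \<noteq> 0"
proof -
  have z: "\<bar>Im z\<bar> \<le> Re z \<and> Re z \<le> N * pi"
    using assms closed_segment_corners unfolding path_image_triangle_path by fastforce
  thus "z \<in> sector" "Re z \<le> N * pi" by (auto simp: sector_def)
  show "cos z \<noteq> 0"
  proof
    assume "cos z = 0"
    then obtain n where n: "z = cos_zero n" using cos_eq_0_sector \<open>z \<in> sector\<close> by blast
    hence "Im z = 0" "Re z > 0" using Re_cos_zero_pos[of n] by auto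
    with assms closed_segment_corners have "Re z = N * pi" unfolding path_image_triangle_path by fastforce
    hence "(2 * real n + 1) * pi = (2 * real N) * pi" using n by simp
    hence "2 * real n + 1 = 2 * real N" by (simp only: mult_cancel_right) simp
    hence "real (2 * n + 1) = real (2 * N)" by simp
    hence "2 * n + 1 = 2 * N" by (simp only: of_nat_eq_iff)
    thus False by presburger
  qed
qed

lemma winding_number_triangle_path:
  assumes "n < N"
  shows "winding_number (triangle_path N) (cos_zero n) = 1"
proof -
  define r where "r = real N * pi"
  have r: "r > 0" using assms by (simp add: r_def)
  let ?A = "{z. \<bar>Im z\<bar> < Re z \<and> Re z < r}"
  have "?A = {z. Im z < Re z} \<inter> {z. - Im z < Re z} \<inter> {z. Re z < r}" by (auto simp: abs_less_iff)
  hence "open ?A" by (simp only:) (intro open_Int open_Collect_less continuous_intros)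
  moreover have "?A \<subseteq> convex hull {0, corner N, \<i> * corner N}"
  proof
    fix z assume z: "z \<in> ?A"
    \<comment> \<open>Barycentric coordinates, from \<open>Re z = r (\<alpha> + \<beta>)\<close> and
      \<open>Im z = r (\<beta> - \<alpha>)\<close>.\<close>
    define \<alpha> \<beta> where "\<alpha> = (Re z - Im z) / (2 * r)" and "\<beta> = (Re z + Im z) / (2 * r)"
    have "z = (1 - \<alpha> - \<beta>) *\<^sub>R 0 + \<alpha> *\<^sub>R corner N + \<beta> *\<^sub>R (\<i> * corner N)"
      using r unfolding corner_def r_def[symmetric] complex_eq_iff
      by (simp add: \<alpha>_def \<beta>_def field_simps)
    moreover have "0 \<le> \<alpha>" "0 \<le> \<beta>" "\<alpha> + \<beta> \<le> 1"
      using z r by (auto simp: \<alpha>_def \<beta>_def abs_less_iff field_simps)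
    ultimately show "z \<in> convex hull {0, corner N, \<i> * corner N}"
      unfolding convex_hull_3 by (intro CollectI exI[of _ "1 - \<alpha> - \<beta>"] exI[of _ \<alpha>] exI[of _ \<beta>]) simp
  qed
  moreover have "real n + 1 / 2 < real N" using assms by simp
  hence "(real n + 1 / 2) * pi < r" unfolding r_def by (intro mult_strict_right_mono) auto
  hence "cos_zero n \<in> ?A" using Re_cos_zero_pos[of n] by (auto simp: field_simps)
  ultimately have "cos_zero n \<in> interior (convex hull {0, corner N, \<i> * corner N})"
    by (meson interiorI)
  from winding_number_triangle[OF this]
  have "winding_number (triangle_path N) (cos_zero n) =
     (if 0 < Im ((corner N - 0) * cnj (corner N - cos_zero n)) then 1 else -1)"
    by (simp add: triangle_path_def)
  moreover have "Im ((corner N - 0) * cnj (corner N - cos_zero n)) = r * ((2 * real n + 1) * pi / 2)"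
    unfolding corner_def r_def[symmetric] by (simp add: algebra_simps)
  moreover have "r * ((2 * real n + 1) * pi / 2) > 0" using r by (intro mult_pos_pos) auto
  ultimately show ?thesis by simp
qed

lemma contour_integral_sec:
  assumes G: "G holomorphic_on sector"
  shows "contour_integral (triangle_path N) (\<lambda>z. G z / cos z) = 2 * pi * \<i> * (\<Sum>n<N. - ((-1) ^ n * G (cos_zero n)))"
proof -
  \<comment> \<open>The cut at \<open>N \<pi> + 1\<close> keeps exactly the first \<open>N\<close>
    zeros, the next one being \<open>N \<pi> + \<pi>/2\<close>, while the triangle stays
    inside.\<close>
  define S where "S = sector \<inter> {z. Re z < N * pi + 1}"
  define pts where "pts = cos_zero ` {..<N}"
  have S: "open S" "convex S" unfolding S_def
    by (intro open_Int open_sector open_Collect_less continuous_intros)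
       (intro convex_Int convex_sector convex_halfspace_Re_lt)
  have inj: "inj cos_zero" by (auto simp: inj_def cos_zero_def)
  have zeros: "cos z \<noteq> 0" if "z \<in> S - pts" for z
  proof
    assume "cos z = 0"
    moreover have "z \<in> sector" using that by (simp add: S_def)
    ultimately obtain n where n: "z = cos_zero n" using cos_eq_0_sector by blast
    have "(2 * real n + 1) * pi / 2 < N * pi + 1" using that n by (simp add: S_def)
    hence "(2 * real n + 1) * pi < 2 * real N * pi + 2" by (simp add: field_simps)
    also have "\<dots> < (2 * real N + 1) * pi" unfolding distrib_right using pi_gt3 by linarith
    finally have "2 * real n + 1 < 2 * real N + 1" by (simp only: mult_less_cancel_right_pos pi_gt_zero)
    hence "n < N" by simp
    thus False using that n by (auto simp: pts_def)
  qed
  have pts: "p \<in> sector" "Re p < N * pi + 1" if p: "p \<in> pts" for p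
  proof -
    obtain n where n: "p = cos_zero n" "n < N" using p by (auto simp: pts_def)
    have "(2 * real n + 1) * pi \<le> (2 * real N) * pi" using n(2) by (intro mult_right_mono) auto
    hence "(2 * real n + 1) * pi / 2 < N * pi + 1" by linarith
    thus "p \<in> sector" "Re p < N * pi + 1" using n cos_zero_in_sector by auto
  qed
  have img: "path_image (triangle_path N) \<subseteq> S - pts"
  proof
    fix z assume "z \<in> path_image (triangle_path N)"
    from path_image_triangle_path_subset[OF this] show "z \<in> S - pts"
      by (auto simp: S_def pts_def sin_cos_zero)
  qed
  have "contour_integral (triangle_path N) (\<lambda>z. G z / cos z) =
     2 * pi * \<i> * (\<Sum>p\<in>pts. winding_number (triangle_path N) p * residue (\<lambda>z. G z / cos z) p)"
  proof (rule Residue_theorem[OF S(1) convex_connected[OF S(2)]])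
    show "(\<lambda>z. G z / cos z) holomorphic_on S - pts"
      using zeros by (intro holomorphic_intros holomorphic_on_subset[OF G]) (auto simp: S_def)
    show "\<forall>z. z \<notin> S \<longrightarrow> winding_number (triangle_path N) z = 0"
      using img by (intro allI impI winding_number_zero_outside[OF _ S(2)])
         (auto simp: valid_path_imp_path valid_triangle_path loop_triangle_path)
  qed (use img valid_triangle_path loop_triangle_path in \<open>auto simp: pts_def\<close>)
  also have "(\<Sum>p\<in>pts. winding_number (triangle_path N) p * residue (\<lambda>z. G z / cos z) p) =
      (\<Sum>n<N. - ((-1) ^ n * G (cos_zero n)))"
    unfolding pts_def
  proof (subst sum.reindex[OF inj_on_subset[OF inj]], simp, unfold o_def, intro sum.cong refl)
    fix n assume n: "n \<in> {..<N}"
    have "residue (\<lambda>z. G z / cos z) (cos_zero n) = - ((-1) ^ n * G (cos_zero n))"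
    proof (rule residue_simple')
      let ?s = "S - (pts - {cos_zero n})"
      show "open ?s" by (intro open_Diff S finite_imp_closed) (auto simp: pts_def)
      show "cos_zero n \<in> ?s" using pts[of "cos_zero n"] n by (auto simp: S_def pts_def)
      show "(\<lambda>z. G z / cos z) holomorphic_on ?s - {cos_zero n}"
        using zeros by (intro holomorphic_intros holomorphic_on_subset[OF G]) (auto simp: S_def)
      have "(cos has_field_derivative - sin (cos_zero n)) (at (cos_zero n))" by (rule DERIV_cos)
      hence "((\<lambda>w. (cos w - cos (cos_zero n)) / (w - cos_zero n)) \<longlongrightarrow> - ((-1) ^ n)) (at (cos_zero n))"
        by (simp add: has_field_derivative_iff sin_cos_zero)
      hence "((\<lambda>w. cos w / (w - cos_zero n)) \<longlongrightarrow> - ((-1) ^ n)) (at (cos_zero n))"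
        by (simp add: sin_cos_zero)
      moreover have "(G \<longlongrightarrow> G (cos_zero n)) (at (cos_zero n))"
        using holomorphic_on_imp_continuous_on[OF G] open_sector cos_zero_in_sector
        by (metis continuous_on_eq_continuous_at isContD)
      ultimately have "((\<lambda>w. G w / (cos w / (w - cos_zero n))) \<longlongrightarrow> G (cos_zero n) / (- ((-1) ^ n))) (at (cos_zero n))"
        by (intro tendsto_divide) auto
      thus "((\<lambda>w. G w / cos w * (w - cos_zero n)) \<longlongrightarrow> - ((-1) ^ n * G (cos_zero n))) (at (cos_zero n))"
        by (simp add: divide_simps minus_one_power_iff split: if_splits)
    qed
    thus "winding_number (triangle_path N) (cos_zero n) * residue (\<lambda>z. G z / cos z) (cos_zero n) =
        - ((-1) ^ n * G (cos_zero n))"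
      using winding_number_triangle_path[of n N] n by simp
  qed
  finally show ?thesis .
qed

lemma sec_contour_integrable:
  assumes "G holomorphic_on sector"
  shows "(\<lambda>z. G z / cos z ^ m) contour_integrable_on (triangle_path N)"
proof (rule contour_integrable_holomorphic_simple[OF _ _ valid_triangle_path])
  have "continuous_on sector (cos :: complex \<Rightarrow> complex)" by (intro continuous_intros)
  from continuous_open_preimage[OF this open_sector, of "- {0}"]
  show "open (sector \<inter> cos -` (- {0 :: complex}))" by auto
  show "(\<lambda>z. G z / cos z ^ m) holomorphic_on sector \<inter> cos -` (- {0})"
    by (intro holomorphic_intros holomorphic_on_subset[OF assms]) auto
  show "path_image (triangle_path N) \<subseteq> sector \<inter> cos -` (- {0})"
    using path_image_triangle_path_subset by auto
qed

lemma contour_integral_sec_primitive: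
  assumes "\<And>z. z \<in> sector \<Longrightarrow> cos z \<noteq> 0 \<Longrightarrow> (F has_field_derivative f z) (at z)"
  shows "contour_integral (triangle_path N) f = 0"
proof (rule contour_integral_unique, rule Cauchy_theorem_primitive[OF _ valid_triangle_path _ loop_triangle_path])
  show "(F has_field_derivative f z) (at z within sector \<inter> cos -` (- {0}))" if "z \<in> sector \<inter> cos -` (- {0})" for z
    using assms[of z] that by (auto intro: has_field_derivative_at_within)
  show "path_image (triangle_path N) \<subseteq> sector \<inter> cos -` (- {0})"
    using path_image_triangle_path_subset by auto
qed

text \<open>Integration by parts with the primitive \<open>G tan\<close> leaves
  \<open>- G' sin / cos\<close>, which has simple poles; since the sine is \<open>(-1)^n\<close> at
  the zeros, the alternating sign cancels.\<close>

lemma contour_integral_sec_square: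
  assumes G: "G holomorphic_on sector"
  shows "contour_integral (triangle_path N) (\<lambda>z. G z / cos z ^ 2) = 2 * pi * \<i> * (\<Sum>n<N. deriv G (cos_zero n))"
proof -
  have G': "deriv G holomorphic_on sector" using G open_sector by (intro holomorphic_deriv)
  have "contour_integral (triangle_path N) (\<lambda>z. (deriv G z * sin z) / cos z ^ 1 + G z / cos z ^ 2) = 0"
  proof (rule contour_integral_sec_primitive[of "\<lambda>z. G z * (sin z / cos z)"])
    fix z assume z: "z \<in> sector" "cos z \<noteq> 0"
    note [derivative_intros] = holomorphic_derivI[OF G open_sector z(1)]
    show "((\<lambda>z. G z * (sin z / cos z)) has_field_derivative deriv G z * sin z / cos z ^ 1 + G z / cos z ^ 2) (at z)"
    proof -
      have s2: "sin z * sin z = 1 - cos z * cos z" using sin_cos_squared_add[of z] by (simp add: power2_eq_square algebra_simps)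
      show ?thesis
        using z(2) by (auto intro!: derivative_eq_intros simp: field_simps power2_eq_square) (simp add: s2 algebra_simps)
    qed
  qed
  moreover have "contour_integral (triangle_path N) (\<lambda>z. (deriv G z * sin z) / cos z ^ 1 + G z / cos z ^ 2) =
      contour_integral (triangle_path N) (\<lambda>z. (deriv G z * sin z) / cos z ^ 1) +
      contour_integral (triangle_path N) (\<lambda>z. G z / cos z ^ 2)"
    by (intro contour_integral_add sec_contour_integrable G holomorphic_intros G')
  moreover have "contour_integral (triangle_path N) (\<lambda>z. (deriv G z * sin z) / cos z ^ 1) =
     2 * pi * \<i> * (\<Sum>n<N. - ((-1) ^ n * (deriv G (cos_zero n) * sin (cos_zero n))))"
    using contour_integral_sec[of "\<lambda>z. deriv G z * sin z" N] G' by (simp add: holomorphic_intros)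
  moreover have "(-1) ^ n * (deriv G (cos_zero n) * sin (cos_zero n)) = deriv G (cos_zero n)" for n
    by (simp add: sin_cos_zero minus_one_power_iff)
  ultimately show ?thesis by (simp add: sum_negf add_eq_0_iff)
qed

lemma DERIV_sec_power:
  fixes z :: complex
  assumes "cos z \<noteq> 0"
  shows "((\<lambda>z. 1 / cos z ^ m) has_field_derivative of_nat m * sin z / cos z ^ (m + 1)) (at z)"
proof (cases m)
  case (Suc k)
  have "((\<lambda>z. inverse (cos z) ^ m) has_field_derivative
      of_nat m * (inverse (cos z) ^ (m - Suc 0) * (sin z * inverse (cos z) ^ 2))) (at z)"
    using assms by (auto intro!: derivative_eq_intros simp: power2_eq_square divide_inverse)
  also have "of_nat m * (inverse (cos z) ^ (m - Suc 0) * (sin z * inverse (cos z) ^ 2)) = of_nat m * sin z / cos z ^ (m + 1)"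
    by (simp add: Suc divide_inverse power_inverse power2_eq_square mult_ac)
  finally show ?thesis by (simp add: power_inverse divide_inverse)
qed auto

text \<open>Two integrations by parts, based on
  \<open>(sec^m)'' = m (m + 1) sec^(m + 2) - m^2 sec^m\<close>. The primitive is
  \<open>G (sec^m)' - G' sec^m\<close>, divided by \<open>m (m + 1)\<close>, and a closed contour
  leaves no boundary terms.\<close>

lemma contour_integral_sec_reduction:
  assumes G: "G holomorphic_on sector" and m: "m \<ge> 1"
  shows "contour_integral (triangle_path N) (\<lambda>z. G z / cos z ^ (m + 2)) =
     contour_integral (triangle_path N) (\<lambda>z. ((deriv (deriv G) z + of_nat (m ^ 2) * G z) / of_nat (m * (m + 1))) / cos z ^ m)"
proof -
  have G': "deriv G holomorphic_on sector" and G'': "deriv (deriv G) holomorphic_on sector"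
    using G open_sector by (auto intro!: holomorphic_deriv)
  let ?H = "\<lambda>z. (deriv (deriv G) z + of_nat (m ^ 2) * G z) / of_nat (m * (m + 1))"
  have "contour_integral (triangle_path N) (\<lambda>z. G z / cos z ^ (m + 2) - ?H z / cos z ^ m) = 0"
  proof (rule contour_integral_sec_primitive[of "\<lambda>z. (G z * (of_nat m * sin z / cos z ^ (m + 1)) - deriv G z / cos z ^ m) / of_nat (m * (m + 1))"])
    fix z assume z: "z \<in> sector" "cos z \<noteq> 0"
    obtain k where k: "m = Suc k" using m by (cases m) auto
    note [derivative_intros] = holomorphic_derivI[OF G open_sector z(1)] holomorphic_derivI[OF G' open_sector z(1)]
    define c s g0 g1 g2 q where "c = cos z" and "s = sin z" and "g0 = G z" and "g1 = deriv G z" and "g2 = deriv (deriv G) z" and "q = (of_nat m :: complex)"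
    have q: "q \<noteq> 0" "q + 1 \<noteq> 0" using m unfolding q_def by (auto simp del: of_nat_Suc simp: add.commute[of _ 1] simp flip: of_nat_Suc)
    have s2: "s * s = 1 - c * c" using sin_cos_squared_add[of z] unfolding s_def c_def by (simp add: power2_eq_square algebra_simps)
    have c: "c \<noteq> 0" using z by (simp add: c_def)
    have 1: "((\<lambda>z. of_nat m * sin z / cos z ^ (m + 1)) has_field_derivative
        q * c / c ^ (m + 1) + q * (q + 1) * (s * s) / c ^ (m + 2)) (at z)"
    proof -
      have "((\<lambda>z. of_nat m * (sin z * (1 / cos z ^ (m + 1)))) has_field_derivative
          of_nat m * (cos z * (1 / cos z ^ (m + 1)) + of_nat (m + 1) * sin z / cos z ^ (m + 1 + 1) * sin z)) (at z)"
        by (intro DERIV_cmult DERIV_mult DERIV_sin DERIV_sec_power z)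
      thus ?thesis using z(2) unfolding c_def s_def q_def by (simp add: algebra_simps)
    qed
    have 2: "((\<lambda>z. deriv G z / cos z ^ m) has_field_derivative g2 / c ^ m + g1 * (q * s / c ^ (m + 1))) (at z)"
      using DERIV_mult[OF holomorphic_derivI[OF G' open_sector z(1)] DERIV_sec_power[OF z(2), of m]]
      unfolding c_def s_def q_def g1_def g2_def by (simp add: mult.commute)
    have "((\<lambda>z. (G z * (of_nat m * sin z / cos z ^ (m + 1)) - deriv G z / cos z ^ m) / of_nat (m * (m + 1))) has_field_derivative
       ((g1 * (q * s / c ^ (m + 1)) + (q * c / c ^ (m + 1) + q * (q + 1) * (s * s) / c ^ (m + 2)) * g0)
         - (g2 / c ^ m + g1 * (q * s / c ^ (m + 1)))) / of_nat (m * (m + 1))) (at z)"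
      using DERIV_cdivide[OF DERIV_diff[OF DERIV_mult[OF holomorphic_derivI[OF G open_sector z(1)] 1] 2], of "of_nat (m * (m + 1))"]
      unfolding c_def s_def q_def g0_def g1_def g2_def by (simp add: mult.commute)
    also have "((g1 * (q * s / c ^ (m + 1)) + (q * c / c ^ (m + 1) + q * (q + 1) * (s * s) / c ^ (m + 2)) * g0)
         - (g2 / c ^ m + g1 * (q * s / c ^ (m + 1)))) / of_nat (m * (m + 1)) =
         G z / cos z ^ (m + 2) - ?H z / cos z ^ m"
    proof -
      have e1: "q * c / c ^ (m + 1) = q / c ^ m" using c by simp
      have e2: "q * (q + 1) * (s * s) / c ^ (m + 2) = q * (q + 1) / c ^ (m + 2) - q * (q + 1) / c ^ m"
        unfolding s2 using c by (simp add: field_simps power2_eq_square)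
      have "(g1 * (q * s / c ^ (m + 1)) + (q * c / c ^ (m + 1) + q * (q + 1) * (s * s) / c ^ (m + 2)) * g0)
         - (g2 / c ^ m + g1 * (q * s / c ^ (m + 1))) = q * (q + 1) * (g0 / c ^ (m + 2)) - (g2 + q ^ 2 * g0) / c ^ m"
        unfolding e1 e2 by (simp add: algebra_simps add_divide_distrib power2_eq_square)
      moreover have "of_nat (m * (m + 1)) = q * (q + 1)" by (simp add: q_def algebra_simps)
      ultimately show ?thesis using q
        by (simp add: diff_divide_distrib g0_def c_def g2_def q_def mult.commute)
    qed
    finally show "((\<lambda>z. (G z * (of_nat m * sin z / cos z ^ (m + 1)) - deriv G z / cos z ^ m) / of_nat (m * (m + 1))) has_field_derivative
         G z / cos z ^ (m + 2) - ?H z / cos z ^ m) (at z)" .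
  qed
  moreover have "contour_integral (triangle_path N) (\<lambda>z. G z / cos z ^ (m + 2) - ?H z / cos z ^ m) =
     contour_integral (triangle_path N) (\<lambda>z. G z / cos z ^ (m + 2)) - contour_integral (triangle_path N) (\<lambda>z. ?H z / cos z ^ m)"
    using m by (intro contour_integral_diff sec_contour_integrable G holomorphic_intros G'') auto
  ultimately show ?thesis by simp
qed

text \<open>Repeated integration by parts lowers the exponent of the secant by two, down to 1 or 2.\<close>

fun sec_operator :: "nat \<Rightarrow> (complex \<Rightarrow> complex) \<Rightarrow> complex \<Rightarrow> complex" where
  "sec_operator 0 G = (\<lambda>_. 0)"
| "sec_operator (Suc 0) G = G"
| "sec_operator (Suc (Suc 0)) G = deriv G"
| "sec_operator (Suc (Suc (Suc m))) G =
     sec_operator (Suc m) (\<lambda>z. (deriv (deriv G) z + of_nat (Suc m ^ 2) * G z) / of_nat (Suc m * (Suc m + 1)))"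

lemma contour_integral_sec_power:
  assumes "G holomorphic_on sector" "m \<ge> 1"
  shows "contour_integral (triangle_path N) (\<lambda>z. G z / cos z ^ m) =
     2 * pi * \<i> * (\<Sum>n<N. (if odd m then - ((-1) ^ n) else 1) * sec_operator m G (cos_zero n))"
  using assms
proof (induction m G rule: sec_operator.induct)
  case (2 G)
  thus ?case using contour_integral_sec[of G N] by simp
next
  case (3 G)
  thus ?case using contour_integral_sec_square[of G N] by (simp add: numeral_2_eq_2)
next
  case (4 m G)
  have hol: "(\<lambda>z. (deriv (deriv G) z + of_nat (Suc m ^ 2) * G z) / of_nat (Suc m * (Suc m + 1))) holomorphic_on sector"
    using 4(2) open_sector
    by (intro holomorphic_intros holomorphic_deriv) (simp_all only: of_nat_eq_0_iff, simp_all)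
  have "contour_integral (triangle_path N) (\<lambda>z. G z / cos z ^ Suc (Suc (Suc m))) =
     contour_integral (triangle_path N) (\<lambda>z. ((deriv (deriv G) z + of_nat (Suc m ^ 2) * G z) / of_nat (Suc m * (Suc m + 1))) / cos z ^ Suc m)"
    using contour_integral_sec_reduction[OF 4(2), of "Suc m" N] unfolding add_2_eq_Suc' by simp
  also note 4(1)[OF hol]
  finally show ?case by simp
qed auto

section \<open>The rays, the far edge and the passage to the limit\<close>

lemma cosh_complex_of_real: "cosh (complex_of_real x) = of_real (cosh x)"
  and sinh_complex_of_real: "sinh (complex_of_real x) = of_real (sinh x)"
  by (simp_all add: cosh_def sinh_def exp_of_real[symmetric] scaleR_conv_of_real)

lemma tanh_complex_of_real: "tanh (complex_of_real x) = of_real (tanh x)"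
  by (simp add: tanh_def cosh_complex_of_real sinh_complex_of_real)

lemma sec_contour_integrable_linepath:
  assumes G: "G holomorphic_on sector" and sub: "closed_segment a b \<subseteq> path_image (triangle_path N)"
  shows "(\<lambda>z. G z / cos z ^ m) contour_integrable_on linepath a b"
proof (rule contour_integrable_continuous_linepath)
  show "continuous_on (closed_segment a b) (\<lambda>z. G z / cos z ^ m)"
    using path_image_triangle_path_subset sub
    by (intro continuous_intros continuous_on_subset[OF holomorphic_on_imp_continuous_on[OF G]]) auto
qed

lemma contour_integral_triangle_split:
  fixes N m
  assumes G: "G holomorphic_on sector"
  defines "F \<equiv> \<lambda>z. G z / cos z ^ m"
  shows "contour_integral (triangle_path N) F =
     contour_integral (linepath 0 (corner N)) F + contour_integral (linepath (corner N) (\<i> * corner N)) F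
       - contour_integral (linepath 0 (\<i> * corner N)) F"
proof -
  have int: "F contour_integrable_on linepath a b" if "closed_segment a b \<subseteq> path_image (triangle_path N)" for a b
    unfolding F_def by (rule sec_contour_integrable_linepath[OF G that])
  have 1: "F contour_integrable_on linepath 0 (corner N)" "F contour_integrable_on linepath (corner N) (\<i> * corner N)"
    "F contour_integrable_on linepath (\<i> * corner N) 0" "F contour_integrable_on linepath 0 (\<i> * corner N)"
    by (auto intro!: int simp: path_image_triangle_path closed_segment_commute)
  have "F contour_integrable_on (linepath (corner N) (\<i> * corner N) +++ linepath (\<i> * corner N) 0)"
    using 1 by (intro contour_integrable_joinI) auto
  hence "contour_integral (triangle_path N) F = contour_integral (linepath 0 (corner N)) F +
     (contour_integral (linepath (corner N) (\<i> * corner N)) F + contour_integral (linepath (\<i> * corner N) 0) F)"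
    unfolding triangle_path_def using 1 by (simp add: valid_path_join)
  moreover have "contour_integral (linepath (\<i> * corner N) 0) F = - contour_integral (linepath 0 (\<i> * corner N)) F"
    using contour_integral_reversepath[of "linepath 0 (\<i> * corner N)" F] by simp
  ultimately show ?thesis by simp
qed

lemma contour_integral_linepath_0:
  "contour_integral (linepath 0 a) F = integral {0..1} (\<lambda>x. F (of_real x * a) * a)"
  unfolding contour_integral_integral by (simp add: linepath_def vector_derivative_linepath_at scaleR_conv_of_real
      vector_derivative_linepath_within cong: integral_cong)

lemma contour_integral_linepath_0_rotate:
  "contour_integral (linepath 0 (\<i> * a)) F = contour_integral (linepath 0 a) (\<lambda>z. \<i> * F (\<i> * z))"
  unfolding contour_integral_linepath_0 by (simp add: mult_ac)

lemma edge_bounds: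
  assumes "z \<in> closed_segment (corner N) (\<i> * corner N)"
  shows "norm z \<le> 2 * (real N * pi)" "norm (cos z) \<ge> 1" "norm (sin z) \<le> norm (cos z)" "norm (cosh z) \<ge> sinh (real N * pi)"
proof -
  have z: "Re z = N * pi" "\<bar>Im z\<bar> \<le> N * pi" using closed_segment_corners(2)[OF assms] by auto
  have "norm z \<le> \<bar>Re z\<bar> + \<bar>Im z\<bar>" by (rule cmod_le)
  thus "norm z \<le> 2 * (real N * pi)" using z by simp
  have zz: "z = of_real (N * pi) + \<i> * of_real (Im z)" using z(1) complex_eq by metis
  have sn: "sin (of_real (N * pi) :: complex) = 0" "cos (of_real (N * pi) :: complex) = of_real ((-1) ^ N)"
    by (simp_all only: sin_of_real cos_of_real sin_npi cos_npi of_real_0)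
  have ci: "cos (\<i> * of_real y) = of_real (cosh y)" "sin (\<i> * of_real y) = \<i> * of_real (sinh y)" for y :: real
    using cosh_conv_cos[of "of_real y :: complex"] sinh_conv_sin[of "of_real y :: complex"]
    by (simp_all add: cosh_complex_of_real[symmetric] sinh_complex_of_real[symmetric])
  have c: "cos z = of_real ((-1) ^ N * cosh (Im z))"
    by (subst zz, subst cos_add) (simp only: sn ci, simp)
  have s: "sin z = of_real ((-1) ^ N) * (\<i> * of_real (sinh (Im z)))"
    by (subst zz, subst sin_add) (simp only: sn ci, simp)
  have nc: "norm (cos z) = cosh (Im z)" unfolding c by (simp only: norm_of_real) (simp add: abs_mult power_abs)
  show "norm (cos z) \<ge> 1" unfolding nc by (rule cosh_real_ge_1)
  have "norm (sin z) = \<bar>sinh (Im z)\<bar>" unfolding s by (simp add: norm_mult norm_power)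
  also have "\<dots> \<le> cosh (Im z)" by (smt (verit) sinh_le_cosh_real sinh_minus cosh_minus)
  finally show "norm (sin z) \<le> norm (cos z)" by (simp add: nc)
  show "norm (cosh z) \<ge> sinh (real N * pi)" using norm_cosh_sinh_ge(1)[of z] z(1) by simp
qed

lemma sinh_pi_bounds:
  assumes "N \<ge> 1"
  shows "sinh (real N * pi) \<ge> exp (real N * pi) / 4" "sinh (real N * pi) \<ge> 1"
proof -
  define x where "x = real N * pi"
  have x: "x \<ge> 3" using assms pi_gt3 mult_mono[of 1 "real N" 3 pi] by (simp add: x_def)
  have "exp x \<ge> 1 + x" by (rule exp_ge_add_one_self)
  moreover have "exp (-x) \<le> 1" using x by simp
  moreover have "sinh x = exp x / 2 - exp (- x) / 2" by (simp add: sinh_def field_simps)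
  ultimately show "sinh (real N * pi) \<ge> exp (real N * pi) / 4" "sinh (real N * pi) \<ge> 1"
    using x unfolding x_def[symmetric] by linarith+
qed

lemma edge_integral_tendsto_0:
  assumes G: "G holomorphic_on sector"
    and bound: "\<And>N z. N \<ge> 1 \<Longrightarrow> z \<in> closed_segment (corner N) (\<i> * corner N) \<Longrightarrow>
      norm (G z / cos z ^ m) \<le> (2 * (real N * pi)) ^ q / sinh (real N * pi)"
  shows "(\<lambda>N. contour_integral (linepath (corner N) (\<i> * corner N)) (\<lambda>z. G z / cos z ^ m)) \<longlonglongrightarrow> 0"
proof (rule Lim_null_comparison)
  have "((\<lambda>x::real. 4 * 2 ^ (q + 1) * (x ^ (q + 1) / exp x)) \<longlongrightarrow> 4 * 2 ^ (q + 1) * 0) at_top"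
    by (intro tendsto_mult tendsto_const tendsto_power_div_exp_0)
  moreover have "filterlim (\<lambda>N. real N * pi) at_top sequentially"
    by (rule filterlim_at_top_mult_tendsto_pos[OF tendsto_const pi_gt_zero filterlim_real_sequentially])
  ultimately show "(\<lambda>N. 4 * 2 ^ (q + 1) * ((real N * pi) ^ (q + 1) / exp (real N * pi))) \<longlonglongrightarrow> 0"
    by (auto dest: filterlim_compose)
  show "\<forall>\<^sub>F N in sequentially. norm (contour_integral (linepath (corner N) (\<i> * corner N)) (\<lambda>z. G z / cos z ^ m)) \<le>
      4 * 2 ^ (q + 1) * ((real N * pi) ^ (q + 1) / exp (real N * pi))"
  proof (intro eventually_sequentiallyI[of 1])
    fix N :: nat assume N: "1 \<le> N"
    define x where "x = real N * pi"
    have x: "x > 0" using N by (simp add: x_def)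
    have "(\<lambda>z. G z / cos z ^ m) contour_integrable_on linepath (corner N) (\<i> * corner N)"
      by (rule sec_contour_integrable_linepath[OF G, of _ _ N]) (auto simp: path_image_triangle_path)
    hence "norm (contour_integral (linepath (corner N) (\<i> * corner N)) (\<lambda>z. G z / cos z ^ m)) \<le>
        (2 * x) ^ q / sinh x * norm (\<i> * corner N - corner N)"
      using sinh_pi_bounds[OF N] x bound[OF N] unfolding x_def
      by (intro has_contour_integral_bound_linepath[OF has_contour_integral_integral]) auto
    also have "norm (\<i> * corner N - corner N) = 2 * x"
    proof -
      have "\<i> * corner N - corner N = 2 * \<i> * of_real x" by (simp add: corner_def x_def algebra_simps)
      thus ?thesis using x by (simp add: norm_mult)
    qed
    also have "(2 * x) ^ q / sinh x * (2 * x) = (2 * x) ^ (q + 1) / sinh x" by simp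
    also have "\<dots> \<le> (2 * x) ^ (q + 1) / (exp x / 4)"
      using sinh_pi_bounds[OF N] x unfolding x_def[symmetric] by (intro divide_left_mono) auto
    also have "\<dots> = 4 * 2 ^ (q + 1) * (x ^ (q + 1) / exp x)" by (simp add: power_mult_distrib)
    finally show "norm (contour_integral (linepath (corner N) (\<i> * corner N)) (\<lambda>z. G z / cos z ^ m)) \<le>
      4 * 2 ^ (q + 1) * ((real N * pi) ^ (q + 1) / exp (real N * pi))" unfolding x_def .
  qed
qed

lemma sec_operator_sum_tendsto:
  assumes G: "G holomorphic_on sector" and m: "m \<ge> 1"
    and bound: "\<And>N z. N \<ge> 1 \<Longrightarrow> z \<in> closed_segment (corner N) (\<i> * corner N) \<Longrightarrow>
      norm (G z / cos z ^ m) \<le> (2 * (real N * pi)) ^ q / sinh (real N * pi)"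
    and ray: "(\<lambda>N. contour_integral (linepath 0 (corner N)) (\<lambda>z. G z / cos z ^ m) -
       contour_integral (linepath 0 (\<i> * corner N)) (\<lambda>z. G z / cos z ^ m)) \<longlonglongrightarrow> R"
  shows "(\<lambda>N. 2 * pi * \<i> * (\<Sum>n<N. (if odd m then - ((-1) ^ n) else 1) * sec_operator m G (cos_zero n))) \<longlonglongrightarrow> R"
proof -
  have "(\<lambda>N. (contour_integral (linepath 0 (corner N)) (\<lambda>z. G z / cos z ^ m) -
       contour_integral (linepath 0 (\<i> * corner N)) (\<lambda>z. G z / cos z ^ m)) +
       contour_integral (linepath (corner N) (\<i> * corner N)) (\<lambda>z. G z / cos z ^ m)) \<longlonglongrightarrow> R + 0"
    by (intro tendsto_add ray edge_integral_tendsto_0[OF G bound])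
  hence "(\<lambda>N. contour_integral (triangle_path N) (\<lambda>z. G z / cos z ^ m)) \<longlonglongrightarrow> R"
    unfolding contour_integral_triangle_split[OF G] by (simp add: algebra_simps)
  thus ?thesis unfolding contour_integral_sec_power[OF G m] .
qed

lemma holomorphic_power_sech: "(\<lambda>z. z ^ q / cosh z ^ m) holomorphic_on sector"
  using cosh_nonzero_sector unfolding cosh_def by (auto intro!: holomorphic_intros)

lemma power_sech_sec_edge_bound:
  assumes "N \<ge> 1" "z \<in> closed_segment (corner N) (\<i> * corner N)" "m \<ge> 1"
  shows "norm (z ^ q / cosh z ^ m / cos z ^ m) \<le> (2 * (real N * pi)) ^ q / sinh (real N * pi)"
proof -
  note b = edge_bounds[OF assms(2)] and sb = sinh_pi_bounds[OF assms(1)]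
  have "norm (z ^ q / cosh z ^ m / cos z ^ m) = norm z ^ q / (norm (cosh z) ^ m * norm (cos z) ^ m)"
    by (simp add: norm_divide norm_power norm_mult)
  also have "\<dots> \<le> (2 * (real N * pi)) ^ q / (sinh (real N * pi) * 1)"
  proof (intro frac_le mult_mono power_mono)
    have "sinh (real N * pi) \<le> norm (cosh z)" by (rule b)
    also have "norm (cosh z) ^ 1 \<le> norm (cosh z) ^ m" using b sb assms(3) by (intro power_increasing) auto
    finally show "sinh (real N * pi) \<le> norm (cosh z) ^ m" by simp
    show "1 \<le> norm (cos z) ^ m" using b by (intro one_le_power) auto
  qed (use b sb assms(1) in auto)
  finally show ?thesis by simp
qed

text \<open>A quarter turn exchanges cos and cosh, so the product of the reciprocals is invariant;
  only the power and the differential leave a factor, which is 1 for \<open>q = 3\<close> and -1 for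
  \<open>q = 4 p + 1\<close>.\<close>

lemma power_sech_sec_rotate:
  fixes z :: complex
  shows "\<i> * ((\<i> * z) ^ q / cosh (\<i> * z) ^ m / cos (\<i> * z) ^ m) = \<i> ^ (q + 1) * (z ^ q / cosh z ^ m / cos z ^ m)"
  by (simp add: cosh_conv_cos power_mult_distrib mult.commute)

lemma power_sech_sec_rays:
  "contour_integral (linepath 0 (corner N)) (\<lambda>z. z ^ q / cosh z ^ m / cos z ^ m) -
   contour_integral (linepath 0 (\<i> * corner N)) (\<lambda>z. z ^ q / cosh z ^ m / cos z ^ m) =
   (1 - \<i> ^ (q + 1)) * contour_integral (linepath 0 (corner N)) (\<lambda>z. z ^ q / cosh z ^ m / cos z ^ m)"
proof -
  have "(\<lambda>z. z ^ q / cosh z ^ m / cos z ^ m) contour_integrable_on linepath 0 (corner N)"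
    by (rule sec_contour_integrable_linepath[OF holomorphic_power_sech, of _ _ N]) (auto simp: path_image_triangle_path)
  hence "contour_integral (linepath 0 (corner N)) (\<lambda>z. \<i> ^ (q + 1) * (z ^ q / cosh z ^ m / cos z ^ m)) =
     \<i> ^ (q + 1) * contour_integral (linepath 0 (corner N)) (\<lambda>z. z ^ q / cosh z ^ m / cos z ^ m)"
    by (rule contour_integral_lmul)
  thus ?thesis unfolding contour_integral_linepath_0_rotate power_sech_sec_rotate by (simp add: algebra_simps)
qed

text \<open>Because \<open>\<i> ^ 4 = 1\<close>, both rays give the same value and cancel along the
  contour. The sum is, up to a constant, the third-order coefficient of \<open>C\<close> for
  \<open>t = \<pi>/2\<close>, so its vanishing yields \<open>K = 0\<close>.\<close>

lemma alt_cube_sech_sum_tendsto: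
  "(\<lambda>N. \<Sum>n<N. (-1) ^ n * (cos_zero n ^ 3 / cosh (cos_zero n))) \<longlonglongrightarrow> 0"
proof -
  have hol: "(\<lambda>z. z ^ 3 / cosh z ^ 1) holomorphic_on sector" by (rule holomorphic_power_sech)
  have ray: "(\<lambda>N. contour_integral (linepath 0 (corner N)) (\<lambda>z. z ^ 3 / cosh z ^ 1 / cos z ^ 1) -
      contour_integral (linepath 0 (\<i> * corner N)) (\<lambda>z. z ^ 3 / cosh z ^ 1 / cos z ^ 1)) \<longlonglongrightarrow> 0"
    unfolding power_sech_sec_rays by (simp add: eval_nat_numeral)
  have "(\<lambda>N. 2 * pi * \<i> * (\<Sum>n<N. (if odd (1::nat) then - ((-1) ^ n) else 1) * sec_operator 1 (\<lambda>z. z ^ 3 / cosh z ^ 1) (cos_zero n))) \<longlonglongrightarrow> 0"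
    by (rule sec_operator_sum_tendsto[OF hol _ power_sech_sec_edge_bound ray]) auto
  from tendsto_mult[OF tendsto_const[of "- 1 / (2 * pi * \<i>)"] this] show ?thesis
    by (simp add: sum_negf)
qed

text \<open>The numerator \<open>sin z\<close> removes the sign of the residues. A quarter turn
  sends \<open>tan z / cosh^2 z\<close>, with the differential, to
  \<open>- tanh z / cos^2 z\<close>, so the rays together integrate the derivative of
  \<open>tan z tanh z\<close>. Its value at the corner tends to \<open>- \<i>\<close>.\<close>

lemma sech_square_sum_tendsto:
  "(\<lambda>N. \<Sum>n<N. 1 / cosh (cos_zero n) ^ 2) \<longlonglongrightarrow> 1 / (2 * pi)"
proof -
  let ?G = "\<lambda>z::complex. sin z / cosh z ^ 2"
  have hol: "?G holomorphic_on sector"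
    using cosh_nonzero_sector unfolding cosh_def by (auto intro!: holomorphic_intros)
  have ray: "contour_integral (linepath 0 (corner N)) (\<lambda>z. ?G z / cos z ^ 1) -
      contour_integral (linepath 0 (\<i> * corner N)) (\<lambda>z. ?G z / cos z ^ 1) = - \<i> * tanh (of_real (real N * pi)) ^ 2" for N
  proof -
    let ?S = "closed_segment 0 (corner N)"
    have nz: "cos z \<noteq> 0" "cosh z \<noteq> 0" if "z \<in> ?S" for z
      using that path_image_triangle_path_subset[of z N] cosh_nonzero_sector by (auto simp: path_image_triangle_path)
    have i1: "(\<lambda>z. ?G z / cos z ^ 1) contour_integrable_on linepath 0 (corner N)"
      by (rule sec_contour_integrable_linepath[OF hol, of _ _ N]) (auto simp: path_image_triangle_path)
    have r: "\<i> * (?G (\<i> * z) / cos (\<i> * z) ^ 1) = - (sinh z / cosh z / cos z ^ 2)" for z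
      by (simp add: cosh_conv_cos sinh_conv_sin mult.commute)
    have i2: "(\<lambda>z. - (sinh z / cosh z / cos z ^ 2)) contour_integrable_on linepath 0 (corner N)"
      using nz by (intro contour_integrable_continuous_linepath) (auto intro!: continuous_intros simp: sinh_def cosh_def)
    have "contour_integral (linepath 0 (corner N)) (\<lambda>z. ?G z / cos z ^ 1) -
      contour_integral (linepath 0 (\<i> * corner N)) (\<lambda>z. ?G z / cos z ^ 1) =
      contour_integral (linepath 0 (corner N)) (\<lambda>z. ?G z / cos z ^ 1 - (- (sinh z / cosh z / cos z ^ 2)))"
      unfolding contour_integral_linepath_0_rotate r by (rule contour_integral_diff[OF i1 i2, symmetric])
    also have "\<dots> = sin (corner N) / cos (corner N) * (sinh (corner N) / cosh (corner N)) - sin 0 / cos 0 * (sinh 0 / cosh 0)"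
    proof (rule contour_integral_unique)
      have "((\<lambda>z. ?G z / cos z ^ 1 - (- (sinh z / cosh z / cos z ^ 2))) has_contour_integral
          (\<lambda>z. sin z / cos z * (sinh z / cosh z)) (pathfinish (linepath 0 (corner N))) -
          (\<lambda>z. sin z / cos z * (sinh z / cosh z)) (pathstart (linepath 0 (corner N)))) (linepath 0 (corner N))"
      proof (rule contour_integral_primitive[of ?S])
        fix z assume z: "z \<in> ?S"
        have "sin z * sin z = 1 - cos z * cos z" "sinh z * sinh z = cosh z * cosh z - 1"
          using sin_cos_squared_add[of z] sinh_square_eq[of z] by (simp_all add: power2_eq_square algebra_simps)
        hence "((\<lambda>z. sin z / cos z) has_field_derivative 1 / cos z ^ 2) (at z)"
          "((\<lambda>z. sinh z / cosh z) has_field_derivative 1 / cosh z ^ 2) (at z)"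
          using nz[OF z] by (auto intro!: derivative_eq_intros simp: power2_eq_square)
        from DERIV_mult[OF this]
        have "((\<lambda>z. sin z / cos z * (sinh z / cosh z)) has_field_derivative
           ?G z / cos z ^ 1 - (- (sinh z / cosh z / cos z ^ 2))) (at z)"
          by (simp add: mult.commute add.commute)
        thus "((\<lambda>z. sin z / cos z * (sinh z / cosh z)) has_field_derivative
           ?G z / cos z ^ 1 - (- (sinh z / cosh z / cos z ^ 2))) (at z within ?S)"
          by (rule has_field_derivative_at_within)
      qed (simp_all only: valid_path_linepath path_image_linepath order_refl)
      thus "((\<lambda>z. ?G z / cos z ^ 1 - (- (sinh z / cosh z / cos z ^ 2))) has_contour_integral
         sin (corner N) / cos (corner N) * (sinh (corner N) / cosh (corner N)) - sin 0 / cos 0 * (sinh 0 / cosh 0)) (linepath 0 (corner N))"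
        by (simp only: pathfinish_linepath pathstart_linepath)
    qed
    also have "\<dots> = - \<i> * tanh (of_real (real N * pi)) ^ 2"
    proof -
      define x where "x = real N * pi"
      have sn: "sin (of_real x :: complex) = 0" "cos (of_real x :: complex) = of_real ((-1) ^ N)"
        unfolding x_def by (simp_all only: sin_of_real cos_of_real sin_npi cos_npi of_real_0)
      have c: "corner N = of_real x - \<i> * of_real x" by (simp add: corner_def x_def algebra_simps)
      have ci: "cos (\<i> * of_real x) = cosh (of_real x)" "sin (\<i> * of_real x) = \<i> * sinh (of_real x)"
         "cosh (\<i> * of_real x) = cos (of_real x)" "sinh (\<i> * of_real x) = \<i> * sin (of_real x)"
        by (simp_all add: cosh_conv_cos sinh_conv_sin)
      have "sin (corner N) = - (of_real ((-1) ^ N) * (\<i> * sinh (of_real x)))" "cos (corner N) = of_real ((-1) ^ N) * cosh (of_real x)"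
        "sinh (corner N) = sinh (of_real x) * of_real ((-1) ^ N)" "cosh (corner N) = cosh (of_real x) * of_real ((-1) ^ N)"
        unfolding c by (simp_all only: sin_diff cos_diff sinh_diff cosh_diff sn ci) simp_all
      thus ?thesis by (simp add: tanh_def x_def[symmetric] power2_eq_square)
    qed
    finally show ?thesis .
  qed
  have lim: "(\<lambda>N. - \<i> * tanh (of_real (real N * pi)) ^ 2 :: complex) \<longlonglongrightarrow> - \<i> * of_real 1 ^ 2"
  proof -
    have "filterlim (\<lambda>N. real N * pi) at_top sequentially"
      by (rule filterlim_at_top_mult_tendsto_pos[OF tendsto_const pi_gt_zero filterlim_real_sequentially])
    hence "(\<lambda>N. tanh (real N * pi)) \<longlonglongrightarrow> 1" by (rule filterlim_compose[OF tanh_real_at_top])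
    from tendsto_mult[OF tendsto_const tendsto_power[OF tendsto_of_real[OF this]]] show ?thesis
      by (simp only: tanh_complex_of_real)
  qed
  have bd: "norm (?G z / cos z ^ 1) \<le> (2 * (real N * pi)) ^ 0 / sinh (real N * pi)"
    if N: "N \<ge> 1" and z: "z \<in> closed_segment (corner N) (\<i> * corner N)" for N z
  proof -
    note b = edge_bounds[OF z] and sb = sinh_pi_bounds[OF N]
    have "norm (?G z / cos z ^ 1) = (norm (sin z) / norm (cos z)) / (norm (cosh z) * norm (cosh z))"
      by (simp add: norm_divide norm_mult power2_eq_square)
    also have "\<dots> \<le> 1 / (sinh (real N * pi) * 1)"
      using b sb N by (intro frac_le mult_mono) (auto simp: divide_le_eq_1)
    finally show ?thesis by simp
  qed
  have rays: "(\<lambda>N. contour_integral (linepath 0 (corner N)) (\<lambda>z. ?G z / cos z ^ 1) -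
      contour_integral (linepath 0 (\<i> * corner N)) (\<lambda>z. ?G z / cos z ^ 1)) \<longlonglongrightarrow> - \<i> * of_real 1 ^ 2"
    unfolding ray by (rule lim)
  have "(if odd (1::nat) then - ((-1) ^ n) else 1) * sec_operator 1 ?G (cos_zero n) = - (1 / cosh (cos_zero n) ^ 2)" for n
    by (cases "even n") (simp_all add: sin_cos_zero)
  hence "(\<lambda>N. 2 * pi * \<i> * (\<Sum>n<N. - (1 / cosh (cos_zero n) ^ 2))) \<longlonglongrightarrow> - \<i> * of_real 1 ^ 2"
    using sec_operator_sum_tendsto[OF hol order_refl bd rays] by (simp only:)
  from tendsto_mult[OF tendsto_const[of "- 1 / (2 * pi * \<i>)"] this] show ?thesis
    by (simp add: sum_negf)
qed

text \<open>On the ray \<open>z = x (1 - \<i>) / 2\<close> the double-angle formulas give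
  \<open>2 cosh z cos z = cos x + cosh x\<close>; this is how the real integrand arises.\<close>

lemma corner_power_sech_sec:
  fixes x :: real
  shows "(of_real x * (1 - \<i>) / 2) ^ q / cosh (of_real x * (1 - \<i>) / 2) ^ m / cos (of_real x * (1 - \<i>) / 2) ^ m =
     ((1 - \<i>) / 2) ^ q * 2 ^ m * of_real (x ^ q / (cos x + cosh x) ^ m)"
proof -
  let ?z = "of_real x * (1 - \<i>) / 2"
  define y where "y = x / 2"
  have z: "?z = of_real y - \<i> * of_real y" by (simp add: y_def field_simps)
  have ci: "cos (\<i> * of_real y) = cosh (of_real y)" "sin (\<i> * of_real y) = \<i> * sinh (of_real y)"
         "cosh (\<i> * of_real y) = cos (of_real y)" "sinh (\<i> * of_real y) = \<i> * sin (of_real y)"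
        by (simp_all add: cosh_conv_cos sinh_conv_sin)
  define c s C S where "c = cos (of_real y :: complex)" and "s = sin (of_real y :: complex)"
    and "C = cosh (of_real y :: complex)" and "S = sinh (of_real y :: complex)"
  have s2: "s * s = 1 - c * c" "S * S = C * C - 1"
    using sin_cos_squared_add[of "of_real y :: complex"] sinh_square_eq[of "of_real y :: complex"]
    by (simp_all add: power2_eq_square algebra_simps c_def s_def C_def S_def)
  have "cosh ?z * cos ?z = (C * c - S * (\<i> * s)) * (c * C + s * (\<i> * S))"
    unfolding z cosh_diff cos_diff ci c_def s_def C_def S_def by simp
  also have "\<dots> = (c * c) * (C * C) + (s * s) * (S * S)" by (simp add: algebra_simps)
  also have "\<dots> = c * c + C * C - 1" unfolding s2 by (simp add: algebra_simps)
  also have "2 * \<dots> = of_real (cos x + cosh x)"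
  proof -
    have "cos x = 2 * (cos y)\<^sup>2 - 1" using cos_double_cos[of y] by (simp add: y_def)
    moreover have "cosh x = 2 * (cosh y)\<^sup>2 - 1" using cosh_double_cosh[of y] by (simp add: y_def)
    ultimately have *: "cos x + cosh x = 2 * (cos y * cos y + cosh y * cosh y - 1)" by (simp add: power2_eq_square)
    show ?thesis unfolding * c_def C_def cos_of_real cosh_complex_of_real by simp
  qed
  finally have *: "2 * (cosh ?z * cos ?z) = of_real (cos x + cosh x)" by simp
  hence "cosh ?z * cos ?z = of_real (cos x + cosh x) / 2" by (simp add: field_simps)
  hence H: "cosh ?z ^ m * cos ?z ^ m = of_real (cos x + cosh x) ^ m / 2 ^ m"
    by (simp only: power_mult_distrib[symmetric] power_divide)
  have E: "?z ^ q / cosh ?z ^ m / cos ?z ^ m = ?z ^ q * 2 ^ m / of_real (cos x + cosh x) ^ m"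
    unfolding divide_divide_eq_left H by simp
  have pz: "?z ^ q = ((1 - \<i>) / 2) ^ q * of_real x ^ q"
    by (simp add: power_mult_distrib[symmetric] mult.commute)
  show ?thesis unfolding E unfolding pz by simp
qed

lemma cos_plus_cosh_ge:
  fixes x :: real
  assumes "x \<ge> 0"
  shows "cos x + cosh x \<ge> exp x / 4" "cos x + cosh x > 0"
proof -
  have ch: "cosh x = exp x / 2 + exp (- x) / 2" by (simp add: cosh_def)
  have "2 \<le> cos x + cosh x"
  proof -
    have "(sin (x / 2))\<^sup>2 \<le> (x / 2)\<^sup>2"
      using abs_sin_x_le_abs_x[of "x / 2"] by (simp only: abs_le_square_iff)
    moreover have "cos x = 1 - 2 * (sin (x / 2))\<^sup>2" using cos_double_sin[of "x / 2"] by simp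
    moreover have "x / 2 \<le> sinh (x / 2)" using real_le_x_sinh[of "x / 2"] assms by (simp add: sinh_def exp_minus field_simps)
    hence "(x / 2)\<^sup>2 \<le> (sinh (x / 2))\<^sup>2" using assms by (intro power_mono) auto
    moreover have "cosh x = 2 * (sinh (x / 2))\<^sup>2 + 1"
      using cosh_double_cosh[of "x / 2"] cosh_square_eq[of "x / 2"] by simp
    ultimately show ?thesis by linarith
  qed
  moreover have "cos x \<ge> -1" "exp (-x) > 0" by simp_all
  \<comment> \<open>This follows from averaging the two lower bounds 2 and
    \<open>exp x / 2 - 1\<close>.\<close>
  ultimately show "cos x + cosh x \<ge> exp x / 4" unfolding ch by linarith
  thus "cos x + cosh x > 0" by (smt (verit) exp_gt_zero divide_pos_pos)
qed

lemma integrand_integrable: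
  fixes q m :: nat
  assumes m: "m \<ge> 1"
  defines "f \<equiv> \<lambda>x::real. x ^ q / (cos x + cosh x) ^ m"
  shows "f integrable_on {0..}"
    and "(\<lambda>N. integral {0..2 * (real N * pi)} f) \<longlonglongrightarrow> integral {0..} f"
proof -
  \<comment> \<open>The majorant is a multiple of the integrand of \<open>Gamma (q + 1)\<close>. The
    extra value 1 at the origin is for \<open>q = 0\<close>, where \<open>0 ^ 0 = 1\<close> but
    \<open>0 powr 0 = 0\<close>.\<close>
  define g where "g = (\<lambda>x::real. 4 ^ m * (x powr (real (q + 1) - 1) / exp x) + (if x = 0 then 1 else 0))"
  have "((\<lambda>x. 4 ^ m * (x powr (real (q + 1) - 1) / exp x)) has_integral 4 ^ m * Gamma (real (q + 1))) {0..}"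
    by (intro has_integral_mult_right Gamma_integral_real) auto
  hence "(g has_integral 4 ^ m * Gamma (real (q + 1))) {0..}"
    by (rule has_integral_spike[of "{0}", rotated 2]) (auto simp: g_def)
  hence g: "g integrable_on {0..}" by blast
  have pos: "cos x + cosh x > 0" if "x \<ge> 0" for x :: real by (rule cos_plus_cosh_ge(2)[OF that])
  have cont: "continuous_on {0..b} f" for b
    unfolding f_def cosh_def using pos unfolding cosh_def
    by (intro continuous_intros) (auto simp: less_imp_neq[symmetric] intro!: continuous_intros)
  have bound: "norm (f x) \<le> g x" if x: "x \<in> {0..}" for x
  proof (cases "x = 0")
    case True
    have "norm (f 0) \<le> 1" by (cases "q = 0") (auto simp: f_def divide_le_eq_1 one_le_power power_0_left)
    thus ?thesis using True by (simp add: g_def)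
  next
    case False
    hence x0: "x > 0" using x by simp
    have "1 \<le> exp x" using x0 by simp
    have "norm (f x) = x ^ q / (cos x + cosh x) ^ m" using pos[of x] x0 by (simp add: f_def)
    also have "\<dots> \<le> x ^ q / (exp x / 4) ^ m"
      using cos_plus_cosh_ge[of x] x0 by (intro divide_left_mono power_mono mult_pos_pos zero_less_power) auto
    also have "\<dots> = 4 ^ m * (x ^ q / exp x ^ m)" by (simp add: power_divide)
    also have "\<dots> \<le> 4 ^ m * (x ^ q / exp x ^ 1)"
      using x0 \<open>1 \<le> exp x\<close> m by (intro mult_left_mono divide_left_mono power_increasing mult_pos_pos zero_less_power) auto
    also have "\<dots> = g x" using x0 by (simp add: g_def powr_realpow)
    finally show ?thesis .
  qed
  define fk where "fk = (\<lambda>N x. if x \<in> {0..2 * (real N * pi)} then f x else 0)"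
  have fk: "(fk N has_integral integral {0..2 * (real N * pi)} f) {0..}" for N
    unfolding fk_def
    by (subst has_integral_restrict) (use cont in \<open>auto intro!: integrable_integral integrable_continuous_interval\<close>)
  have lim: "(\<lambda>N. fk N x) \<longlonglongrightarrow> f x" if "x \<in> {0..}" for x
  proof (rule tendsto_eventually)
    have "filterlim (\<lambda>N. 2 * (real N * pi)) at_top sequentially"
      by (rule filterlim_tendsto_pos_mult_at_top[OF tendsto_const zero_less_numeral])
         (rule filterlim_at_top_mult_tendsto_pos[OF tendsto_const pi_gt_zero filterlim_real_sequentially])
    hence "\<forall>\<^sub>F N in sequentially. x \<le> 2 * (real N * pi)" by (simp add: filterlim_at_top)
    thus "\<forall>\<^sub>F N in sequentially. fk N x = f x"
      by eventually_elim (use that in \<open>simp add: fk_def\<close>)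
  qed
  have le: "norm (fk N x) \<le> g x" if "x \<in> {0..}" for N x
    using bound[OF that] norm_ge_zero[of "f x"] unfolding fk_def by (auto simp del: norm_ge_zero)
  show "f integrable_on {0..}"
    by (rule dominated_convergence(1)[OF has_integral_integrable[OF fk] g le lim])
  have "(\<lambda>N. integral {0..} (fk N)) \<longlonglongrightarrow> integral {0..} f"
    by (rule dominated_convergence(2)[OF has_integral_integrable[OF fk] g le lim])
  thus "(\<lambda>N. integral {0..2 * (real N * pi)} f) \<longlonglongrightarrow> integral {0..} f"
    by (simp only: integral_unique[OF fk])
qed

lemma ray_integral_eq:
  fixes q m N :: nat
  assumes m: "m \<ge> 1"
  defines "f \<equiv> \<lambda>x::real. x ^ q / (cos x + cosh x) ^ m"
  shows "contour_integral (linepath 0 (corner N)) (\<lambda>z. z ^ q / cosh z ^ m / cos z ^ m) =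
     ((1 - \<i>) / 2) ^ (q + 1) * 2 ^ m * of_real (integral {0..2 * (real N * pi)} f)"
proof (cases "N = 0")
  case True
  thus ?thesis by (simp add: corner_def)
next
  case False
  \<comment> \<open>In the parametrisation \<open>z = x (1 - \<i>) / 2\<close> the corner
    \<open>N \<pi> (1 - \<i>)\<close> belongs to \<open>x = 2 N \<pi>\<close>.\<close>
  define X where "X = 2 * (real N * pi)"
  have X: "X > 0" using False by (simp add: X_def)
  have "f integrable_on {0..X}"
    by (rule integrable_on_subinterval[OF integrand_integrable(1)[OF m, of q, folded f_def]]) auto
  hence "(f has_integral integral {0..X} f) {0..X}" by (rule integrable_integral)
  from has_integral_stretch_real[OF this, of X]
  have "((\<lambda>x. f (X * x)) has_integral (1 / X) * integral {0..X} f) ((\<lambda>x. x / X) ` {0..X})" using X by simp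
  moreover have "(\<lambda>x. x / X) ` {0..X} = {0..1}"
  proof
    show "{0..1} \<subseteq> (\<lambda>x. x / X) ` {0..X}"
    proof
      fix y assume "y \<in> {0..1::real}"
      hence "y = (X * y) / X" "X * y \<in> {0..X}" using X by (auto simp: mult_left_le)
      thus "y \<in> (\<lambda>x. x / X) ` {0..X}" by blast
    qed
  qed (use X in auto)
  ultimately have "((\<lambda>x. f (X * x)) has_integral (1 / X) * integral {0..X} f) {0..1}" by simp
  hence "((\<lambda>x. complex_of_real (f (X * x))) has_integral of_real ((1 / X) * integral {0..X} f)) {0..1}"
    by (rule has_integral_of_real)
  from has_integral_mult_right[OF this, of "((1 - \<i>) / 2) ^ (q + 1) * 2 ^ m * of_real X"]
  have "((\<lambda>x. ((1 - \<i>) / 2) ^ (q + 1) * 2 ^ m * of_real X * of_real (f (X * x))) has_integral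
     ((1 - \<i>) / 2) ^ (q + 1) * 2 ^ m * of_real (integral {0..X} f)) {0..1}" using X by (simp add: mult.assoc)
  moreover have "((1 - \<i>) / 2) ^ (q + 1) * 2 ^ m * of_real X * of_real (f (X * x)) =
     ((of_real x * corner N) ^ q / cosh (of_real x * corner N) ^ m / cos (of_real x * corner N) ^ m) * corner N" for x
  proof -
    have c: "of_real x * corner N = of_real (X * x) * (1 - \<i>) / 2" "corner N = of_real X * ((1 - \<i>) / 2)"
      by (simp_all add: corner_def X_def)
    show ?thesis unfolding c(1) corner_power_sech_sec unfolding c(2) f_def by (simp add: mult_ac)
  qed
  ultimately show ?thesis unfolding contour_integral_linepath_0 X_def[symmetric] by (simp add: integral_unique)
qed

text \<open>The rays at angles \<open>\<mp>\<pi>/4\<close> are exchanged by \<open>z \<mapsto> \<i> z\<close>, which multiplies the integrand by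
  \<open>\<i> ^ (4 p + 2) = - 1\<close>; so their contributions add up.\<close>

theorem sec_operator_sum_tendsto_integral:
  fixes m p :: nat
  assumes m: "m \<ge> 1"
  defines "f \<equiv> \<lambda>x::real. x ^ (4 * p + 1) / (cos x + cosh x) ^ m"
  shows "(\<lambda>N. \<Sum>n<N. (if odd m then - ((-1) ^ n) else 1) * sec_operator m (\<lambda>z. z ^ (4 * p + 1) / cosh z ^ m) (cos_zero n))
     \<longlonglongrightarrow> of_real (- ((-1) ^ p) * 2 ^ m / (2 ^ (2 * p + 1) * pi) * integral {0..} f)"
proof -
  have i4: "\<i> ^ (4 * p + 1 + 1) = -1" by (simp add: power_add power_mult)
  have half: "((1 - \<i>) / 2) ^ (4 * p + 1 + 1) = - \<i> * (-1) ^ p / 2 ^ (2 * p + 1)"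
  proof -
    have "4 * p + 1 + 1 = 2 * (2 * p + 1)" by simp
    hence "((1 - \<i>) / 2) ^ (4 * p + 1 + 1) = (((1 - \<i>) / 2) ^ 2) ^ (2 * p + 1)" by (simp only: power_mult)
    also have "((1 - \<i>) / 2) ^ 2 = - \<i> / 2" by (simp add: power2_eq_square algebra_simps)
    also have "(- \<i> / 2) ^ (2 * p + 1) = (- \<i>) ^ (2 * p + 1) / 2 ^ (2 * p + 1)" by (rule power_divide)
    also have "(- \<i>) ^ (2 * p + 1) = - \<i> * (-1) ^ p" by (simp add: power_mult)
    finally show ?thesis .
  qed
  have "(\<lambda>N. 2 * (((1 - \<i>) / 2) ^ (4 * p + 1 + 1) * 2 ^ m * of_real (integral {0..2 * (real N * pi)} f))) \<longlonglongrightarrow>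
      2 * (((1 - \<i>) / 2) ^ (4 * p + 1 + 1) * 2 ^ m * of_real (integral {0..} f))"
    unfolding f_def by (intro tendsto_intros integrand_integrable(2) m)
  hence ray: "(\<lambda>N. contour_integral (linepath 0 (corner N)) (\<lambda>z. z ^ (4 * p + 1) / cosh z ^ m / cos z ^ m) -
      contour_integral (linepath 0 (\<i> * corner N)) (\<lambda>z. z ^ (4 * p + 1) / cosh z ^ m / cos z ^ m)) \<longlonglongrightarrow>
      2 * (((1 - \<i>) / 2) ^ (4 * p + 1 + 1) * 2 ^ m * of_real (integral {0..} f))"
    unfolding power_sech_sec_rays unfolding i4 ray_integral_eq[OF m] f_def by simp
  have "(\<lambda>N. 2 * pi * \<i> * (\<Sum>n<N. (if odd m then - ((-1) ^ n) else 1) *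
      sec_operator m (\<lambda>z. z ^ (4 * p + 1) / cosh z ^ m) (cos_zero n))) \<longlonglongrightarrow>
      2 * (((1 - \<i>) / 2) ^ (4 * p + 1 + 1) * 2 ^ m * of_real (integral {0..} f))"
    by (rule sec_operator_sum_tendsto[OF holomorphic_power_sech m power_sech_sec_edge_bound[OF _ _ m] ray])
  from tendsto_mult[OF tendsto_const[of "1 / (2 * pi * \<i>)"] this]
  have *: "(\<lambda>N. \<Sum>n<N. (if odd m then - ((-1) ^ n) else 1) * sec_operator m (\<lambda>z. z ^ (4 * p + 1) / cosh z ^ m) (cos_zero n))
     \<longlonglongrightarrow> 1 / (2 * pi * \<i>) * (2 * (((1 - \<i>) / 2) ^ (4 * p + 1 + 1) * 2 ^ m * of_real (integral {0..} f)))"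
    by (simp add: mult.assoc[symmetric])
  have "1 / (2 * pi * \<i>) * (2 * (((1 - \<i>) / 2) ^ (4 * p + 1 + 1) * 2 ^ m * of_real (integral {0..} f))) =
     of_real (- ((-1) ^ p) * 2 ^ m / (2 ^ (2 * p + 1) * pi) * integral {0..} f)"
    unfolding half by (simp add: field_simps)
  with * show ?thesis by simp
qed

subsection \<open>The parameter value pi / 2\<close>

definition sech_fun :: "complex \<Rightarrow> complex" where "sech_fun z = 1 / cosh z"
definition sech_square_fun :: "complex \<Rightarrow> complex" where "sech_square_fun z = 1 / cosh z ^ 2"

lemma cosh_nonzero_off_axis: "Re z \<noteq> 0 \<Longrightarrow> cosh z \<noteq> 0"
  using norm_cosh_sinh_ge(1)[of z] by force

lemma holomorphic_sech_fun: "sech_fun holomorphic_on {z. Re z \<noteq> 0}" "sech_square_fun holomorphic_on {z. Re z \<noteq> 0}"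
  unfolding sech_fun_def[abs_def] sech_square_fun_def[abs_def]
  using cosh_nonzero_off_axis unfolding cosh_def by (auto intro!: holomorphic_intros)

lemma open_off_axis: "open {z. Re z \<noteq> 0}"
  by (intro open_Collect_neq continuous_intros)

lemma higher_deriv_odd_sech:
  assumes "Re t > 0"
  shows "(deriv ^^ b) (\<lambda>t. odd_sech t k) t = of_int (odd_freq k) ^ b * (deriv ^^ b) sech_fun (of_int (odd_freq k) * t)"
proof -
  have "(deriv ^^ b) (\<lambda>t. sech_fun (of_int (odd_freq k) * t)) t = of_int (odd_freq k) ^ b * (deriv ^^ b) sech_fun (of_int (odd_freq k) * t)"
    by (rule higher_deriv_compose_linear[OF holomorphic_sech_fun(1) open_right_half_plane[of 0] open_off_axis])
       (use assms odd_freq_nonzero in auto)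
  thus ?thesis by (simp add: sech_fun_def odd_sech_def[abs_def] odd_freq_def)
qed

lemma higher_deriv_odd_tanh_rem:
  assumes "Re t > 0"
  shows "(deriv ^^ (b + 1)) (\<lambda>t. odd_tanh_rem t k) t =
     of_int (odd_freq k) ^ (b + 1) * (deriv ^^ b) sech_square_fun (of_int (odd_freq k) * t)"
proof -
  let ?\<omega> = "of_int (odd_freq k) :: complex"
  have hol: "(\<lambda>t. sech_square_fun (?\<omega> * t)) holomorphic_on {t. 0 < Re t}"
  proof -
    have "(sech_square_fun \<circ> (\<lambda>t. ?\<omega> * t)) holomorphic_on {t. 0 < Re t}"
      by (rule holomorphic_on_compose_gen[OF _ holomorphic_sech_fun(2)]) (use odd_freq_nonzero in \<open>auto intro!: holomorphic_intros\<close>)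
    thus ?thesis by (simp add: o_def)
  qed
  have "(deriv ^^ b) (deriv (\<lambda>t. odd_tanh_rem t k)) t = (deriv ^^ b) (\<lambda>t. ?\<omega> * sech_square_fun (?\<omega> * t)) t"
  proof (rule higher_deriv_cong_ev)
    have "\<forall>\<^sub>F x in nhds t. x \<in> {t. 0 < Re t}"
      using assms open_right_half_plane[of 0] by (intro eventually_nhds_in_open) auto
    thus "\<forall>\<^sub>F x in nhds t. deriv (\<lambda>t. odd_tanh_rem t k) x = ?\<omega> * sech_square_fun (?\<omega> * x)"
    proof eventually_elim
      case (elim x)
      thus ?case using DERIV_imp_deriv[OF odd_tanh_rem_deriv[of x k]]
        by (simp add: sech_square_fun_def odd_sech_def odd_freq_def power_divide)
    qed
  qed simp
  also have "\<dots> = ?\<omega> * (deriv ^^ b) (\<lambda>t. sech_square_fun (?\<omega> * t)) t"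
    by (rule higher_deriv_cmult[OF hol _ open_right_half_plane]) (use assms in auto)
  also have "(deriv ^^ b) (\<lambda>t. sech_square_fun (?\<omega> * t)) t = ?\<omega> ^ b * (deriv ^^ b) sech_square_fun (?\<omega> * t)"
    by (rule higher_deriv_compose_linear[OF holomorphic_sech_fun(2) open_right_half_plane[of 0] open_off_axis])
       (use assms odd_freq_nonzero in auto)
  finally show ?thesis by (simp add: funpow_swap1)
qed

lemma odd_freq_half_pi: "of_int (odd_freq (int k)) * half_pi = cos_zero k"
  by (simp add: odd_freq_def cos_zero_def field_simps)

lemma odd_freq_reflect: "odd_freq (- 1 - k) = - odd_freq k"
  by (simp add: odd_freq_def)

lemma half_pi_in_right_half_plane: "Re half_pi > 0" by simp

lemma higher_deriv_eventually_cong: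
  assumes "\<And>t. 0 < Re t \<Longrightarrow> f t = g t" "0 < Re t"
  shows "(deriv ^^ b) f t = (deriv ^^ b) g t"
proof (rule higher_deriv_cong_ev)
  have "\<forall>\<^sub>F x in nhds t. x \<in> {t. 0 < Re t}"
    using assms open_right_half_plane[of 0] by (intro eventually_nhds_in_open) auto
  thus "\<forall>\<^sub>F x in nhds t. f x = g x" by eventually_elim (use assms in auto)
qed simp

text \<open>Each derivative in \<open>t\<close> brings out a frequency \<open>\<omega>\<close>, and
  at \<open>t = \<pi>/2\<close> the points \<open>\<omega> t\<close> with positive
  \<open>\<omega>\<close> are the zeros \<open>cos_zero k\<close>. For odd \<open>n\<close> the sign
  change of \<open>\<omega>^n\<close> under reflection offsets that of the alternating sign, so the
  one-sided sum is half of the two-sided one.\<close>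

lemma alt_sech_sums:
  assumes n: "odd n"
  shows "(\<lambda>k. (-1) ^ k * cos_zero k ^ (n + b) * (deriv ^^ b) sech_fun (cos_zero k)) sums
     (of_real (pi / 2) ^ (n + b) * (fact n / (2 * \<i> ^ (n + 1))) * (deriv ^^ b) (\<lambda>t. fps_nth (sech_fps t) n) half_pi)"
proof -
  let ?F = "\<lambda>t. \<Sum>\<^sub>\<infinity>k. (\<i> * alt_sign k) * (\<i> * of_int (odd_freq k)) ^ n * odd_sech t k"
  let ?f = "\<lambda>k. (\<i> * alt_sign k) * (\<i> * of_int (odd_freq k)) ^ n * (deriv ^^ b) (\<lambda>t. odd_sech t k) half_pi"
  have "(?f has_sum (deriv ^^ b) ?F half_pi) UNIV"
    by (rule odd_sech_half_plane_series(2)) (use norm_alt_sign in auto)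
  moreover have "(deriv ^^ b) ?F half_pi = fact n * (deriv ^^ b) (\<lambda>t. fps_nth (sech_fps t) n) half_pi"
  proof -
    have "(deriv ^^ b) ?F half_pi = (deriv ^^ b) (\<lambda>t. fact n * fps_nth (sech_fps t) n) half_pi"
      by (rule higher_deriv_eventually_cong) (use sech_fps_nth_eq in auto)
    also have "\<dots> = fact n * (deriv ^^ b) (\<lambda>t. fps_nth (sech_fps t) n) half_pi"
      by (rule higher_deriv_cmult[OF holomorphic_onI_deriv[OF sech_fps_nth_deriv] _ open_right_half_plane]) auto
    finally show ?thesis .
  qed
  ultimately have "(?f has_sum fact n * (deriv ^^ b) (\<lambda>t. fps_nth (sech_fps t) n) half_pi) UNIV" by simp
  moreover have "?f (- 1 - k) = ?f k" for k
  proof -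
    have "(\<lambda>t. odd_sech t (- 1 - k)) = (\<lambda>t. odd_sech t k)" using odd_sech_reflect by blast
    moreover have "alt_sign (- 1 - k) = - alt_sign k" by (simp add: alt_sign_def)
    moreover have "(\<i> * of_int (- odd_freq k)) ^ n = - ((\<i> * complex_of_int (odd_freq k)) ^ n)"
      using n by (simp add: power_minus_odd)
    ultimately show ?thesis by (simp only: odd_freq_reflect) simp
  qed
  ultimately have "(\<lambda>k. ?f (int k)) sums (fact n * (deriv ^^ b) (\<lambda>t. fps_nth (sech_fps t) n) half_pi / 2)"
    by (rule has_sum_int_symmetric_partial_sums)
  from sums_mult[OF this, of "of_real (pi / 2) ^ (n + b) / \<i> ^ (n + 1)"]
  have "(\<lambda>k. of_real (pi / 2) ^ (n + b) / \<i> ^ (n + 1) * ?f (int k)) sums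
     (of_real (pi / 2) ^ (n + b) * (fact n / (2 * \<i> ^ (n + 1))) * (deriv ^^ b) (\<lambda>t. fps_nth (sech_fps t) n) half_pi)"
    by (simp add: field_simps)
  moreover have "of_real (pi / 2) ^ (n + b) / \<i> ^ (n + 1) * ?f (int k) =
      (-1) ^ k * cos_zero k ^ (n + b) * (deriv ^^ b) sech_fun (cos_zero k)" for k
  proof -
    have c: "cos_zero k ^ j = of_real (pi / 2) ^ j * of_int (odd_freq (int k)) ^ j" for j
      unfolding odd_freq_half_pi[symmetric] by (simp only: power_mult_distrib mult.commute)
    have cancel: "P / x * (x * o' * D) = P * o' * D" if "x \<noteq> 0" for P x o' D :: complex
      using that by simp
    have f: "?f (int k) = \<i> ^ (n + 1) * of_int (odd_freq (int k)) ^ (n + b) * ((-1) ^ k * (deriv ^^ b) sech_fun (cos_zero k))"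
      unfolding higher_deriv_odd_sech[OF half_pi_in_right_half_plane] odd_freq_half_pi
      by (simp add: power_mult_distrib power_add alt_sign_def minus_one_power_iff)
    show ?thesis unfolding c f by (subst cancel) (simp_all only: mult_ac power_not_zero complex_i_not_zero not_False_eq_True)
  qed
  ultimately show ?thesis by simp
qed

text \<open>The first derivative in \<open>t\<close> turns the tanh remainder into
  \<open>\<omega> sech^2 (\<omega> t)\<close>; hence \<open>b + 1\<close> derivatives lead to the
  \<open>b\<close>-th derivative of the squared sech, with one more power of the zero.\<close>

lemma sech_square_sums:
  assumes n: "odd n"
  shows "(\<lambda>k. cos_zero k ^ (n + b + 1) * (deriv ^^ b) sech_square_fun (cos_zero k)) sums
     (of_real (pi / 2) ^ (n + b + 1) * (fact n / (2 * \<i> ^ (n + 1))) * (deriv ^^ (b + 1)) (\<lambda>t. fps_nth (tanh_rem_fps t) n) half_pi)"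
proof -
  let ?F = "\<lambda>t. \<Sum>\<^sub>\<infinity>k. \<i> * (\<i> * of_int (odd_freq k)) ^ n * odd_tanh_rem t k"
  let ?f = "\<lambda>k. \<i> * (\<i> * of_int (odd_freq k)) ^ n * (deriv ^^ (b + 1)) (\<lambda>t. odd_tanh_rem t k) half_pi"
  have "(?f has_sum (deriv ^^ (b + 1)) ?F half_pi) UNIV"
    by (rule odd_tanh_rem_half_plane_series(2)) auto
  moreover have "(deriv ^^ (b + 1)) ?F half_pi = fact n * (deriv ^^ (b + 1)) (\<lambda>t. fps_nth (tanh_rem_fps t) n) half_pi"
  proof -
    have "(\<lambda>t. ?F t / fact n) holomorphic_on {t. 0 < Re t}"
      by (intro holomorphic_intros odd_tanh_rem_half_plane_series(1)) auto
    hence hol: "(\<lambda>t. fps_nth (tanh_rem_fps t) n) holomorphic_on {t. 0 < Re t}"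
      by (rule holomorphic_transform) (simp add: tanh_rem_fps_nth_eq[symmetric])
    have "(deriv ^^ (b + 1)) ?F half_pi = (deriv ^^ (b + 1)) (\<lambda>t. fact n * fps_nth (tanh_rem_fps t) n) half_pi"
      by (rule higher_deriv_eventually_cong) (use tanh_rem_fps_nth_eq in auto)
    also have "\<dots> = fact n * (deriv ^^ (b + 1)) (\<lambda>t. fps_nth (tanh_rem_fps t) n) half_pi"
      by (rule higher_deriv_cmult[OF hol _ open_right_half_plane]) auto
    finally show ?thesis .
  qed
  ultimately have "(?f has_sum fact n * (deriv ^^ (b + 1)) (\<lambda>t. fps_nth (tanh_rem_fps t) n) half_pi) UNIV" by (simp only:)
  moreover have "?f (- 1 - k) = ?f k" for k
  proof -
    have "(deriv ^^ (b + 1)) (\<lambda>t. odd_tanh_rem t (- 1 - k)) half_pi = (deriv ^^ (b + 1)) (\<lambda>t. - odd_tanh_rem t k) half_pi"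
      using odd_tanh_rem_reflect by simp
    also have "\<dots> = - (deriv ^^ (b + 1)) (\<lambda>t. odd_tanh_rem t k) half_pi"
      by (rule higher_deriv_uminus[OF holomorphic_onI_deriv[OF odd_tanh_rem_deriv] open_right_half_plane]) auto
    finally have "(deriv ^^ (b + 1)) (\<lambda>t. odd_tanh_rem t (- 1 - k)) half_pi = - (deriv ^^ (b + 1)) (\<lambda>t. odd_tanh_rem t k) half_pi" .
    moreover have "(\<i> * of_int (- odd_freq k)) ^ n = - ((\<i> * complex_of_int (odd_freq k)) ^ n)"
      using n by (simp add: power_minus_odd)
    ultimately show ?thesis by (simp only: odd_freq_reflect) simp
  qed
  ultimately have "(\<lambda>k. ?f (int k)) sums (fact n * (deriv ^^ (b + 1)) (\<lambda>t. fps_nth (tanh_rem_fps t) n) half_pi / 2)"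
    by (rule has_sum_int_symmetric_partial_sums)
  from sums_mult[OF this, of "of_real (pi / 2) ^ (n + b + 1) / \<i> ^ (n + 1)"]
  have "(\<lambda>k. of_real (pi / 2) ^ (n + b + 1) / \<i> ^ (n + 1) * ?f (int k)) sums
     (of_real (pi / 2) ^ (n + b + 1) * (fact n / (2 * \<i> ^ (n + 1))) * (deriv ^^ (b + 1)) (\<lambda>t. fps_nth (tanh_rem_fps t) n) half_pi)"
    by (simp add: field_simps del: funpow.simps)
  moreover have "of_real (pi / 2) ^ (n + b + 1) / \<i> ^ (n + 1) * ?f (int k) =
      cos_zero k ^ (n + b + 1) * (deriv ^^ b) sech_square_fun (cos_zero k)" for k
  proof -
    have c: "cos_zero k ^ j = of_real (pi / 2) ^ j * of_int (odd_freq (int k)) ^ j" for j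
      unfolding odd_freq_half_pi[symmetric] by (simp only: power_mult_distrib mult.commute)
    have cancel: "P / x * (x * o' * D) = P * o' * D" if "x \<noteq> 0" for P x o' D :: complex
      using that by simp
    have f: "?f (int k) = \<i> ^ (n + 1) * of_int (odd_freq (int k)) ^ (n + b + 1) * (deriv ^^ b) sech_square_fun (cos_zero k)"
      unfolding higher_deriv_odd_tanh_rem[OF half_pi_in_right_half_plane] odd_freq_half_pi
      by (simp add: power_mult_distrib power_add)
    show ?thesis unfolding c f by (subst cancel) (simp_all only: power_not_zero complex_i_not_zero not_False_eq_True)
  qed
  ultimately show ?thesis by simp
qed

lemma energy_half_pi: "sech_square_sum half_pi = of_real (1 / pi)"
proof -
  interpret right_half_plane half_pi by standard simp
  have "((\<lambda>n. odd_sech half_pi n ^ 2) has_sum sech_square_sum half_pi) UNIV" by (rule sech_square_has_sum)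
  hence "(\<lambda>k. odd_sech half_pi (int k) ^ 2) sums (sech_square_sum half_pi / 2)"
    by (rule has_sum_int_symmetric_partial_sums) (simp add: odd_sech_reflect)
  moreover have "odd_sech half_pi (int k) ^ 2 = 1 / cosh (cos_zero k) ^ 2" for k
    unfolding odd_freq_half_pi[symmetric] odd_sech_def odd_freq_def by (simp add: power_divide)
  ultimately have "(\<lambda>N. \<Sum>k<N. 1 / cosh (cos_zero k) ^ 2) \<longlonglongrightarrow> sech_square_sum half_pi / 2"
    by (simp add: sums_def)
  hence "sech_square_sum half_pi / 2 = 1 / (2 * pi)" using sech_square_sum_tendsto LIMSEQ_unique by blast
  thus ?thesis by (simp add: field_simps)
qed

lemma modulus_half_pi: "sech_modulus half_pi = 0"
proof -
  have "(\<lambda>k. (-1) ^ k * cos_zero k ^ (3 + 0) * (deriv ^^ 0) sech_fun (cos_zero k)) sums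
     (of_real (pi / 2) ^ (3 + 0) * (fact 3 / (2 * \<i> ^ (3 + 1))) * (deriv ^^ 0) (\<lambda>t. fps_nth (sech_fps t) 3) half_pi)"
    by (rule alt_sech_sums) simp
  moreover have "(\<lambda>k. (-1) ^ k * cos_zero k ^ (3 + 0) * (deriv ^^ 0) sech_fun (cos_zero k)) sums 0"
    using alt_cube_sech_sum_tendsto by (simp add: sums_def sech_fun_def mult.assoc)
  ultimately have "of_real (pi / 2) ^ (3 + 0) * (fact 3 / (2 * \<i> ^ (3 + 1))) * (deriv ^^ 0) (\<lambda>t. fps_nth (sech_fps t) 3) half_pi = 0"
    using sums_unique2 by blast
  hence "fps_nth (sech_fps half_pi) 3 = 0" by simp
  thus ?thesis by (simp add: sech_modulus_def)
qed

text \<open>The slope is a nonzero multiple of the integral for \<open>m = 1\<close> and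
  \<open>p = 0\<close>, and that integral is positive.\<close>

lemma slope_half_pi_nonzero: "sech_slope half_pi \<noteq> 0"
proof
  assume 0: "sech_slope half_pi = 0"
  have "(\<lambda>k. (-1) ^ k * cos_zero k ^ (1 + 0) * (deriv ^^ 0) sech_fun (cos_zero k)) sums
     (of_real (pi / 2) ^ (1 + 0) * (fact 1 / (2 * \<i> ^ (1 + 1))) * (deriv ^^ 0) (\<lambda>t. fps_nth (sech_fps t) 1) half_pi)"
    by (rule alt_sech_sums) simp
  hence "(\<lambda>k. (-1) ^ k * (cos_zero k / cosh (cos_zero k))) sums 0"
    using 0 unfolding sech_slope_def by (simp add: sech_fun_def)
  hence "(\<lambda>N. - (\<Sum>k<N. (-1) ^ k * (cos_zero k / cosh (cos_zero k)))) \<longlonglongrightarrow> - 0"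
    unfolding sums_def by (rule tendsto_minus)
  moreover define f where "f = (\<lambda>x::real. x ^ (4 * 0 + 1) / (cos x + cosh x) ^ 1)"
  have "(\<lambda>N. - (\<Sum>k<N. (-1) ^ k * (cos_zero k / cosh (cos_zero k)))) \<longlonglongrightarrow>
     of_real (- ((-1) ^ 0) * 2 ^ 1 / (2 ^ (2 * 0 + 1) * pi) * integral {0..} f)"
    using sec_operator_sum_tendsto_integral[of 1 0] unfolding f_def by (simp add: sum_negf)
  ultimately have "of_real (- ((-1) ^ 0) * 2 ^ 1 / (2 ^ (2 * 0 + 1) * pi) * integral {0..} f) = - (0 :: complex)"
    using LIMSEQ_unique by blast
  hence I: "integral {0..} f = 0" by simp
  have int: "f integrable_on {0..}" unfolding f_def by (rule integrand_integrable(1)) simp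
  have nonneg: "f x \<ge> 0" if "x \<ge> 0" for x using cos_plus_cosh_ge(2)[OF that] that by (simp add: f_def)
  have int12: "f integrable_on {1..2}" by (rule integrable_on_subinterval[OF int]) auto
  have "integral {1..2::real} (\<lambda>_. 1 / (1 + cosh 2)) \<le> integral {1..2} f"
  proof (rule integral_le[OF _ int12])
    fix x :: real assume x: "x \<in> {1..2}"
    have "cosh x \<le> cosh 2" using x by (simp add: cosh_real_nonneg_le_iff)
    hence "cos x + cosh x \<le> 1 + cosh 2" by (intro add_mono) auto
    thus "1 / (1 + cosh 2) \<le> f x" using x cos_plus_cosh_ge(2)[of x] unfolding f_def by (auto intro!: frac_le)
  qed (rule integrable_const_ivl)
  also have "\<dots> \<le> integral {0..} f" by (rule integral_subset_le[OF _ int12 int]) (use nonneg in auto)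
  finally have "1 / (1 + cosh 2) \<le> (0::real)" using I by simp
  moreover have "1 / (1 + cosh 2) > (0::real)" by (simp add: add_pos_pos)
  ultimately show False by simp
qed

lemma half_pi_regular: "half_pi \<in> regular_domain"
  using slope_half_pi_nonzero by (simp add: regular_domain_def)

subsection \<open>The lemniscate constant\<close>

text \<open>Substitution of \<open>g^4\<close> in the Beta integral: along
  \<open>g' = - c sqrt (1 - g^4)\<close> the integral up to \<open>g^4\<close> decreases at the
  constant rate \<open>4 c\<close>. The Beta integrand is singular at both ends, so derivatives are
  used in the interior and continuity at the ends.\<close>

lemma lemniscate_quarter_period:
  fixes g :: "real \<Rightarrow> real"
  assumes a: "a > 0" and cont: "continuous_on {0..a} g" and ends: "g 0 = 1" "g a = 0"
    and range: "\<And>x. 0 < x \<Longrightarrow> x < a \<Longrightarrow> 0 < g x \<and> g x < 1"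
    and deriv: "\<And>x. 0 < x \<Longrightarrow> x < a \<Longrightarrow> (g has_real_derivative - c * sqrt (1 - g x ^ 4)) (at x)"
  shows "Beta (1 / 4) (1 / 2) = 4 * c * a"
proof -
  define b where "b = (\<lambda>t::real. t powr (1 / 4 - 1) * (1 - t) powr (1 / 2 - 1))"
  have int: "(b has_integral Beta (1 / 4) (1 / 2)) {0..1}"
    unfolding b_def by (rule has_integral_Beta_real) auto
  define B where "B = (\<lambda>u. integral {0..u} b)"
  have contB: "continuous_on {0..1} B"
    unfolding B_def by (rule indefinite_integral_continuous_1) (use int in blast)
  have derivB: "(B has_real_derivative b u) (at u)" if u: "0 < u" "u < 1" for u
  proof -
    have "continuous (at u) b"
      unfolding b_def using u by (intro continuous_intros) auto
    hence "continuous (at u within {0..1} - {}) b" by (rule continuous_at_imp_continuous_at_within)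
    hence "(B has_vector_derivative b u) (at u within ({0..1} - {}))"
      unfolding B_def using int u by (intro integral_has_vector_derivative_continuous_at) auto
    moreover have "at u within {0..1} = at u" by (rule at_within_interior) (use u in simp)
    ultimately show ?thesis unfolding has_real_derivative_iff_has_vector_derivative by simp
  qed
  define H where "H = (\<lambda>x. B (g x ^ 4) + 4 * c * x)"
  have bounds: "0 \<le> g x \<and> g x \<le> 1" if "x \<in> {0..a}" for x
    using range[of x] ends that by (cases "x = 0"; cases "x = a") auto
  have "H a = H 0"
  proof (rule DERIV_isconst_end[of 0 a H])
    have "continuous_on {0..a} (\<lambda>x. B (g x ^ 4))"
      by (rule continuous_on_compose2[OF contB]) (use bounds cont in \<open>auto intro!: continuous_intros power_le_one\<close>)
    thus "continuous_on {0..a} H" unfolding H_def by (intro continuous_intros)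
    fix x assume x: "0 < x" "x < a"
    define G where "G = g x"
    have G: "0 < G" "G < 1" using range[OF x] by (auto simp: G_def)
    have G4: "0 < G ^ 4" "G ^ 4 < 1" using G by (auto simp: power_less_one_iff)
    have "((\<lambda>x. B (g x ^ 4)) has_real_derivative b (G ^ 4) * (4 * G ^ 3 * (- c * sqrt (1 - G ^ 4)))) (at x)"
      unfolding G_def
      by (rule DERIV_chain2[OF derivB]) (use G4 x in \<open>auto simp: G_def intro!: derivative_eq_intros deriv\<close>)
    moreover have "b (G ^ 4) * (4 * G ^ 3 * (- c * sqrt (1 - G ^ 4))) = - 4 * c"
    proof -
      have e1: "(G ^ 4) powr (1 / 4 - 1) = inverse (G ^ 3)"
      proof -
        have p: "G powr 4 = G ^ 4" "G powr 3 = G ^ 3" using G by simp_all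
        have "(G powr 4) powr (1 / 4 - 1) = G powr (- 3)" unfolding powr_powr by simp
        also have "\<dots> = inverse (G powr 3)" by (rule powr_minus)
        finally show ?thesis unfolding p .
      qed
      have e2: "(1 - G ^ 4) powr (1 / 2 - 1) = inverse (sqrt (1 - G ^ 4))"
        using G4 by (simp add: powr_minus powr_half_sqrt)
      have "inverse A * inverse S * (4 * A * (- c * S)) = - 4 * c" if "A \<noteq> 0" "S \<noteq> 0" for A S
        using that by (simp add: field_simps)
      moreover have "G ^ 3 \<noteq> 0" "sqrt (1 - G ^ 4) \<noteq> 0" using G G4 by simp_all
      ultimately show ?thesis unfolding b_def e1 e2 by blast
    qed
    ultimately have "((\<lambda>x. B (g x ^ 4)) has_real_derivative - 4 * c) (at x)" by (simp only:)
    thus "(H has_real_derivative 0) (at x)"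
      unfolding H_def by (auto intro!: derivative_eq_intros)
  qed (use a in auto)
  thus ?thesis using ends integral_unique[OF int] by (simp add: H_def B_def)
qed

text \<open>The reflection formula \<open>Gamma (1/4) Gamma (3/4) = \<pi> sqrt 2\<close> eliminates
  \<open>Gamma (3/4)\<close>; squaring removes this root and that of
  \<open>Gamma (1/2) = sqrt \<pi>\<close>.\<close>

lemma Beta_quarter_half: "Beta (1 / 4) (1 / 2 :: real) ^ 2 = Gamma (1 / 4) ^ 4 / (2 * pi)"
proof -
  have "Gamma (complex_of_real (1 / 4)) * Gamma (complex_of_real (3 / 4)) = of_real pi / sin (of_real (pi / 4))"
    using Gamma_reflection_complex[of "1 / 4"] by simp
  hence "complex_of_real (Gamma (1 / 4) * Gamma (3 / 4)) = of_real (pi / sin (pi / 4))"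
    unfolding Gamma_complex_of_real sin_of_real by simp
  hence r: "Gamma (1 / 4) * Gamma (3 / 4) = pi / sin (pi / 4)" unfolding of_real_eq_iff .
  have "(Gamma (1 / 4) * Gamma (3 / 4)) ^ 2 = 2 * pi ^ 2"
    unfolding r by (simp add: sin_45 power_divide)
  hence r2: "Gamma (1 / 4) ^ 2 * Gamma (3 / 4) ^ 2 = 2 * pi ^ 2" by (simp add: power_mult_distrib)
  hence "Gamma (3 / 4 :: real) \<noteq> 0" "Gamma (1 / 4 :: real) \<noteq> 0" by auto
  hence q: "1 / Gamma (3 / 4) ^ 2 = Gamma (1 / 4) ^ 2 / (2 * pi ^ 2)"
    using r2 by (simp add: field_simps)
  have "Beta (1 / 4) (1 / 2 :: real) ^ 2 = Gamma (1 / 4) ^ 2 * pi * (1 / Gamma (3 / 4) ^ 2)"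
    by (simp add: Beta_def Gamma_one_half_real power_mult_distrib power_divide)
  also have "\<dots> = Gamma (1 / 4) ^ 4 / (2 * pi)"
    unfolding q by (simp add: field_simps power2_eq_square eval_nat_numeral)
  finally show ?thesis .
qed

text \<open>By \<open>y'' = - 2 y^3\<close> and \<open>y'(0) = 0\<close> this is
  \<open>c cl(c v)\<close>, with cl the lemniscate cosine and \<open>c\<close> the value at
  0.\<close>

definition lemniscate_cos :: "real \<Rightarrow> real" where
  "lemniscate_cos v = Re (sech_series half_pi (of_real v))"

definition lemniscate_cos' :: "real \<Rightarrow> real" where
  "lemniscate_cos' v = Re (deriv (sech_series half_pi) (of_real v))"

lemma sech_series_half_pi_even: "sech_series half_pi (- v) = sech_series half_pi v" if v: "\<bar>Im v\<bar> < pi / 2"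
proof -
  interpret right_half_plane half_pi by standard simp
  let ?f = "\<lambda>v n. odd_sech half_pi n * exp (\<i> * of_int (odd_freq n) * v)"
  have hs: "(?f v has_sum sech_series half_pi v) UNIV" if "\<bar>Im v\<bar> < pi / 2" for v
    unfolding sech_series_def by (rule fourier_has_sum[OF exp_decay_sech abs_le_freq(1)]) (use that in simp)
  have bij: "bij (\<lambda>n::int. -1 - n)" by (rule bij_betw_byWitness[where f' = "\<lambda>n. -1 - n"]) auto
  have "((\<lambda>n. ?f (- v) (-1 - n)) has_sum sech_series half_pi (- v)) UNIV"
    by (rule iffD2[OF has_sum_reindex_bij_betw[OF bij, of "?f (- v)"] hs]) (use v in simp)
  moreover have "?f (- v) (-1 - n) = ?f v n" for n
    by (simp add: odd_sech_reflect odd_freq_reflect)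
  ultimately have "(?f v has_sum sech_series half_pi (- v)) UNIV" by (simp only:)
  thus ?thesis using hs[OF v] by (rule has_sum_unique)
qed

lemma sech_series_half_pi_real: "sech_series half_pi (of_real v) = of_real (lemniscate_cos v)"
proof -
  interpret right_half_plane half_pi by standard simp
  let ?f = "\<lambda>v n. odd_sech half_pi n * exp (\<i> * of_int (odd_freq n) * v)"
  have hs: "(?f (of_real v) has_sum sech_series half_pi (of_real v)) UNIV" for v
    unfolding sech_series_def by (rule fourier_has_sum[OF exp_decay_sech abs_le_freq(1)]) simp
  have "((\<lambda>n. cnj (?f (of_real v) n)) has_sum cnj (sech_series half_pi (of_real v))) UNIV"
    using hs by (simp only: has_sum_cnj_iff)
  moreover have "cnj (?f (of_real v) n) = ?f (of_real (- v)) n" for n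
  proof -
    have "odd_sech half_pi n = of_real (1 / cosh (real_of_int (2 * n + 1) * (pi / 2)))"
      unfolding odd_sech_def of_real_divide cosh_complex_of_real[symmetric] by simp
    hence "cnj (odd_sech half_pi n) = odd_sech half_pi n" by (simp only: complex_cnj_complex_of_real)
    thus ?thesis by (simp add: exp_cnj)
  qed
  ultimately have "((\<lambda>n. ?f (of_real (- v)) n) has_sum cnj (sech_series half_pi (of_real v))) UNIV" by (simp only:)
  hence "cnj (sech_series half_pi (of_real v)) = sech_series half_pi (of_real (- v))"
    using hs[of "- v"] has_sum_unique by blast
  also have "\<dots> = sech_series half_pi (of_real v)" using sech_series_half_pi_even[of "of_real v"] by simp
  finally show ?thesis unfolding lemniscate_cos_def by (metis Reals_cnj_iff of_real_Re)
qed

lemma sech_series_half_pi_derivs: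
  assumes "\<bar>Im v\<bar> < pi / 2"
  shows "(sech_series half_pi has_field_derivative deriv (sech_series half_pi) v) (at v)"
    and "(deriv (sech_series half_pi) has_field_derivative - 2 * sech_series half_pi v ^ 3) (at v)"
proof -
  interpret right_half_plane half_pi by standard simp
  have hol: "sech_series half_pi holomorphic_on {v. \<bar>Im v\<bar> < pi / 2}"
    unfolding sech_series_def using fourier_holomorphic(1)[OF exp_decay_sech abs_le_freq(1)] by simp
  show "(sech_series half_pi has_field_derivative deriv (sech_series half_pi) v) (at v)"
    by (rule holomorphic_derivI[OF hol open_strip]) (use assms in simp)
  have "(deriv (sech_series half_pi) has_field_derivative deriv (deriv (sech_series half_pi)) v) (at v)"
    by (rule holomorphic_derivI[OF holomorphic_deriv[OF hol open_strip] open_strip]) (use assms in simp)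
  moreover have "deriv (deriv (sech_series half_pi)) v = - 2 * sech_series half_pi v ^ 3"
    using sech_fps_ODE(2)[OF half_pi_regular, of v, unfolded modulus_half_pi] assms by (simp add: numeral_2_eq_2)
  ultimately show "(deriv (sech_series half_pi) has_field_derivative - 2 * sech_series half_pi v ^ 3) (at v)" by simp
qed

lemma Re_of_real_has_derivative:
  assumes "(f has_field_derivative f') (at (of_real v))"
  shows "((\<lambda>v. Re (f (of_real v))) has_real_derivative Re f') (at v)"
    and "((\<lambda>v. Im (f (of_real v))) has_real_derivative Im f') (at v)"
proof -
  have *: "((\<lambda>v. f (of_real v)) has_vector_derivative f') (at v)"
    using has_vector_derivative_real_field[OF assms] .
  show "((\<lambda>v. Re (f (of_real v))) has_real_derivative Re f') (at v)"
    "((\<lambda>v. Im (f (of_real v))) has_real_derivative Im f') (at v)"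
    using bounded_linear.has_vector_derivative[OF bounded_linear_Re *]
      bounded_linear.has_vector_derivative[OF bounded_linear_Im *]
    by (simp_all add: has_real_derivative_iff_has_vector_derivative)
qed

lemma lemniscate_cos_deriv:
  "(lemniscate_cos has_real_derivative lemniscate_cos' v) (at v)"
  "(lemniscate_cos' has_real_derivative - 2 * lemniscate_cos v ^ 3) (at v)"
proof -
  show "(lemniscate_cos has_real_derivative lemniscate_cos' v) (at v)"
    unfolding lemniscate_cos_def[abs_def] lemniscate_cos'_def
    by (rule Re_of_real_has_derivative(1)[OF sech_series_half_pi_derivs(1)]) simp
  have "(lemniscate_cos' has_real_derivative Re (- 2 * sech_series half_pi (of_real v) ^ 3)) (at v)"
    unfolding lemniscate_cos'_def[abs_def]
    by (rule Re_of_real_has_derivative(1)[OF sech_series_half_pi_derivs(2)]) simp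
  thus "(lemniscate_cos' has_real_derivative - 2 * lemniscate_cos v ^ 3) (at v)"
    unfolding sech_series_half_pi_real by (simp add: of_real_power[symmetric] del: of_real_power)
qed

lemma deriv_sech_series_half_pi_real: "deriv (sech_series half_pi) (of_real v) = of_real (lemniscate_cos' v)"
proof -
  have "((\<lambda>v. Im (sech_series half_pi (of_real v))) has_real_derivative Im (deriv (sech_series half_pi) (of_real v))) (at v)"
    by (rule Re_of_real_has_derivative(2)[OF sech_series_half_pi_derivs(1)]) simp
  hence "((\<lambda>v. 0) has_real_derivative Im (deriv (sech_series half_pi) (of_real v))) (at v)"
    unfolding sech_series_half_pi_real by simp
  hence "Im (deriv (sech_series half_pi) (of_real v)) = 0" using DERIV_unique DERIV_const by blast
  thus ?thesis by (simp add: complex_eq_iff lemniscate_cos'_def)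
qed

lemma lemniscate_cos_zero: "lemniscate_cos (pi / 2) = 0"
proof -
  interpret right_half_plane half_pi by standard simp
  show ?thesis using sech_fps_nth_0 unfolding sech_fps_def lemniscate_cos_def
    by (simp add: fps_expansion_def)
qed

lemma sech_slope_half_pi: "sech_slope half_pi = of_real (lemniscate_cos' (pi / 2))"
  unfolding sech_slope_def sech_fps_def using deriv_sech_series_half_pi_real[of "pi / 2"]
  by (simp add: fps_expansion_def)

text \<open>The product identity holds on the whole real line, so a zero of \<open>C\<close> at
  \<open>v\<close> would force \<open>L sin (v - \<pi>/2) = 0\<close>. Hence \<open>\<pi>/2\<close>
  is the first positive zero, that is, the quarter period.\<close>

lemma lemniscate_cos_nonzero: "lemniscate_cos v \<noteq> 0" if "0 \<le> v" "v < pi / 2"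
proof
  assume 0: "lemniscate_cos v = 0"
  interpret right_half_plane half_pi by standard simp
  define w where "w = v - pi / 2"
  have w: "of_real v = half_pi + of_real w" by (simp add: w_def)
  have "sech_series half_pi (of_real v) * (1 - sin (of_real w) * tanh_rem_series half_pi (of_real w)) = sech_slope half_pi * sin (of_real w)"
    unfolding w sech_slope_def by (rule sech_series_mult_tanh_rem_slope) simp
  hence "sech_slope half_pi * of_real (sin w) = 0" unfolding sech_series_half_pi_real 0 sin_of_real by simp
  hence "sin w = 0" using slope_half_pi_nonzero by simp
  moreover have "sin (- w) > 0" by (rule sin_gt_zero) (use that in \<open>auto simp: w_def\<close>)
  ultimately show False by simp
qed

lemma lemniscate_cos'_0: "lemniscate_cos' 0 = 0"
proof -
  have d: "((\<lambda>v. lemniscate_cos (- v)) has_real_derivative lemniscate_cos' (- 0) * - 1) (at 0)"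
    by (rule DERIV_chain2[OF lemniscate_cos_deriv(1)]) (auto intro!: derivative_eq_intros)
  have e: "(\<lambda>v. lemniscate_cos (- v)) = lemniscate_cos"
    using sech_series_half_pi_even by (auto simp: lemniscate_cos_def)
  show ?thesis using DERIV_unique[OF d[unfolded e] lemniscate_cos_deriv(1)[of 0]] by simp
qed

text \<open>The first integral of \<open>y'' = - 2 y^3\<close>, evaluated at 0, where the derivative
  vanishes.\<close>

lemma lemniscate_energy: "lemniscate_cos' v ^ 2 + lemniscate_cos v ^ 4 = lemniscate_cos 0 ^ 4"
proof -
  have "\<forall>x. ((\<lambda>v. lemniscate_cos' v ^ 2 + lemniscate_cos v ^ 4) has_real_derivative 0) (at x)"
  proof
    fix x
    show "((\<lambda>v. lemniscate_cos' v ^ 2 + lemniscate_cos v ^ 4) has_real_derivative 0) (at x)"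
      by (rule derivative_eq_intros lemniscate_cos_deriv refl)+ (simp add: power2_eq_square eval_nat_numeral)
  qed
  from DERIV_isconst_all[OF this, of v 0] show ?thesis by (simp add: lemniscate_cos'_0)
qed

text \<open>After division by \<open>c\<close> the energy law reads
  \<open>g'^2 = c^2 (1 - g^4)\<close>. The root to take is negative, since
  \<open>g'' = - 2 c^2 g^3 < 0\<close> makes \<open>g'\<close> decrease from 0. The sign of
  \<open>c\<close> is left open, hence the absolute value.\<close>

lemma lemniscate_period: "Beta (1 / 4) (1 / 2) = 2 * pi * \<bar>lemniscate_cos 0\<bar>"
proof -
  define c where "c = lemniscate_cos 0"
  have c: "c \<noteq> 0" unfolding c_def by (rule lemniscate_cos_nonzero) auto
  define g where "g = (\<lambda>v. lemniscate_cos v / c)"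
  define g' where "g' = (\<lambda>v. lemniscate_cos' v / c)"
  have gd: "(g has_real_derivative g' v) (at v)" for v
    unfolding g_def g'_def by (intro DERIV_cdivide lemniscate_cos_deriv)
  have gd2: "(g' has_real_derivative - 2 * c ^ 2 * g v ^ 3) (at v)" for v
  proof -
    have "(g' has_real_derivative (- 2 * lemniscate_cos v ^ 3) / c) (at v)"
      unfolding g'_def by (intro DERIV_cdivide lemniscate_cos_deriv)
    moreover have "(- 2 * lemniscate_cos v ^ 3) / c = - 2 * c ^ 2 * g v ^ 3"
      using c by (simp add: g_def field_simps eval_nat_numeral)
    ultimately show ?thesis by simp
  qed
  have contg: "continuous_on A g" for A
    using gd by (meson DERIV_isCont continuous_at_imp_continuous_on)
  have g0: "g 0 = 1" and g1: "g (pi / 2) = 0" and g'0: "g' 0 = 0"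
    using c by (auto simp: g_def g'_def c_def[symmetric] lemniscate_cos_zero lemniscate_cos'_0)
  have pos: "g v > 0" if v: "0 \<le> v" "v < pi / 2" for v
  proof (rule ccontr)
    assume "\<not> g v > 0"
    hence "\<exists>x\<ge>0. x \<le> v \<and> g x = 0" using v g0 contg by (intro IVT2') auto
    thus False using lemniscate_cos_nonzero c v by (auto simp: g_def)
  qed
  have neg: "g' v < 0" if v: "0 < v" "v < pi / 2" for v
  proof -
    have "g' v < g' 0"
    proof (rule DERIV_neg_imp_decreasing_open[OF v(1)])
      fix x assume x: "0 < x" "x < v"
      have "c ^ 2 * g x ^ 3 > 0" using pos[of x] x v c by simp
      thus "\<exists>y. (g' has_real_derivative y) (at x) \<and> y < 0"
        using gd2[of x] by (intro exI[of _ "- 2 * c ^ 2 * g x ^ 3"]) auto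
    next
      show "continuous_on {0..v} g'" using gd2 by (meson DERIV_isCont continuous_at_imp_continuous_on)
    qed
    thus ?thesis by (simp add: g'0)
  qed
  have lt1: "g v < 1" if v: "0 < v" "v < pi / 2" for v
  proof -
    have "g v < g 0"
      by (rule DERIV_neg_imp_decreasing_open[OF v(1)]) (use gd neg v contg in force)+
    thus ?thesis by (simp add: g0)
  qed
  have "Beta (1 / 4) (1 / 2) = 4 * \<bar>c\<bar> * (pi / 2)"
  proof (rule lemniscate_quarter_period[OF _ contg g0 g1])
    fix x assume x: "0 < x" "x < pi / 2"
    show "0 < g x \<and> g x < 1" using pos[of x] lt1[of x] x by auto
    have "(\<bar>c\<bar> * sqrt (1 - g x ^ 4)) ^ 2 = (- g' x) ^ 2"
    proof -
      have "g x ^ 4 \<le> 1" using pos[of x] lt1[of x] x by (intro power_le_one) auto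
      hence "(\<bar>c\<bar> * sqrt (1 - g x ^ 4)) ^ 2 = c ^ 2 * (1 - g x ^ 4)" by (simp add: power_mult_distrib)
      also have "\<dots> = (c ^ 4 - lemniscate_cos x ^ 4) / c ^ 2"
        using c by (simp add: g_def field_simps eval_nat_numeral)
      also have "c ^ 4 - lemniscate_cos x ^ 4 = lemniscate_cos' x ^ 2"
        using lemniscate_energy[of x] by (simp add: c_def)
      finally show ?thesis by (simp add: g'_def power_divide)
    qed
    moreover have "- g' x \<ge> 0" using neg[OF x] by simp
    moreover have "\<bar>c\<bar> * sqrt (1 - g x ^ 4) \<ge> 0"
      using power_le_one[of "g x" 4] pos[of x] lt1[of x] x by simp
    ultimately have "\<bar>c\<bar> * sqrt (1 - g x ^ 4) = - g' x" using power2_eq_imp_eq by blast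
    thus "(g has_real_derivative - \<bar>c\<bar> * sqrt (1 - g x ^ 4)) (at x)" using gd[of x] by simp
  qed simp
  thus ?thesis by (simp add: c_def)
qed

text \<open>At the zero \<open>\<pi>/2\<close> the energy law gives \<open>L^2 = c^4\<close>, and
  the period gives \<open>c^2\<close>. The factor \<open>\<sigma>\<close> is 1 or -1; leaving the
  sign open is harmless, as it only enters rational coefficients.\<close>

lemma sech_slope_half_pi_Gamma:
  obtains \<sigma> :: rat where "sech_slope half_pi = of_real (of_rat \<sigma> * (Gamma (1 / 4) ^ 4 / (8 * pi ^ 3)))"
proof -
  have "(2 * pi * \<bar>lemniscate_cos 0\<bar>) ^ 2 = Gamma (1 / 4) ^ 4 / (2 * pi)"
    using Beta_quarter_half unfolding lemniscate_period .
  hence c2: "lemniscate_cos 0 ^ 2 = Gamma (1 / 4) ^ 4 / (8 * pi ^ 3)"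
    by (simp add: power_mult_distrib field_simps eval_nat_numeral)
  have "lemniscate_cos' (pi / 2) ^ 2 = (lemniscate_cos 0 ^ 2) ^ 2"
    using lemniscate_energy[of "pi / 2"] by (simp add: lemniscate_cos_zero)
  hence "lemniscate_cos' (pi / 2) = lemniscate_cos 0 ^ 2 \<or> lemniscate_cos' (pi / 2) = - (lemniscate_cos 0 ^ 2)"
    by (simp only: power2_eq_iff)
  thus ?thesis using that[of 1] that[of "-1"] unfolding sech_slope_half_pi c2 by auto
qed

subsection \<open>Evaluation of the integral\<close>

lemma of_real_of_rat: "of_real (of_rat r) = (of_rat r :: 'a :: real_field)"
  by (cases r) (simp add: of_rat_rat)

lemma of_rat_inverse_of_nat: "of_rat (1 / of_nat n) = 1 / of_nat n"
  by (simp only: of_rat_divide of_rat_1 of_rat_of_nat_eq)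

text \<open>The elements are real but are embedded in the complex numbers, where the residue sums
  live; \<open>E\<close> carries the restrictions on the exponents through all linear steps.\<close>

definition monomial_span :: "real \<Rightarrow> real \<Rightarrow> (nat \<times> nat) set \<Rightarrow> complex set" where
  "monomial_span x y E =
     {of_real (\<Sum>(\<alpha>, \<beta>)\<in>S. of_rat (c \<alpha> \<beta>) * x ^ \<alpha> * y ^ \<beta>) | S (c :: nat \<Rightarrow> nat \<Rightarrow> rat). finite S \<and> S \<subseteq> E}"

lemma monomial_span_base: "(\<alpha>, \<beta>) \<in> E \<Longrightarrow> of_rat r * of_real (x ^ \<alpha> * y ^ \<beta>) \<in> monomial_span x y E"
  unfolding monomial_span_def
  by (rule CollectI, rule exI[of _ "{(\<alpha>, \<beta>)}"], rule exI[of _ "\<lambda>_ _. r"]) (simp add: of_real_of_rat)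

lemma monomial_span_zero: "0 \<in> monomial_span x y E"
  unfolding monomial_span_def by (rule CollectI, rule exI[of _ "{}"]) simp

lemma monomial_span_add:
  assumes "u \<in> monomial_span x y E" "v \<in> monomial_span x y E"
  shows "u + v \<in> monomial_span x y E"
proof -
  obtain S c T d where u: "finite S" "S \<subseteq> E" "u = of_real (\<Sum>(\<alpha>, \<beta>)\<in>S. of_rat (c \<alpha> \<beta>) * x ^ \<alpha> * y ^ \<beta>)"
    and v: "finite T" "T \<subseteq> E" "v = of_real (\<Sum>(\<alpha>, \<beta>)\<in>T. of_rat (d \<alpha> \<beta>) * x ^ \<alpha> * y ^ \<beta>)"
    using assms unfolding monomial_span_def by blast
  define c' where "c' = (\<lambda>\<alpha> \<beta>. if (\<alpha>, \<beta>) \<in> S then c \<alpha> \<beta> else 0)"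
  define d' where "d' = (\<lambda>\<alpha> \<beta>. if (\<alpha>, \<beta>) \<in> T then d \<alpha> \<beta> else 0)"
  have "(\<Sum>(\<alpha>, \<beta>)\<in>S. of_rat (c \<alpha> \<beta>) * x ^ \<alpha> * y ^ \<beta>) = (\<Sum>(\<alpha>, \<beta>)\<in>S \<union> T. of_rat (c' \<alpha> \<beta>) * x ^ \<alpha> * y ^ \<beta>)"
    by (rule sum.mono_neutral_cong_left) (use u v in \<open>auto simp: c'_def\<close>)
  moreover have "(\<Sum>(\<alpha>, \<beta>)\<in>T. of_rat (d \<alpha> \<beta>) * x ^ \<alpha> * y ^ \<beta>) = (\<Sum>(\<alpha>, \<beta>)\<in>S \<union> T. of_rat (d' \<alpha> \<beta>) * x ^ \<alpha> * y ^ \<beta>)"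
    by (rule sum.mono_neutral_cong_left) (use u v in \<open>auto simp: d'_def\<close>)
  ultimately have "u + v = of_real (\<Sum>(\<alpha>, \<beta>)\<in>S \<union> T. of_rat (c' \<alpha> \<beta> + d' \<alpha> \<beta>) * x ^ \<alpha> * y ^ \<beta>)"
    unfolding u v of_real_add[symmetric]
    by (simp add: sum.distrib[symmetric] case_prod_beta of_rat_add distrib_right)
  thus ?thesis unfolding monomial_span_def
    using u v by (intro CollectI exI[of _ "S \<union> T"] exI[of _ "\<lambda>\<alpha> \<beta>. c' \<alpha> \<beta> + d' \<alpha> \<beta>"]) auto
qed

lemma monomial_span_scale:
  assumes "u \<in> monomial_span x y E"
  shows "of_rat r * u \<in> monomial_span x y E"
proof -
  obtain S c where u: "finite S" "S \<subseteq> E" "u = of_real (\<Sum>(\<alpha>, \<beta>)\<in>S. of_rat (c \<alpha> \<beta>) * x ^ \<alpha> * y ^ \<beta>)"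
    using assms unfolding monomial_span_def by blast
  have "of_rat r * u = of_real (of_rat r * (\<Sum>(\<alpha>, \<beta>)\<in>S. of_rat (c \<alpha> \<beta>) * x ^ \<alpha> * y ^ \<beta>))"
    unfolding u by (simp add: of_real_of_rat)
  also have "of_rat r * (\<Sum>(\<alpha>, \<beta>)\<in>S. of_rat (c \<alpha> \<beta>) * x ^ \<alpha> * y ^ \<beta>) = (\<Sum>(\<alpha>, \<beta>)\<in>S. of_rat (r * c \<alpha> \<beta>) * x ^ \<alpha> * y ^ \<beta>)"
    unfolding sum_distrib_left by (intro sum.cong) (auto simp: of_rat_mult)
  finally show ?thesis unfolding monomial_span_def
    using u by (intro CollectI exI[of _ S] exI[of _ "\<lambda>\<alpha> \<beta>. r * c \<alpha> \<beta>"]) auto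
qed

lemma rspan_monomial_span:
  assumes "F \<in> rspan_on U B" "x0 \<in> U" "\<And>b. b \<in> B \<Longrightarrow> u * b x0 \<in> monomial_span x y E"
  shows "u * F x0 \<in> monomial_span x y E"
proof -
  obtain f where f: "f \<in> rspan B" "F x0 = f x0" using assms by (auto simp: rspan_on_def)
  have "u * f x0 \<in> monomial_span x y E" using f(1)
  proof (induction f rule: rspan.induct)
    case (rspan_step b f r)
    have "of_rat r * (u * b x0) + u * f x0 \<in> monomial_span x y E"
      by (intro monomial_span_add monomial_span_scale assms rspan_step)
    thus ?case by (simp add: algebra_simps)
  qed (simp add: monomial_span_zero)
  thus ?thesis by (simp add: f)
qed

text \<open>The terms that the Leibniz rule produces from the \<open>k\<close>-th derivative of
  \<open>z^q \<phi>\<close>; \<open>i\<close> counts the derivatives that fall on the power. The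
  parity of \<open>k\<close> is recorded because it makes the Taylor index that is met later
  odd.\<close>

definition jets :: "(complex \<Rightarrow> complex) \<Rightarrow> nat \<Rightarrow> bool \<Rightarrow> nat \<Rightarrow> (complex \<Rightarrow> complex) set" where
  "jets \<phi> q par K = {\<lambda>z. z ^ (q - i) * (deriv ^^ (k - i)) \<phi> z | i k. i \<le> k \<and> i \<le> q \<and> k \<le> K \<and> even k = par}"

lemma jetsI: "i \<le> k \<Longrightarrow> i \<le> q \<Longrightarrow> k \<le> K \<Longrightarrow> even k = par \<Longrightarrow> (\<lambda>z. z ^ (q - i) * (deriv ^^ (k - i)) \<phi> z) \<in> jets \<phi> q par K"
  unfolding jets_def by blast

lemma jets_deriv:
  assumes \<phi>: "\<phi> holomorphic_on U" and U: "open U" and b: "b \<in> jets \<phi> q par K"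
  shows "x \<in> U \<Longrightarrow> b field_differentiable at x" and "deriv b \<in> rspan_on U (jets \<phi> q (\<not> par) (K + 1))"
proof -
  obtain i k where ik: "b = (\<lambda>z. z ^ (q - i) * (deriv ^^ (k - i)) \<phi> z)" "i \<le> k" "i \<le> q" "k \<le> K" "even k = par"
    using b unfolding jets_def by blast
  have d: "(b has_field_derivative of_nat (q - i) * (z ^ (q - Suc i) * (deriv ^^ (k - i)) \<phi> z) + z ^ (q - i) * (deriv ^^ (Suc k - i)) \<phi> z) (at z)"
    if z: "z \<in> U" for z
  proof -
    have "((deriv ^^ (k - i)) \<phi> has_field_derivative (deriv ^^ (Suc k - i)) \<phi> z) (at z)"
      using holomorphic_derivI[OF holomorphic_higher_deriv[OF \<phi> U] U z] ik by (simp add: Suc_diff_le)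
    thus ?thesis unfolding ik(1) by (auto intro!: derivative_eq_intros simp: mult_ac)
  qed
  show "x \<in> U \<Longrightarrow> b field_differentiable at x" using d field_differentiable_def by blast
  have "(\<lambda>z. of_nat (q - i) * (z ^ (q - Suc i) * (deriv ^^ (k - i)) \<phi> z)) \<in> rspan_on U (jets \<phi> q (\<not> par) (K + 1))"
  proof (cases "i = q")
    case True
    thus ?thesis by (intro rspan_on_cong[OF rspan_on_zero]) simp
  next
    case False
    have "(\<lambda>z. z ^ (q - Suc i) * (deriv ^^ (Suc k - Suc i)) \<phi> z) \<in> jets \<phi> q (\<not> par) (K + 1)"
      by (rule jetsI) (use ik False in auto)
    thus ?thesis unfolding diff_Suc_Suc by (intro rspan_on_scale_of_nat rspan_on_base)
  qed
  moreover have "(\<lambda>z. z ^ (q - i) * (deriv ^^ (Suc k - i)) \<phi> z) \<in> rspan_on U (jets \<phi> q (\<not> par) (K + 1))"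
    by (rule rspan_on_base, rule jetsI) (use ik in auto)
  ultimately show "deriv b \<in> rspan_on U (jets \<phi> q (\<not> par) (K + 1))"
    using rspan_on_cong[OF rspan_on_add, of _ U _ _ "deriv b"] d[THEN DERIV_imp_deriv] by fastforce
qed

lemma jets_mono: "F \<in> rspan_on U (jets \<phi> q par K) \<Longrightarrow> K \<le> K' \<Longrightarrow> F \<in> rspan_on U (jets \<phi> q par K')"
  by (erule rspan_on_subset) (use jetsI in \<open>fastforce simp: jets_def[of _ _ _ K]\<close>)

lemma rspan_on_jets_deriv:
  assumes \<phi>: "\<phi> holomorphic_on U" and U: "open U" and F: "F \<in> rspan_on U (jets \<phi> q par K)"
  shows "deriv F \<in> rspan_on U (jets \<phi> q (\<not> par) (K + 1))"
  by (rule rspan_on_deriv[OF U F jets_deriv[OF \<phi> U]])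

lemma rspan_on_jets_deriv2:
  assumes \<phi>: "\<phi> holomorphic_on U" and U: "open U" and F: "F \<in> rspan_on U (jets \<phi> q par K)"
  shows "deriv (deriv F) \<in> rspan_on U (jets \<phi> q par (K + 2))"
  using rspan_on_jets_deriv[OF \<phi> U rspan_on_jets_deriv[OF \<phi> U F]] by simp

text \<open>\<open>sec_operator m\<close> is a rational combination of derivatives whose orders are
  at most \<open>m - 1\<close> and have the parity of \<open>m - 1\<close>; each reduction by two
  adds two derivatives.\<close>

lemma sec_operator_jets:
  assumes \<phi>: "\<phi> holomorphic_on U" and U: "open U"
  shows "m \<ge> 1 \<Longrightarrow> F \<in> rspan_on U (jets \<phi> q par K) \<Longrightarrow>
    sec_operator m F \<in> rspan_on U (jets \<phi> q (par = odd m) (K + (m - 1)))"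
proof (induction m F arbitrary: K rule: sec_operator.induct)
  case (3 F)
  show ?case using rspan_on_jets_deriv[OF \<phi> U 3(2)] by simp
next
  case (4 m F)
  let ?r = "1 / of_nat (Suc m * (Suc m + 1)) :: rat"
  let ?G = "\<lambda>z. (deriv (deriv F) z + of_nat (Suc m ^ 2) * F z) / of_nat (Suc m * (Suc m + 1))"
  have "(\<lambda>z. of_rat ?r * (deriv (deriv F) z + of_nat (Suc m ^ 2) * F z)) \<in> rspan_on U (jets \<phi> q par (K + 2))"
    by (intro rspan_on_scale rspan_on_add rspan_on_scale_of_nat rspan_on_jets_deriv2[OF \<phi> U 4(3)] jets_mono[OF 4(3)]) simp
  hence "?G \<in> rspan_on U (jets \<phi> q par (K + 2))"
    by (rule rspan_on_cong) (simp only: of_rat_inverse_of_nat times_divide_eq_left mult_1_left)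
  from 4(1)[OF _ this] show ?case by simp
qed auto

lemma sech_power_deriv2:
  fixes z :: complex
  assumes "cosh z \<noteq> 0"
  shows "deriv (deriv (\<lambda>z. 1 / cosh z ^ m)) z =
    of_nat (m ^ 2) / cosh z ^ m - of_nat (m * (m + 1)) / cosh z ^ (m + 2)"
proof -
  let ?V = "{z :: complex. cosh z \<noteq> 0}"
  have V: "open ?V" by (intro open_Collect_neq continuous_intros)
  have 1: "((\<lambda>z. 1 / cosh z ^ m) has_field_derivative - (of_nat m * sinh z / cosh z ^ (m + 1))) (at z)"
    if "cosh z \<noteq> 0" for z :: complex and m
  proof -
    have "((\<lambda>z. 1 / cosh z ^ m) has_field_derivative - (of_nat m * (sinh z * cosh z ^ (m - 1))) / (cosh z ^ m * cosh z ^ m)) (at z)"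
      by (rule derivative_eq_intros refl)+ (use that in simp_all)
    moreover have "- (of_nat m * (sinh z * cosh z ^ (m - 1))) / (cosh z ^ m * cosh z ^ m) = - (of_nat m * sinh z / cosh z ^ (m + 1))"
      using that by (cases m) (simp_all add: field_simps)
    ultimately show ?thesis by simp
  qed
  have "deriv (deriv (\<lambda>z. 1 / cosh z ^ m)) z = deriv (\<lambda>z. - of_nat m * (sinh z * (1 / cosh z ^ (m + 1)))) z"
  proof (rule deriv_cong_ev[OF _ refl])
    have "\<forall>\<^sub>F z in nhds z. z \<in> ?V" using assms V by (intro eventually_nhds_in_open) auto
    thus "\<forall>\<^sub>F z in nhds z. deriv (\<lambda>z. 1 / cosh z ^ m) z = - of_nat m * (sinh z * (1 / cosh z ^ (m + 1)))"
      by eventually_elim (simp add: DERIV_imp_deriv[OF 1])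
  qed
  also have "\<dots> = - of_nat m * (sinh z * - (of_nat (m + 1) * sinh z / cosh z ^ (m + 1 + 1)) + cosh z * (1 / cosh z ^ (m + 1)))"
    by (rule DERIV_imp_deriv, rule DERIV_cmult, rule DERIV_mult'[OF _ 1[OF assms]]) (auto intro!: derivative_eq_intros)
  also have "\<dots> = of_nat (m * (m + 1)) * sinh z ^ 2 / cosh z ^ (m + 2) - of_nat m / cosh z ^ m"
    using assms by (simp add: field_simps power2_eq_square)
  also have "sinh z ^ 2 = cosh z ^ 2 - 1" using hyperbolic_pythagoras[of z] by (simp add: algebra_simps)
  also have "of_nat (m * (m + 1)) * (cosh z ^ 2 - 1) / cosh z ^ (m + 2) - of_nat m / cosh z ^ m =
      of_nat (m ^ 2) / cosh z ^ m - of_nat (m * (m + 1)) / cosh z ^ (m + 2)"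
    using assms by (simp add: field_simps power2_eq_square power_add)
  finally show ?thesis .
qed

lemma sech_power_jets_step:
  fixes F :: "complex \<Rightarrow> complex" and m :: nat
  defines "U \<equiv> {z :: complex. Re z \<noteq> 0}"
  assumes \<phi>: "\<phi> holomorphic_on U" and m: "m \<ge> 1" and F: "(\<lambda>z. 1 / cosh z ^ m) \<in> rspan_on U (jets \<phi> 0 True K)"
  shows "(\<lambda>z. 1 / cosh z ^ (m + 2)) \<in> rspan_on U (jets \<phi> 0 True (K + 2))"
proof -
  have U: "open U" unfolding U_def by (rule open_off_axis)
  let ?F = "\<lambda>z. 1 / cosh z ^ m :: complex"
  let ?r = "1 / of_nat (m * (m + 1)) :: rat"
  have *: "(\<lambda>z. of_rat ?r * (of_nat (m ^ 2) * ?F z + - deriv (deriv ?F) z)) \<in> rspan_on U (jets \<phi> 0 True (K + 2))"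
    by (intro rspan_on_scale rspan_on_add rspan_on_scale_of_nat rspan_on_uminus rspan_on_jets_deriv2[OF \<phi> U F] jets_mono[OF F]) simp
  show ?thesis
  proof (rule rspan_on_cong[OF *])
    fix z assume "z \<in> U"
    hence nz: "cosh z \<noteq> 0" using cosh_nonzero_off_axis by (simp add: U_def)
    define N where "N = (of_nat (m * (m + 1)) :: complex)"
    have "N \<noteq> 0" unfolding N_def of_nat_eq_0_iff using m by simp
    moreover have "of_rat ?r = 1 / N" unfolding N_def by (rule of_rat_inverse_of_nat)
    ultimately show "1 / cosh z ^ (m + 2) = of_rat ?r * (of_nat (m ^ 2) * ?F z + - deriv (deriv ?F) z)"
      unfolding sech_power_deriv2[OF nz] N_def[symmetric] by simp
  qed
qed

lemma jets_0_mult_power: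
  assumes "F \<in> rspan_on U (jets \<phi> 0 par K)"
  shows "(\<lambda>z. z ^ q * F z) \<in> rspan_on U (jets \<phi> q par K)"
proof (rule rspan_on_linear_image[OF assms, where L = "\<lambda>F z. z ^ q * F z"])
  fix b assume "b \<in> jets \<phi> 0 par K"
  then obtain k where "b = (deriv ^^ k) \<phi>" "k \<le> K" "even k = par" unfolding jets_def by auto
  thus "(\<lambda>z. z ^ q * b z) \<in> rspan_on U (jets \<phi> q par K)"
    using jetsI[of 0 k q K par \<phi>] by (intro rspan_on_base) simp
qed (auto simp: algebra_simps)

text \<open>Solved for the highest power, the formula for the second derivative of
  \<open>1 / cosh z ^ m\<close> expresses the power \<open>m + 2\<close> through the power
  \<open>m\<close> and its second derivative. So every power of sech is an even-order differential
  operator applied to sech or to its square.\<close>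

lemma sech_power_jets:
  "odd m \<Longrightarrow> (\<lambda>z. 1 / cosh z ^ m) \<in> rspan_on {z. Re z \<noteq> 0} (jets sech_fun 0 True (m - 1))"
  "even m \<Longrightarrow> m \<ge> 1 \<Longrightarrow> (\<lambda>z. 1 / cosh z ^ m) \<in> rspan_on {z. Re z \<noteq> 0} (jets sech_square_fun 0 True (m - 2))"
proof -
  have "(\<lambda>z. 1 / cosh z ^ (2 * j + 1)) \<in> rspan_on {z. Re z \<noteq> 0} (jets sech_fun 0 True (2 * j))" for j
  proof (induction j)
    case 0
    have "sech_fun \<in> jets sech_fun 0 True (2 * 0)" using jetsI[of 0 0 0 0 True sech_fun] by simp
    from rspan_on_base[OF this] show ?case by (rule rspan_on_cong) (simp add: sech_fun_def)
  next
    case (Suc j)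
    show ?case using sech_power_jets_step[OF holomorphic_sech_fun(1) _ Suc] by simp
  qed
  thus "odd m \<Longrightarrow> (\<lambda>z. 1 / cosh z ^ m) \<in> rspan_on {z. Re z \<noteq> 0} (jets sech_fun 0 True (m - 1))"
    by (auto elim!: oddE)
  have "(\<lambda>z. 1 / cosh z ^ (2 * j + 2)) \<in> rspan_on {z. Re z \<noteq> 0} (jets sech_square_fun 0 True (2 * j))" for j
  proof (induction j)
    case 0
    have "sech_square_fun \<in> jets sech_square_fun 0 True (2 * 0)" using jetsI[of 0 0 0 0 True sech_square_fun] by simp
    from rspan_on_base[OF this] show ?case by (rule rspan_on_cong) (simp add: sech_square_fun_def power2_eq_square)
  next
    case (Suc j)
    show ?case using sech_power_jets_step[OF holomorphic_sech_fun(2) _ Suc] by simp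
  qed
  moreover assume "even m" "m \<ge> 1"
  hence "m = 2 * (m div 2 - 1) + 2" by presburger
  then obtain j where "m = 2 * j + 2" by blast
  ultimately show "(\<lambda>z. 1 / cosh z ^ m) \<in> rspan_on {z. Re z \<noteq> 0} (jets sech_square_fun 0 True (m - 2))"
    by (simp only: diff_add_inverse2)
qed

lemma sums_rspan_on:
  assumes F: "F \<in> rspan_on U B" and pts: "\<And>k. z k \<in> U"
    and base: "\<And>b. b \<in> B \<Longrightarrow> \<exists>L. (\<lambda>k. s k * b (z k)) sums L \<and> u * L \<in> monomial_span x y E"
  shows "\<exists>L. (\<lambda>k. s k * F (z k)) sums L \<and> u * L \<in> monomial_span x y E"
proof -
  obtain f where f: "f \<in> rspan B" "\<And>x. x \<in> U \<Longrightarrow> F x = f x" using F by (auto simp: rspan_on_def)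
  have "\<exists>L. (\<lambda>k. s k * f (z k)) sums L \<and> u * L \<in> monomial_span x y E" using f(1)
  proof (induction f rule: rspan.induct)
    case rspan_zero
    show ?case by (intro exI[of _ 0]) (simp add: monomial_span_zero)
  next
    case (rspan_step b f r)
    obtain L where L: "(\<lambda>k. s k * f (z k)) sums L" "u * L \<in> monomial_span x y E" using rspan_step(3) by blast
    obtain M where M: "(\<lambda>k. s k * b (z k)) sums M" "u * M \<in> monomial_span x y E" using base[OF rspan_step(1)] by blast
    have "(\<lambda>k. of_rat r * (s k * b (z k)) + s k * f (z k)) sums (of_rat r * M + L)"
      by (intro sums_add sums_mult L M)
    moreover have "of_rat r * (u * M) + u * L \<in> monomial_span x y E"
      by (intro monomial_span_add monomial_span_scale L M)
    ultimately show ?case by (intro exI[of _ "of_rat r * M + L"]) (simp add: algebra_simps)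
  qed
  thus ?thesis using f(2)[OF pts] by simp
qed

definition integral_exponents :: "nat \<Rightarrow> nat \<Rightarrow> (nat \<times> nat) set" where
  "integral_exponents m p = {(\<alpha>, \<beta>). even \<alpha> = even m \<and>
     2 * int p - int m + 2 \<le> int \<alpha> \<and> int \<alpha> \<le> 2 * int p + int m \<and>
     2 * int p - int m + 2 \<le> int \<beta> \<and> int \<beta> \<le> 2 * int p + 3 * int m - 2}"

text \<open>At \<open>t = \<pi>/2\<close> only monomials without \<open>K\<close> survive; each is a
  rational multiple of \<open>X^i Y^(3 i + l)\<close>, and the prefactor \<open>pi ^ N\<close>
  lowers the exponent of \<open>Y\<close> by \<open>N\<close>.\<close>

lemma quasi_forms_half_pi:
  assumes F: "F \<in> rspan_on regular_domain (quasi_forms w par d)"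
    and E: "\<And>i l. i + l = w \<Longrightarrow> even i = par \<Longrightarrow> l \<le> d \<Longrightarrow> \<exists>\<beta>. 3 * i + l = \<beta> + N \<and> (i, \<beta>) \<in> E"
  shows "of_real (pi ^ N) * F half_pi \<in> monomial_span (Gamma (1 / 4) ^ 4) (inverse pi) E"
proof (rule rspan_monomial_span[OF F half_pi_regular])
  let ?X = "Gamma (1 / 4) ^ 4 :: real"
  fix b assume "b \<in> quasi_forms w par d"
  then obtain i j l where b: "b = sme_monomial i j l" "i + j + l = w" "even i = par" "l \<le> d"
    unfolding quasi_forms_def by blast
  show "of_real (pi ^ N) * b half_pi \<in> monomial_span ?X (inverse pi) E"
  proof (cases "j = 0")
    case False
    hence "b half_pi = 0" unfolding b sme_monomial_def modulus_half_pi by simp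
    thus ?thesis by (simp only: mult_zero_right monomial_span_zero)
  next
    case True
    then obtain \<beta> where \<beta>: "3 * i + l = \<beta> + N" "(i, \<beta>) \<in> E" using E b by auto
    obtain \<sigma> where \<sigma>: "sech_slope half_pi = of_real (of_rat \<sigma> * (?X / (8 * pi ^ 3)))"
      using sech_slope_half_pi_Gamma by blast
    have "of_real (pi ^ N) * b half_pi = of_real (pi ^ N * (of_rat \<sigma> * (?X / (8 * pi ^ 3))) ^ i * (1 / pi) ^ l)"
      unfolding b sme_monomial_def \<sigma> True energy_half_pi
      by (simp only: of_real_mult of_real_power power_0 mult_1_right mult.assoc)
    also have "pi ^ N * (of_rat \<sigma> * (?X / (8 * pi ^ 3))) ^ i * (1 / pi) ^ l =
        of_rat (\<sigma> ^ i / 8 ^ i) * (?X ^ i * (pi ^ N / pi ^ (3 * i + l)))"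
      by (simp add: power_mult_distrib power_divide power_mult[symmetric] power_add of_rat_divide of_rat_power mult_ac)
    also have "pi ^ N / pi ^ (3 * i + l) = inverse pi ^ \<beta>"
      unfolding \<beta> by (simp add: power_add power_inverse field_simps)
    also have "complex_of_real (of_rat (\<sigma> ^ i / 8 ^ i) * (?X ^ i * inverse pi ^ \<beta>)) =
        of_rat (\<sigma> ^ i / 8 ^ i) * of_real (?X ^ i * inverse pi ^ \<beta>)"
      by (simp only: of_real_mult of_real_of_rat)
    also have "\<dots> \<in> monomial_span ?X (inverse pi) E" by (rule monomial_span_base[OF \<beta>(2)])
    finally show ?thesis .
  qed
qed

lemma i_power_odd: "odd n \<Longrightarrow> \<i> ^ (n + 1) = (-1) ^ ((n + 1) div 2)"
  by (metis even_add odd_one power2_i power_mult even_two_times_div_two)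

lemma pi_half_power_mult:
  assumes "odd n"
  shows "of_real pi * (of_real (pi / 2) ^ k * (fact n / (2 * \<i> ^ (n + 1))) * V) =
    of_rat (fact n / (2 ^ (k + 1) * (-1) ^ ((n + 1) div 2))) * (of_real (pi ^ (k + 1)) * V)"
proof -
  have "of_rat (fact n / (2 ^ (k + 1) * (-1) ^ ((n + 1) div 2))) = fact n / (2 ^ (k + 1) * (-1 :: complex) ^ ((n + 1) div 2))"
    using of_rat_of_nat_eq[of "fact n", where ?'a = complex]
    by (simp add: of_rat_divide of_rat_mult of_rat_power of_rat_minus)
  thus ?thesis unfolding i_power_odd[OF assms] by (simp add: power_divide field_simps)
qed

lemma jet_sum_odd:
  assumes m: "odd m" and p: "p \<ge> m div 2" and b: "b \<in> jets sech_fun (4 * p + 1) True (2 * m - 2)"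
  shows "\<exists>L. (\<lambda>k. - ((-1) ^ k) * b (cos_zero k)) sums L \<and>
    of_real pi * L \<in> monomial_span (Gamma (1 / 4) ^ 4) (inverse pi) (integral_exponents m p)"
proof -
  obtain i k where ik: "b = (\<lambda>z. z ^ (4 * p + 1 - i) * (deriv ^^ (k - i)) sech_fun z)" "i \<le> k" "i \<le> 4 * p + 1" "k \<le> 2 * m - 2" "even k"
    using b unfolding jets_def by auto
  define n where "n = 4 * p + 1 - k"
  \<comment> \<open>Here the lower bound on \<open>p\<close> enters: it keeps the Taylor index
    \<open>n\<close> at least 1.\<close>
  have k: "k \<le> 4 * p" using ik p m by presburger
  have n: "odd n" "4 * p + 1 - i = n + (k - i)" using ik k by (auto simp: n_def)
  let ?V = "(deriv ^^ (k - i)) (\<lambda>t. fps_nth (sech_fps t) n) half_pi"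
  let ?L = "of_real (pi / 2) ^ (n + (k - i)) * (fact n / (2 * \<i> ^ (n + 1))) * ?V"
  have "(\<lambda>j. - ((-1) ^ j * cos_zero j ^ (n + (k - i)) * (deriv ^^ (k - i)) sech_fun (cos_zero j))) sums - ?L"
    by (rule sums_minus[OF alt_sech_sums[OF n(1)]])
  hence s: "(\<lambda>j. - ((-1) ^ j) * b (cos_zero j)) sums - ?L" unfolding ik(1) n(2) by (simp add: mult.assoc)
  have V: "of_real (pi ^ (n + (k - i) + 1)) * ?V \<in> monomial_span (Gamma (1 / 4) ^ 4) (inverse pi) (integral_exponents m p)"
  proof (rule quasi_forms_half_pi[OF sech_fps_nth_higher_deriv_forms[OF n(1)]])
    fix \<alpha> l assume \<alpha>: "\<alpha> + l = (n + 1) div 2 + (k - i)" "even \<alpha> = False" "l \<le> k - i"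
    define t where "t = k - i - l"
    obtain h where h: "k = 2 * h" using ik(5) by blast
    have nh: "(n + 1) div 2 = 2 * p + 1 - h" "h \<le> 2 * p" using k h by (auto simp: n_def)
    have \<alpha>t: "\<alpha> = 2 * p + 1 - h + t" "t \<le> 2 * h" "h + 1 \<le> m" using \<alpha> nh ik h odd_pos[OF m] by (auto simp: t_def)
    have "3 * \<alpha> + l = (\<alpha> + t) + (n + (k - i) + 1)" using \<alpha> n(1) by (auto simp: t_def elim!: oddE)
    moreover have "(\<alpha>, \<alpha> + t) \<in> integral_exponents m p"
      unfolding integral_exponents_def using \<alpha>(2) m \<alpha>t nh(2) by (auto simp: of_nat_diff)
    ultimately show "\<exists>\<beta>. 3 * \<alpha> + l = \<beta> + (n + (k - i) + 1) \<and> (\<alpha>, \<beta>) \<in> integral_exponents m p" by blast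
  qed
  have "of_real pi * - ?L = of_rat (- 1) * (of_rat (fact n / (2 ^ (n + (k - i) + 1) * (-1) ^ ((n + 1) div 2))) * (of_real (pi ^ (n + (k - i) + 1)) * ?V))"
    unfolding pi_half_power_mult[OF n(1), symmetric] by (simp add: of_rat_minus)
  also have "\<dots> \<in> monomial_span (Gamma (1 / 4) ^ 4) (inverse pi) (integral_exponents m p)"
    by (intro monomial_span_scale V)
  finally show ?thesis using s by blast
qed

lemma jet_sum_even:
  assumes m: "even m" "m \<ge> 1" and p: "p \<ge> m div 2" and b: "b \<in> jets sech_square_fun (4 * p + 1) False (2 * m - 3)"
  shows "\<exists>L. (\<lambda>k. 1 * b (cos_zero k)) sums L \<and>
    of_real pi * L \<in> monomial_span (Gamma (1 / 4) ^ 4) (inverse pi) (integral_exponents m p)"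
proof -
  obtain i k where ik: "b = (\<lambda>z. z ^ (4 * p + 1 - i) * (deriv ^^ (k - i)) sech_square_fun z)" "i \<le> k" "i \<le> 4 * p + 1" "k \<le> 2 * m - 3" "odd k"
    using b unfolding jets_def by auto
  \<comment> \<open>One derivative in \<open>t\<close> is spent on passing from tanh to the squared
    sech, so the index is one less than for odd \<open>m\<close>.\<close>
  define n where "n = 4 * p - k"
  define c where "c = k - i + 1"
  have k: "k + 3 \<le> 4 * p" using ik p m by presburger
  have n: "odd n" "4 * p + 1 - i = n + (k - i) + 1" using ik k by (auto simp: n_def)
  let ?V = "(deriv ^^ (k - i + 1)) (\<lambda>t. fps_nth (tanh_rem_fps t) n) half_pi"
  let ?L = "of_real (pi / 2) ^ (n + (k - i) + 1) * (fact n / (2 * \<i> ^ (n + 1))) * ?V"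
  have s: "(\<lambda>j. 1 * b (cos_zero j)) sums ?L" unfolding ik(1) n(2) mult_1_left by (rule sech_square_sums[OF n(1)])
  have V: "of_real (pi ^ (n + (k - i) + 1 + 1)) * ?V \<in> monomial_span (Gamma (1 / 4) ^ 4) (inverse pi) (integral_exponents m p)"
  proof (rule quasi_forms_half_pi[OF tanh_rem_fps_nth_higher_deriv_forms[OF n(1)]])
    fix \<alpha> l assume \<alpha>: "\<alpha> + l = (n + 1) div 2 + (k - i + 1)" "even \<alpha> = True" "l \<le> k - i + 1"
    \<comment> \<open>Now \<open>k = 2 h + 1\<close>, and \<open>\<alpha> = 2 p - h + t\<close>,
      \<open>\<beta> = \<alpha> + t\<close> with \<open>0 \<le> t \<le> 2 h + 2\<close> and
      \<open>h \<le> m - 2\<close>, which gives the same bounds.\<close>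
    define t where "t = k - i + 1 - l"
    obtain h where h: "k = 2 * h + 1" using ik(5) oddE by blast
    have nh: "(n + 1) div 2 = 2 * p - h" "h + 2 \<le> 2 * p" using k h by (auto simp: n_def)
    have \<alpha>t: "\<alpha> = 2 * p - h + t" "t \<le> 2 * h + 2" "h + 2 \<le> m" using \<alpha> nh ik h m by (auto simp: t_def)
    have "3 * \<alpha> + l = (\<alpha> + t) + (n + (k - i) + 1 + 1)" using \<alpha> n(1) by (auto simp: t_def elim!: oddE)
    moreover have "(\<alpha>, \<alpha> + t) \<in> integral_exponents m p"
      unfolding integral_exponents_def using \<alpha>(2) m \<alpha>t nh(2) by (auto simp: of_nat_diff)
    ultimately show "\<exists>\<beta>. 3 * \<alpha> + l = \<beta> + (n + (k - i) + 1 + 1) \<and> (\<alpha>, \<beta>) \<in> integral_exponents m p" by blast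
  qed
  have "of_real pi * ?L \<in> monomial_span (Gamma (1 / 4) ^ 4) (inverse pi) (integral_exponents m p)"
    unfolding pi_half_power_mult[OF n(1)] by (intro monomial_span_scale V)
  thus ?thesis using s by blast
qed

lemma integral_in_monomial_span:
  assumes m: "m \<ge> 1" and p: "p \<ge> m div 2"
  shows "of_real (integral {0..} (\<lambda>x. x ^ (4 * p + 1) / (cos x + cosh x) ^ m)) \<in>
    monomial_span (Gamma (1 / 4) ^ 4) (inverse pi) (integral_exponents m p)"
proof -
  define I where "I = integral {0..} (\<lambda>x::real. x ^ (4 * p + 1) / (cos x + cosh x) ^ m)"
  define sg where "sg = (\<lambda>n::nat. if odd m then - ((-1) ^ n) else (1 :: complex))"
  let ?G = "\<lambda>z::complex. z ^ (4 * p + 1) / cosh z ^ m"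
  let ?U = "{z :: complex. Re z \<noteq> 0}"
  have pts: "cos_zero k \<in> ?U" for k
    using Re_cos_zero_pos[of k] by simp
  have "\<exists>L. (\<lambda>k. sg k * sec_operator m ?G (cos_zero k)) sums L \<and>
    of_real pi * L \<in> monomial_span (Gamma (1 / 4) ^ 4) (inverse pi) (integral_exponents m p)"
  proof (cases "odd m")
    case True
    have "(\<lambda>z. z ^ (4 * p + 1) * (1 / cosh z ^ m)) \<in> rspan_on ?U (jets sech_fun (4 * p + 1) True (m - 1))"
      by (rule jets_0_mult_power[OF sech_power_jets(1)[OF True]])
    hence "?G \<in> rspan_on ?U (jets sech_fun (4 * p + 1) True (m - 1))" by (rule rspan_on_cong) simp
    from sec_operator_jets[OF holomorphic_sech_fun(1) open_off_axis m this] True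
    have *: "sec_operator m ?G \<in> rspan_on ?U (jets sech_fun (4 * p + 1) True (m - 1 + (m - 1)))" by simp
    have "m - 1 + (m - 1) = 2 * m - 2" by simp
    from sums_rspan_on[where s = "\<lambda>k. - ((-1) ^ k)" and z = cos_zero, OF *[unfolded this] pts jet_sum_odd[OF True p]] show ?thesis using True by (simp add: sg_def)
  next
    case False
    have "(\<lambda>z. z ^ (4 * p + 1) * (1 / cosh z ^ m)) \<in> rspan_on ?U (jets sech_square_fun (4 * p + 1) True (m - 2))"
      by (rule jets_0_mult_power[OF sech_power_jets(2)]) (use False m in auto)
    hence "?G \<in> rspan_on ?U (jets sech_square_fun (4 * p + 1) True (m - 2))" by (rule rspan_on_cong) simp
    from sec_operator_jets[OF holomorphic_sech_fun(2) open_off_axis m this] False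
    have *: "sec_operator m ?G \<in> rspan_on ?U (jets sech_square_fun (4 * p + 1) False (m - 2 + (m - 1)))" by simp
    have "m - 2 + (m - 1) = 2 * m - 3" using m False by (cases "m = 1") auto
    from sums_rspan_on[where s = "\<lambda>_. 1" and z = cos_zero, OF *[unfolded this] pts jet_sum_even[OF _ m p]] False show ?thesis by (simp add: sg_def)
  qed
  then obtain L where L: "(\<lambda>k. sg k * sec_operator m ?G (cos_zero k)) sums L"
    "of_real pi * L \<in> monomial_span (Gamma (1 / 4) ^ 4) (inverse pi) (integral_exponents m p)" by blast
  \<comment> \<open>The residue sum is a rational multiple of the integral divided by
    \<open>\<pi>\<close>; this is why \<open>of_real pi * L\<close> has been tracked.\<close>
  have "L = of_real (- ((-1) ^ p) * 2 ^ m / (2 ^ (2 * p + 1) * pi) * I)"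
    using L(1) sec_operator_sum_tendsto_integral[OF m, of p] unfolding sums_def I_def sg_def by (rule LIMSEQ_unique)
  hence "of_real I = of_rat (- ((-1) ^ p) * 2 ^ (2 * p + 1) / 2 ^ m) * (of_real pi * L)"
    by (cases "even p") (simp_all add: of_rat_divide of_rat_mult of_rat_power of_rat_minus field_simps)
  thus ?thesis unfolding I_def[symmetric] using monomial_span_scale[OF L(2)] by simp
qed

theorem theorem1p1:
  fixes X Y :: real and m p :: nat and f :: "real \<Rightarrow> real"
  assumes X: "X = Gamma (1 / 4) ^ 4"
    and Y: "Y = inverse pi"
    and m: "m \<ge> 1"
    and p: "p \<ge> m div 2"
    and f: "f = (\<lambda>x. x ^ (4 * p + 1) / (cos x + cosh x) ^ m)"
  shows "f integrable_on {0..} \<and>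
         integral {0..} f \<in> rat_adjoin2 X Y \<and>
         (\<exists>(S :: (nat \<times> nat) set) (c :: nat \<Rightarrow> nat \<Rightarrow> rat).
            finite S \<and>
            (\<forall>(\<alpha>, \<beta>)\<in>S.
               even \<alpha> = even m \<and>
               2 * int p - int m + 2 \<le> int \<alpha> \<and> int \<alpha> \<le> 2 * int p + int m \<and>
               2 * int p - int m + 2 \<le> int \<beta> \<and> int \<beta> \<le> 2 * int p + 3 * int m - 2) \<and>
            integral {0..} f = (\<Sum>(\<alpha>, \<beta>)\<in>S. of_rat (c \<alpha> \<beta>) * X ^ \<alpha> * Y ^ \<beta>))"
proof -
  obtain S c where S: "finite S" "S \<subseteq> integral_exponents m p"
    "complex_of_real (integral {0..} f) = of_real (\<Sum>(\<alpha>, \<beta>)\<in>S. of_rat (c \<alpha> \<beta>) * X ^ \<alpha> * Y ^ \<beta>)"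
    using integral_in_monomial_span[OF m p] unfolding monomial_span_def f X Y by blast
  hence eq: "integral {0..} f = (\<Sum>(\<alpha>, \<beta>)\<in>S. of_rat (c \<alpha> \<beta>) * X ^ \<alpha> * Y ^ \<beta>)"
    by (simp only: of_real_eq_iff)
  have "f integrable_on {0..}" unfolding f by (rule integrand_integrable(1)[OF m])
  moreover have "integral {0..} f \<in> rat_adjoin2 X Y" unfolding rat_adjoin2_def using S(1) eq by blast
  ultimately show ?thesis using S(1,2) eq unfolding integral_exponents_def
    by (intro conjI exI[of _ S] exI[of _ c]) auto
qed

end
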